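(* Let $\mathcal{E}$ be an elementary topos with a natural numbers object $(N,0,\mathrm{S})$ and let $\varphi$ be an axiom of Heyting arithmetic $\mathbf{HA}$. Then, under the standard interpretation of $\varphi$ on $N$, $\mathcal{E}\models\forall\mathbb{P}\subseteq\mathrm{Lop}\ \forall j\in\mathrm{Lop}.\ j\Vdash_{\mathbb{P}}\varphi$.
   Context: $\mathcal{E}$ is an elementary topos with subobject classifier $\Omega$; formulas are terms of type $\Omega$ of its internal intuitionistic higher-order type theory and $\mathcal{E}\models\varphi$ means the interpretation of $\varphi$ is the top subobject. The language of arithmetic has $0$, successor $\mathrm{S}$ and function symbols for all primitive recursive functions; $\mathbf{HA}$ consists of $\forall x\neg(\mathrm{S}x=0)$, the defining equations of the primitive recursive functions and the induction scheme, over intuitionistic logic. The standard interpretation turns an arithmetic formula into an internal formula whose variables range over $N$ (function symbols interpreted by the corresponding morphisms $N^m\to N$, equality by equality on $N$); this is an $\mathcal{L}_N$-formula. For $j:P\Omega$ write $jp$ for $p\in j$; $\mathrm{is\text{-}lop}[j]:=\forall p.(p\to jp)\wedge\forall p.(j(jp)\to jp)\wedge\forall p,q.((p\to q)\to(jp\to jq))$; $\mathrm{Lop}:=\{j:P\Omega\mid\mathrm{is\text{-}lop}[j]\}$; $j\le k:=\forall p{:}\Omega.(jp\to kp)$; for $\mathbb{P}:P(P\Omega)$, $\mathbb{P}\subseteq\mathrm{Lop}$ means every element of $\mathbb{P}$ lies in $\mathrm{Lop}$, and $\forall k\ge_{\mathbb{P}}j.\chi:=\forall k{:}P\Omega.(k\in\mathbb{P}\to(j\le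 k\to\chi))$. For an object $X$, $\mathcal{L}_X$-formulas are built from atomic $R[\vec x]$ ($R:X^m\to\Omega$ a morphism, including $\bot$) by $\wedge,\vee,\to,\exists x{:}X,\forall x{:}X$. The translation $j\Vdash_{\mathbb{P}}\varphi$: $j\Vdash_{\mathbb{P}}R:=jR$; $\wedge$ componentwise; $j\Vdash_{\mathbb{P}}(\varphi\vee\psi):=j((j\Vdash_{\mathbb{P}}\varphi)\vee(j\Vdash_{\mathbb{P}}\psi))$; $j\Vdash_{\mathbb{P}}(\varphi\to\psi):=\forall k\ge_{\mathbb{P}}j.((k\Vdash_{\mathbb{P}}\varphi)\to(k\Vdash_{\mathbb{P}}\psi))$; $j\Vdash_{\mathbb{P}}\exists y.\varphi:=j(\exists y.\,j\Vdash_{\mathbb{P}}\varphi)$; $j\Vdash_{\mathbb{P}}\forall y.\varphi:=\forall k\ge_{\mathbb{P}}j\,\forall y.\,k\Vdash_{\mathbb{P}}\varphi$. *)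

theory Defs
  imports Main
begin

section \<open>Elementary toposes with chosen structure\<close>

record ('o, 'a) topos =
  Obj :: "'o set"
  Arr :: "'a set"
  Dom :: "'a \<Rightarrow> 'o"
  Cod :: "'a \<Rightarrow> 'o"
  Idt :: "'o \<Rightarrow> 'a"
  Cmp :: "'a \<Rightarrow> 'a \<Rightarrow> 'a" (infixr "\<cdot>\<index>" 75)
  One :: "'o"
  Prod :: "'o \<Rightarrow> 'o \<Rightarrow> 'o"
  Fst :: "'o \<Rightarrow> 'o \<Rightarrow> 'a"
  Snd :: "'o \<Rightarrow> 'o \<Rightarrow> 'a"
  Exp :: "'o \<Rightarrow> 'o \<Rightarrow> 'o"
  Ev :: "'o \<Rightarrow> 'o \<Rightarrow> 'a"
  Omega :: "'o"
  Tru :: "'a"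

text \<open>\<open>Exp E A B\<close> is the exponential \<open>B\<^sup>A\<close>, and \<open>Ev E A B\<close> is the evaluation
  \<open>B\<^sup>A \<times> A \<rightarrow> B\<close>.\<close>

definition Hom :: "('o, 'a) topos \<Rightarrow> 'o \<Rightarrow> 'o \<Rightarrow> 'a set" where
  "Hom E A B = {f \<in> Arr E. Dom E f = A \<and> Cod E f = B}"

definition monic :: "('o, 'a) topos \<Rightarrow> 'a \<Rightarrow> bool" where
  "monic E m \<longleftrightarrow> m \<in> Arr E \<and>
     (\<forall>D\<in>Obj E. \<forall>f\<in>Hom E D (Dom E m). \<forall>g\<in>Hom E D (Dom E m).
        m \<cdot>\<^bsub>E\<^esub> f = m \<cdot>\<^bsub>E\<^esub> g \<longrightarrow> f = g)"

definition bang :: "('o, 'a) topos \<Rightarrow> 'o \<Rightarrow> 'a" where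
  "bang E A = (THE f. f \<in> Hom E A (One E))"

definition pair :: "('o, 'a) topos \<Rightarrow> 'a \<Rightarrow> 'a \<Rightarrow> 'a" where
  "pair E f g = (THE h. h \<in> Hom E (Dom E f) (Prod E (Cod E f) (Cod E g)) \<and>
     Fst E (Cod E f) (Cod E g) \<cdot>\<^bsub>E\<^esub> h = f \<and> Snd E (Cod E f) (Cod E g) \<cdot>\<^bsub>E\<^esub> h = g)"

definition uncurried :: "('o, 'a) topos \<Rightarrow> 'o \<Rightarrow> 'o \<Rightarrow> 'o \<Rightarrow> 'a \<Rightarrow> 'a" where
  "uncurried E C A B h = Ev E A B \<cdot>\<^bsub>E\<^esub> pair E (h \<cdot>\<^bsub>E\<^esub> Fst E C A) (Snd E C A)"

definition curried :: "('o, 'a) topos \<Rightarrow> 'o \<Rightarrow> 'o \<Rightarrow> 'o \<Rightarrow> 'a \<Rightarrow> 'a" where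
  "curried E C A B f = (THE h. h \<in> Hom E C (Exp E A B) \<and> uncurried E C A B h = f)"

definition true_at :: "('o, 'a) topos \<Rightarrow> 'o \<Rightarrow> 'a" where
  "true_at E A = Tru E \<cdot>\<^bsub>E\<^esub> bang E A"

text \<open>\<open>classifies E m \<chi>\<close>: the square with sides \<open>m\<close>, \<open>!\<close>, \<open>\<chi>\<close> and \<open>true\<close> is a pullback.\<close>

definition classifies :: "('o, 'a) topos \<Rightarrow> 'a \<Rightarrow> 'a \<Rightarrow> bool" where
  "classifies E m \<chi> \<longleftrightarrow> m \<in> Arr E \<and> \<chi> \<in> Hom E (Cod E m) (Omega E) \<and>
     \<chi> \<cdot>\<^bsub>E\<^esub> m = true_at E (Dom E m) \<and>
     (\<forall>D\<in>Obj E. \<forall>f\<in>Hom E D (Cod E m). \<chi> \<cdot>\<^bsub>E\<^esub> f = true_at E D \<longrightarrow>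
        (\<exists>!g. g \<in> Hom E D (Dom E m) \<and> m \<cdot>\<^bsub>E\<^esub> g = f))"

locale elementary_topos =
  fixes E :: "('o, 'a) topos"
  assumes dom_obj: "f \<in> Arr E \<Longrightarrow> Dom E f \<in> Obj E"
    and cod_obj: "f \<in> Arr E \<Longrightarrow> Cod E f \<in> Obj E"
    and id_hom: "A \<in> Obj E \<Longrightarrow> Idt E A \<in> Hom E A A"
    and comp_hom: "f \<in> Hom E A B \<Longrightarrow> g \<in> Hom E B C \<Longrightarrow> g \<cdot>\<^bsub>E\<^esub> f \<in> Hom E A C"
    and id_left: "f \<in> Hom E A B \<Longrightarrow> Idt E B \<cdot>\<^bsub>E\<^esub> f = f"
    and id_right: "f \<in> Hom E A B \<Longrightarrow> f \<cdot>\<^bsub>E\<^esub> Idt E A = f"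
    and comp_assoc: "f \<in> Hom E A B \<Longrightarrow> g \<in> Hom E B C \<Longrightarrow> h \<in> Hom E C D \<Longrightarrow>
        (h \<cdot>\<^bsub>E\<^esub> g) \<cdot>\<^bsub>E\<^esub> f = h \<cdot>\<^bsub>E\<^esub> (g \<cdot>\<^bsub>E\<^esub> f)"
    and one_obj: "One E \<in> Obj E"
    and terminal: "A \<in> Obj E \<Longrightarrow> \<exists>!f. f \<in> Hom E A (One E)"
    and prod_obj: "A \<in> Obj E \<Longrightarrow> B \<in> Obj E \<Longrightarrow> Prod E A B \<in> Obj E"
    and fst_hom: "A \<in> Obj E \<Longrightarrow> B \<in> Obj E \<Longrightarrow> Fst E A B \<in> Hom E (Prod E A B) A"
    and snd_hom: "A \<in> Obj E \<Longrightarrow> B \<in> Obj E \<Longrightarrow> Snd E A B \<in> Hom E (Prod E A B) B"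
    and product: "f \<in> Hom E C A \<Longrightarrow> g \<in> Hom E C B \<Longrightarrow>
        \<exists>!h. h \<in> Hom E C (Prod E A B) \<and> Fst E A B \<cdot>\<^bsub>E\<^esub> h = f \<and> Snd E A B \<cdot>\<^bsub>E\<^esub> h = g"
    and equalizer: "f \<in> Hom E A B \<Longrightarrow> g \<in> Hom E A B \<Longrightarrow>
        \<exists>e\<in>Arr E. Cod E e = A \<and> f \<cdot>\<^bsub>E\<^esub> e = g \<cdot>\<^bsub>E\<^esub> e \<and>
          (\<forall>D\<in>Obj E. \<forall>h\<in>Hom E D A. f \<cdot>\<^bsub>E\<^esub> h = g \<cdot>\<^bsub>E\<^esub> h \<longrightarrow>
             (\<exists>!k. k \<in> Hom E D (Dom E e) \<and> e \<cdot>\<^bsub>E\<^esub> k = h))"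
    and exp_obj: "A \<in> Obj E \<Longrightarrow> B \<in> Obj E \<Longrightarrow> Exp E A B \<in> Obj E"
    and ev_hom: "A \<in> Obj E \<Longrightarrow> B \<in> Obj E \<Longrightarrow> Ev E A B \<in> Hom E (Prod E (Exp E A B) A) B"
    and exponential: "A \<in> Obj E \<Longrightarrow> B \<in> Obj E \<Longrightarrow> C \<in> Obj E \<Longrightarrow> f \<in> Hom E (Prod E C A) B \<Longrightarrow>
        \<exists>!h. h \<in> Hom E C (Exp E A B) \<and> uncurried E C A B h = f"
    and omega_obj: "Omega E \<in> Obj E"
    and true_hom: "Tru E \<in> Hom E (One E) (Omega E)"
    and classifier: "monic E m \<Longrightarrow> \<exists>!\<chi>. classifies E m \<chi>"

definition pw :: "('o, 'a) topos \<Rightarrow> 'o \<Rightarrow> 'o" where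
  "pw E X = Exp E X (Omega E)"

definition nno :: "('o, 'a) topos \<Rightarrow> 'o \<Rightarrow> 'a \<Rightarrow> 'a \<Rightarrow> bool" where
  "nno E N z s \<longleftrightarrow> N \<in> Obj E \<and> z \<in> Hom E (One E) N \<and> s \<in> Hom E N N \<and>
     (\<forall>A\<in>Obj E. \<forall>a\<in>Hom E (One E) A. \<forall>f\<in>Hom E A A.
        \<exists>!h. h \<in> Hom E N A \<and> h \<cdot>\<^bsub>E\<^esub> z = a \<and> h \<cdot>\<^bsub>E\<^esub> s = f \<cdot>\<^bsub>E\<^esub> h)"


section \<open>Heyting operations on subobjects\<close>

text \<open>Subobjects of \<open>G\<close> are represented by their characteristic morphisms \<open>G \<rightarrow> \<Omega>\<close>. A morphism
  \<open>f\<close> into \<open>G\<close> factors through the subobject classified by \<open>\<phi>\<close> iff \<open>\<phi> \<circ> f\<close> is \<open>true\<close>; hence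
  \<open>sub_le\<close> is inclusion of subobjects. The logical operations are given by their universal
  properties in this order; the quantifiers are the adjoints of pulling back along the
  projection \<open>G \<times> X \<rightarrow> G\<close>.\<close>

definition sub_le :: "('o, 'a) topos \<Rightarrow> 'o \<Rightarrow> 'a \<Rightarrow> 'a \<Rightarrow> bool" where
  "sub_le E G \<phi> \<psi> \<longleftrightarrow> (\<forall>D\<in>Obj E. \<forall>f\<in>Hom E D G.
     \<phi> \<cdot>\<^bsub>E\<^esub> f = true_at E D \<longrightarrow> \<psi> \<cdot>\<^bsub>E\<^esub> f = true_at E D)"

definition sub_bot :: "('o, 'a) topos \<Rightarrow> 'o \<Rightarrow> 'a" where
  "sub_bot E G = (THE c. c \<in> Hom E G (Omega E) \<and>
     (\<forall>d\<in>Hom E G (Omega E). sub_le E G c d))"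

definition sub_meet :: "('o, 'a) topos \<Rightarrow> 'o \<Rightarrow> 'a \<Rightarrow> 'a \<Rightarrow> 'a" where
  "sub_meet E G \<phi> \<psi> = (THE c. c \<in> Hom E G (Omega E) \<and>
     (\<forall>d\<in>Hom E G (Omega E). sub_le E G d c \<longleftrightarrow> sub_le E G d \<phi> \<and> sub_le E G d \<psi>))"

definition sub_join :: "('o, 'a) topos \<Rightarrow> 'o \<Rightarrow> 'a \<Rightarrow> 'a \<Rightarrow> 'a" where
  "sub_join E G \<phi> \<psi> = (THE c. c \<in> Hom E G (Omega E) \<and>
     (\<forall>d\<in>Hom E G (Omega E). sub_le E G c d \<longleftrightarrow> sub_le E G \<phi> d \<and> sub_le E G \<psi> d))"

definition sub_imp :: "('o, 'a) topos \<Rightarrow> 'o \<Rightarrow> 'a \<Rightarrow> 'a \<Rightarrow> 'a" where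
  "sub_imp E G \<phi> \<psi> = (THE c. c \<in> Hom E G (Omega E) \<and>
     (\<forall>d\<in>Hom E G (Omega E). sub_le E G d c \<longleftrightarrow> sub_le E G (sub_meet E G d \<phi>) \<psi>))"

definition sub_all :: "('o, 'a) topos \<Rightarrow> 'o \<Rightarrow> 'o \<Rightarrow> 'a \<Rightarrow> 'a" where
  "sub_all E G X \<phi> = (THE c. c \<in> Hom E G (Omega E) \<and>
     (\<forall>d\<in>Hom E G (Omega E). sub_le E G d c \<longleftrightarrow> sub_le E (Prod E G X) (d \<cdot>\<^bsub>E\<^esub> Fst E G X) \<phi>))"

definition sub_ex :: "('o, 'a) topos \<Rightarrow> 'o \<Rightarrow> 'o \<Rightarrow> 'a \<Rightarrow> 'a" where
  "sub_ex E G X \<phi> = (THE c. c \<in> Hom E G (Omega E) \<and>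
     (\<forall>d\<in>Hom E G (Omega E). sub_le E G c d \<longleftrightarrow> sub_le E (Prod E G X) \<phi> (d \<cdot>\<^bsub>E\<^esub> Fst E G X)))"

definition eq_at :: "('o, 'a) topos \<Rightarrow> 'o \<Rightarrow> 'a" where
  "eq_at E X = (THE \<chi>. classifies E (pair E (Idt E X) (Idt E X)) \<chi>)"


section \<open>The internal higher-order type theory\<close>

text \<open>Types are the objects of the topos and every morphism is a function symbol. Variables are de
  Bruijn indices; the head of a context is the type of variable 0.\<close>

datatype ('o, 'a) tm =
    TVar nat
  | TStar
  | TPair "('o, 'a) tm" "('o, 'a) tm"
  | TApp 'a "('o, 'a) tm"
  | TEq "('o, 'a) tm" "('o, 'a) tm"
  | TMem "('o, 'a) tm" "('o, 'a) tm"
  | TCompr 'o "('o, 'a) tm"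
  | TTop
  | TBot
  | TAnd "('o, 'a) tm" "('o, 'a) tm"
  | TOr "('o, 'a) tm" "('o, 'a) tm"
  | TImp "('o, 'a) tm" "('o, 'a) tm"
  | TAll 'o "('o, 'a) tm"
  | TEx 'o "('o, 'a) tm"

inductive typed :: "('o, 'a) topos \<Rightarrow> 'o list \<Rightarrow> ('o, 'a) tm \<Rightarrow> 'o \<Rightarrow> bool" for E where
  "i < length \<Gamma> \<Longrightarrow> typed E \<Gamma> (TVar i) (\<Gamma> ! i)"
| "typed E \<Gamma> TStar (One E)"
| "typed E \<Gamma> t A \<Longrightarrow> typed E \<Gamma> u B \<Longrightarrow> typed E \<Gamma> (TPair t u) (Prod E A B)"
| "f \<in> Hom E A B \<Longrightarrow> typed E \<Gamma> t A \<Longrightarrow> typed E \<Gamma> (TApp f t) B"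
| "typed E \<Gamma> t A \<Longrightarrow> typed E \<Gamma> u A \<Longrightarrow> typed E \<Gamma> (TEq t u) (Omega E)"
| "typed E \<Gamma> t A \<Longrightarrow> typed E \<Gamma> u (pw E A) \<Longrightarrow> typed E \<Gamma> (TMem t u) (Omega E)"
| "X \<in> Obj E \<Longrightarrow> typed E (X # \<Gamma>) \<phi> (Omega E) \<Longrightarrow> typed E \<Gamma> (TCompr X \<phi>) (pw E X)"
| "typed E \<Gamma> TTop (Omega E)"
| "typed E \<Gamma> TBot (Omega E)"
| "typed E \<Gamma> \<phi> (Omega E) \<Longrightarrow> typed E \<Gamma> \<psi> (Omega E) \<Longrightarrow> typed E \<Gamma> (TAnd \<phi> \<psi>) (Omega E)"
| "typed E \<Gamma> \<phi> (Omega E) \<Longrightarrow> typed E \<Gamma> \<psi> (Omega E) \<Longrightarrow> typed E \<Gamma> (TOr \<phi> \<psi>) (Omega E)"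
| "typed E \<Gamma> \<phi> (Omega E) \<Longrightarrow> typed E \<Gamma> \<psi> (Omega E) \<Longrightarrow> typed E \<Gamma> (TImp \<phi> \<psi>) (Omega E)"
| "X \<in> Obj E \<Longrightarrow> typed E (X # \<Gamma>) \<phi> (Omega E) \<Longrightarrow> typed E \<Gamma> (TAll X \<phi>) (Omega E)"
| "X \<in> Obj E \<Longrightarrow> typed E (X # \<Gamma>) \<phi> (Omega E) \<Longrightarrow> typed E \<Gamma> (TEx X \<phi>) (Omega E)"

fun ctx :: "('o, 'a) topos \<Rightarrow> 'o list \<Rightarrow> 'o" where
  "ctx E [] = One E"
| "ctx E (X # \<Gamma>) = Prod E (ctx E \<Gamma>) X"

fun proj :: "('o, 'a) topos \<Rightarrow> 'o list \<Rightarrow> nat \<Rightarrow> 'a" where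
  "proj E [] i = undefined"
| "proj E (X # \<Gamma>) 0 = Snd E (ctx E \<Gamma>) X"
| "proj E (X # \<Gamma>) (Suc i) = proj E \<Gamma> i \<cdot>\<^bsub>E\<^esub> Fst E (ctx E \<Gamma>) X"

text \<open>For \<open>t\<close> of type \<open>A\<close> in context \<open>\<Gamma>\<close>, \<open>sem E \<Gamma> t\<close> is its interpretation
  \<open>ctx E \<Gamma> \<rightarrow> A\<close>; in the clauses for \<open>TEq\<close> and \<open>TMem\<close> the type is recovered as a codomain.\<close>

fun sem :: "('o, 'a) topos \<Rightarrow> 'o list \<Rightarrow> ('o, 'a) tm \<Rightarrow> 'a" where
  "sem E \<Gamma> (TVar i) = proj E \<Gamma> i"
| "sem E \<Gamma> TStar = bang E (ctx E \<Gamma>)"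
| "sem E \<Gamma> (TPair t u) = pair E (sem E \<Gamma> t) (sem E \<Gamma> u)"
| "sem E \<Gamma> (TApp f t) = f \<cdot>\<^bsub>E\<^esub> sem E \<Gamma> t"
| "sem E \<Gamma> (TEq t u) = eq_at E (Cod E (sem E \<Gamma> t)) \<cdot>\<^bsub>E\<^esub> pair E (sem E \<Gamma> t) (sem E \<Gamma> u)"
| "sem E \<Gamma> (TMem t u) =
     Ev E (Cod E (sem E \<Gamma> t)) (Omega E) \<cdot>\<^bsub>E\<^esub> pair E (sem E \<Gamma> u) (sem E \<Gamma> t)"
| "sem E \<Gamma> (TCompr X \<phi>) = curried E (ctx E \<Gamma>) X (Omega E) (sem E (X # \<Gamma>) \<phi>)"
| "sem E \<Gamma> TTop = true_at E (ctx E \<Gamma>)"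
| "sem E \<Gamma> TBot = sub_bot E (ctx E \<Gamma>)"
| "sem E \<Gamma> (TAnd \<phi> \<psi>) = sub_meet E (ctx E \<Gamma>) (sem E \<Gamma> \<phi>) (sem E \<Gamma> \<psi>)"
| "sem E \<Gamma> (TOr \<phi> \<psi>) = sub_join E (ctx E \<Gamma>) (sem E \<Gamma> \<phi>) (sem E \<Gamma> \<psi>)"
| "sem E \<Gamma> (TImp \<phi> \<psi>) = sub_imp E (ctx E \<Gamma>) (sem E \<Gamma> \<phi>) (sem E \<Gamma> \<psi>)"
| "sem E \<Gamma> (TAll X \<phi>) = sub_all E (ctx E \<Gamma>) X (sem E (X # \<Gamma>) \<phi>)"
| "sem E \<Gamma> (TEx X \<phi>) = sub_ex E (ctx E \<Gamma>) X (sem E (X # \<Gamma>) \<phi>)"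

definition holds :: "('o, 'a) topos \<Rightarrow> 'o list \<Rightarrow> ('o, 'a) tm \<Rightarrow> bool" where
  "holds E \<Gamma> \<phi> \<longleftrightarrow> typed E \<Gamma> \<phi> (Omega E) \<and> sem E \<Gamma> \<phi> = true_at E (ctx E \<Gamma>)"

text \<open>The tuple of \<open>t\<^sub>0, \<dots>, t\<^sub>m\<^sub>-\<^sub>1\<close>, of type \<open>ctx E [A\<^sub>0, \<dots>, A\<^sub>m\<^sub>-\<^sub>1]\<close>; in
  particular \<open>ctx E (replicate m X)\<close> is the power \<open>X\<^sup>m\<close>.\<close>

fun tuple :: "('o, 'a) tm list \<Rightarrow> ('o, 'a) tm" where
  "tuple [] = TStar"
| "tuple (t # ts) = TPair (tuple ts) t"


section \<open>Local operators and the forcing translation\<close>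

text \<open>Variables of type \<open>P\<Omega>\<close> and \<open>P(P\<Omega>)\<close> are passed as de Bruijn indices.\<close>

abbreviation at_op :: "nat \<Rightarrow> ('o, 'a) tm \<Rightarrow> ('o, 'a) tm" where
  "at_op j p \<equiv> TMem p (TVar j)"

definition is_lop :: "('o, 'a) topos \<Rightarrow> nat \<Rightarrow> ('o, 'a) tm" where
  "is_lop E j =
     TAnd (TAll (Omega E) (TImp (TVar 0) (at_op (j + 1) (TVar 0))))
    (TAnd (TAll (Omega E) (TImp (at_op (j + 1) (at_op (j + 1) (TVar 0))) (at_op (j + 1) (TVar 0))))
          (TAll (Omega E) (TAll (Omega E) (TImp (TImp (TVar 1) (TVar 0))
             (TImp (at_op (j + 2) (TVar 1)) (at_op (j + 2) (TVar 0)))))))"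

definition Lop :: "('o, 'a) topos \<Rightarrow> ('o, 'a) tm" where
  "Lop E = TCompr (pw E (Omega E)) (is_lop E 0)"

definition op_le :: "('o, 'a) topos \<Rightarrow> nat \<Rightarrow> nat \<Rightarrow> ('o, 'a) tm" where
  "op_le E j k = TAll (Omega E) (TImp (at_op (j + 1) (TVar 0)) (at_op (k + 1) (TVar 0)))"

definition sub_Lop :: "('o, 'a) topos \<Rightarrow> nat \<Rightarrow> ('o, 'a) tm" where
  "sub_Lop E P = TAll (pw E (Omega E)) (TImp (TMem (TVar 0) (TVar (P + 1))) (TMem (TVar 0) (Lop E)))"

text \<open>\<open>all_ge E P j \<chi>\<close> binds \<open>k\<close> as variable 0 of \<open>\<chi>\<close>.\<close>

definition all_ge :: "('o, 'a) topos \<Rightarrow> nat \<Rightarrow> nat \<Rightarrow> ('o, 'a) tm \<Rightarrow> ('o, 'a) tm" where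
  "all_ge E P j \<chi> = TAll (pw E (Omega E))
     (TImp (TMem (TVar 0) (TVar (P + 1))) (TImp (op_le E (j + 1) 0) \<chi>))"

text \<open>Formulas over an object \<open>X\<close>: \<open>LAtom R [i\<^sub>1, \<dots>, i\<^sub>m]\<close> is \<open>R\<close> applied to variables, for a
  morphism \<open>R\<close> from \<open>X\<^sup>m\<close> to \<open>\<Omega>\<close>. Indices count only variables of type \<open>X\<close>.\<close>

datatype 'a lfm =
    LAtom 'a "nat list"
  | LAnd "'a lfm" "'a lfm"
  | LOr "'a lfm" "'a lfm"
  | LImp "'a lfm" "'a lfm"
  | LEx "'a lfm"
  | LAll "'a lfm"

text \<open>\<open>v\<close> maps the variables of the \<open>X\<close>-formula to variables of the ambient context, which also
  contains the operators; \<open>up v\<close> is its extension under a binder of type \<open>X\<close>.\<close>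

definition up :: "(nat \<Rightarrow> nat) \<Rightarrow> nat \<Rightarrow> nat" where
  "up v i = (case i of 0 \<Rightarrow> 0 | Suc i' \<Rightarrow> Suc (v i'))"

fun force :: "('o, 'a) topos \<Rightarrow> 'o \<Rightarrow> nat \<Rightarrow> nat \<Rightarrow> (nat \<Rightarrow> nat) \<Rightarrow> 'a lfm \<Rightarrow> ('o, 'a) tm" where
  "force E X P j v (LAtom R is) = at_op j (TApp R (tuple (map (\<lambda>i. TVar (v i)) is)))"
| "force E X P j v (LAnd \<phi> \<psi>) = TAnd (force E X P j v \<phi>) (force E X P j v \<psi>)"
| "force E X P j v (LOr \<phi> \<psi>) = at_op j (TOr (force E X P j v \<phi>) (force E X P j v \<psi>))"
| "force E X P j v (LImp \<phi> \<psi>) = all_ge E P j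
     (TImp (force E X (P + 1) 0 (\<lambda>i. v i + 1) \<phi>) (force E X (P + 1) 0 (\<lambda>i. v i + 1) \<psi>))"
| "force E X P j v (LEx \<phi>) = at_op j (TEx X (force E X (P + 1) (j + 1) (up v) \<phi>))"
| "force E X P j v (LAll \<phi>) = all_ge E P j
     (TAll X (force E X (P + 2) 1 (up (\<lambda>i. v i + 1)) \<phi>))"


section \<open>Heyting arithmetic\<close>

text \<open>One function symbol for each primitive recursive definition. \<open>PComp m f gs\<close> is the \<open>m\<close>-ary
  composite of \<open>f\<close> with the list \<open>gs\<close>; \<open>PRec f g\<close> recurses on its first argument. The constant
  \<open>0\<close> and the successor are \<open>PZero\<close> and \<open>PSucc\<close>.\<close>

datatype prim =
    PZero
  | PSucc
  | PProj nat nat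
  | PComp nat prim "prim list"
  | PRec prim prim

fun arity :: "prim \<Rightarrow> nat" where
  "arity PZero = 0"
| "arity PSucc = 1"
| "arity (PProj m i) = m"
| "arity (PComp m f gs) = m"
| "arity (PRec f g) = arity f + 1"

fun prim_wf :: "prim \<Rightarrow> bool" where
  "prim_wf PZero \<longleftrightarrow> True"
| "prim_wf PSucc \<longleftrightarrow> True"
| "prim_wf (PProj m i) \<longleftrightarrow> i < m"
| "prim_wf (PComp m f gs) \<longleftrightarrow>
     prim_wf f \<and> arity f = length gs \<and> (\<forall>g\<in>set gs. prim_wf g \<and> arity g = m)"
| "prim_wf (PRec f g) \<longleftrightarrow> prim_wf f \<and> prim_wf g \<and> arity g = arity f + 2"

datatype atm = AVar nat | AFun prim "atm list"

abbreviation AZero :: atm where "AZero \<equiv> AFun PZero []"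
abbreviation ASuc :: "atm \<Rightarrow> atm" where "ASuc t \<equiv> AFun PSucc [t]"

datatype afm =
    AEq atm atm
  | ABot
  | AAnd afm afm
  | AOr afm afm
  | AImp afm afm
  | AEx afm
  | AAll afm

abbreviation ANeg :: "afm \<Rightarrow> afm" where "ANeg \<phi> \<equiv> AImp \<phi> ABot"

text \<open>Well-formedness with free variables among \<open>0, \<dots>, n - 1\<close>.\<close>

fun atm_wf :: "nat \<Rightarrow> atm \<Rightarrow> bool" where
  "atm_wf n (AVar i) \<longleftrightarrow> i < n"
| "atm_wf n (AFun f ts) \<longleftrightarrow> prim_wf f \<and> length ts = arity f \<and> (\<forall>t\<in>set ts. atm_wf n t)"

fun afm_wf :: "nat \<Rightarrow> afm \<Rightarrow> bool" where
  "afm_wf n (AEq t u) \<longleftrightarrow> atm_wf n t \<and> atm_wf n u"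
| "afm_wf n ABot \<longleftrightarrow> True"
| "afm_wf n (AAnd \<phi> \<psi>) \<longleftrightarrow> afm_wf n \<phi> \<and> afm_wf n \<psi>"
| "afm_wf n (AOr \<phi> \<psi>) \<longleftrightarrow> afm_wf n \<phi> \<and> afm_wf n \<psi>"
| "afm_wf n (AImp \<phi> \<psi>) \<longleftrightarrow> afm_wf n \<phi> \<and> afm_wf n \<psi>"
| "afm_wf n (AEx \<phi>) \<longleftrightarrow> afm_wf (Suc n) \<phi>"
| "afm_wf n (AAll \<phi>) \<longleftrightarrow> afm_wf (Suc n) \<phi>"

fun atm_subst :: "(nat \<Rightarrow> atm) \<Rightarrow> atm \<Rightarrow> atm" where
  "atm_subst \<sigma> (AVar i) = \<sigma> i"
| "atm_subst \<sigma> (AFun f ts) = AFun f (map (atm_subst \<sigma>) ts)"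

definition under :: "(nat \<Rightarrow> atm) \<Rightarrow> nat \<Rightarrow> atm" where
  "under \<sigma> i = (case i of 0 \<Rightarrow> AVar 0 | Suc i' \<Rightarrow> atm_subst (\<lambda>k. AVar (Suc k)) (\<sigma> i'))"

fun afm_subst :: "(nat \<Rightarrow> atm) \<Rightarrow> afm \<Rightarrow> afm" where
  "afm_subst \<sigma> (AEq t u) = AEq (atm_subst \<sigma> t) (atm_subst \<sigma> u)"
| "afm_subst \<sigma> ABot = ABot"
| "afm_subst \<sigma> (AAnd \<phi> \<psi>) = AAnd (afm_subst \<sigma> \<phi>) (afm_subst \<sigma> \<psi>)"
| "afm_subst \<sigma> (AOr \<phi> \<psi>) = AOr (afm_subst \<sigma> \<phi>) (afm_subst \<sigma> \<psi>)"
| "afm_subst \<sigma> (AImp \<phi> \<psi>) = AImp (afm_subst \<sigma> \<phi>) (afm_subst \<sigma> \<psi>)"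
| "afm_subst \<sigma> (AEx \<phi>) = AEx (afm_subst (under \<sigma>) \<phi>)"
| "afm_subst \<sigma> (AAll \<phi>) = AAll (afm_subst (under \<sigma>) \<phi>)"

definition subst_zero :: "afm \<Rightarrow> afm" where
  "subst_zero \<phi> = afm_subst (\<lambda>i. case i of 0 \<Rightarrow> AZero | Suc i' \<Rightarrow> AVar i') \<phi>"

text \<open>\<open>\<phi>[S x / x]\<close> for \<open>x\<close> variable 0, still in a context containing \<open>x\<close>.\<close>

definition subst_suc :: "afm \<Rightarrow> afm" where
  "subst_suc \<phi> = afm_subst (\<lambda>i. case i of 0 \<Rightarrow> ASuc (AVar 0) | Suc i' \<Rightarrow> AVar (Suc i')) \<phi>"

definition vars :: "nat \<Rightarrow> nat \<Rightarrow> atm list" where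
  "vars k m = map AVar [k..<k + m]"

text \<open>\<open>HA_axiom n \<phi>\<close>: \<open>\<phi>\<close> is an axiom with free variables among \<open>0, \<dots>, n - 1\<close>. By rule \<open>gen\<close>
  this comprises both the axioms with free variables and their universal closures (\<open>n = 0\<close>).\<close>

inductive HA_axiom :: "nat \<Rightarrow> afm \<Rightarrow> bool" where
  succ_nonzero: "HA_axiom n (AAll (ANeg (AEq (ASuc (AVar 0)) AZero)))"
| proj_eq: "prim_wf (PProj m i) \<Longrightarrow> m \<le> n \<Longrightarrow>
    HA_axiom n (AEq (AFun (PProj m i) (vars 0 m)) (AVar i))"
| comp_eq: "prim_wf (PComp m f gs) \<Longrightarrow> m \<le> n \<Longrightarrow>
    HA_axiom n (AEq (AFun (PComp m f gs) (vars 0 m)) (AFun f (map (\<lambda>g. AFun g (vars 0 m)) gs)))"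
| rec_zero: "prim_wf (PRec f g) \<Longrightarrow> arity f \<le> n \<Longrightarrow>
    HA_axiom n (AEq (AFun (PRec f g) (AZero # vars 0 (arity f))) (AFun f (vars 0 (arity f))))"
| rec_suc: "prim_wf (PRec f g) \<Longrightarrow> arity f + 1 \<le> n \<Longrightarrow>
    HA_axiom n (AEq (AFun (PRec f g) (ASuc (AVar 0) # vars 1 (arity f)))
      (AFun g (AVar 0 # AFun (PRec f g) (AVar 0 # vars 1 (arity f)) # vars 1 (arity f))))"
| induction: "afm_wf (Suc n) \<phi> \<Longrightarrow>
    HA_axiom n (AImp (AAnd (subst_zero \<phi>) (AAll (AImp \<phi> (subst_suc \<phi>)))) (AAll \<phi>))"
| gen: "HA_axiom (Suc n) \<phi> \<Longrightarrow> HA_axiom n (AAll \<phi>)"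


section \<open>The standard interpretation of arithmetic\<close>

definition mor_tuple :: "('o, 'a) topos \<Rightarrow> 'o \<Rightarrow> 'a list \<Rightarrow> 'a" where
  "mor_tuple E D fs = foldr (\<lambda>f h. pair E h f) fs (bang E D)"

text \<open>The morphism \<open>N\<^sup>m \<rightarrow> N\<close> of an \<open>m\<close>-ary function symbol. Since the first argument is the
  last factor of \<open>N\<^sup>m\<^sup>+\<^sup>1 = N\<^sup>m \<times> N\<close>, the clause for \<open>PRec\<close> says \<open>h(0, x) = f(x)\<close> and
  \<open>h(S y, x) = g(y, h(y, x), x)\<close>.\<close>

fun prim_mor :: "('o, 'a) topos \<Rightarrow> 'o \<Rightarrow> 'a \<Rightarrow> 'a \<Rightarrow> prim \<Rightarrow> 'a" where
  "prim_mor E N z s PZero = z"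
| "prim_mor E N z s PSucc = s \<cdot>\<^bsub>E\<^esub> proj E [N] 0"
| "prim_mor E N z s (PProj m i) = proj E (replicate m N) i"
| "prim_mor E N z s (PComp m f gs) =
     prim_mor E N z s f \<cdot>\<^bsub>E\<^esub> mor_tuple E (ctx E (replicate m N)) (map (prim_mor E N z s) gs)"
| "prim_mor E N z s (PRec f g) =
     (let D = ctx E (replicate (arity f) N); p = Fst E D N; q = Snd E D N in
      THE h. h \<in> Hom E (Prod E D N) N \<and>
        h \<cdot>\<^bsub>E\<^esub> pair E (Idt E D) (z \<cdot>\<^bsub>E\<^esub> bang E D) = prim_mor E N z s f \<and>
        h \<cdot>\<^bsub>E\<^esub> pair E p (s \<cdot>\<^bsub>E\<^esub> q) = prim_mor E N z s g \<cdot>\<^bsub>E\<^esub> pair E (pair E p h) q)"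

fun std_tm :: "('o, 'a) topos \<Rightarrow> 'o \<Rightarrow> 'a \<Rightarrow> 'a \<Rightarrow> atm \<Rightarrow> ('o, 'a) tm" where
  "std_tm E N z s (AVar i) = TVar i"
| "std_tm E N z s (AFun f ts) = TApp (prim_mor E N z s f) (tuple (map (std_tm E N z s) ts))"

text \<open>An equation with variables among the \<open>n\<close> variables in scope becomes an atomic formula given
  by a morphism \<open>N\<^sup>n \<rightarrow> \<Omega>\<close>.\<close>

fun std :: "('o, 'a) topos \<Rightarrow> 'o \<Rightarrow> 'a \<Rightarrow> 'a \<Rightarrow> nat \<Rightarrow> afm \<Rightarrow> 'a lfm" where
  "std E N z s n (AEq t u) =
     LAtom (sem E (replicate n N) (TEq (std_tm E N z s t) (std_tm E N z s u))) [0..<n]"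
| "std E N z s n ABot = LAtom (sem E [] TBot) []"
| "std E N z s n (AAnd \<phi> \<psi>) = LAnd (std E N z s n \<phi>) (std E N z s n \<psi>)"
| "std E N z s n (AOr \<phi> \<psi>) = LOr (std E N z s n \<phi>) (std E N z s n \<psi>)"
| "std E N z s n (AImp \<phi> \<psi>) = LImp (std E N z s n \<phi>) (std E N z s n \<psi>)"
| "std E N z s n (AEx \<phi>) = LEx (std E N z s (Suc n) \<phi>)"
| "std E N z s n (AAll \<phi>) = LAll (std E N z s (Suc n) \<phi>)"

end

theory Submission
  imports Defs
begin

text \<open>Formulas are evaluated on generalized elements: \<open>\<phi>\<close> holds at \<open>f : D \<rightarrow> G\<close> iff \<open>\<phi> \<circ> f\<close> is
  \<open>true\<close>. Morphisms into \<open>\<Omega>\<close> are determined by where they hold, which gives Kripke--Joyal clauses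
  for all connectives. In these terms \<open>j \<tturnstile>\<^sub>P \<phi>\<close> is monotone in \<open>j\<close> along \<open>P \<subseteq> Lop\<close>. Hence, for
  the induction axiom, at every \<open>k \<ge> j\<close> in \<open>P\<close> the predicate \<open>k \<tturnstile>\<^sub>P \<phi>(x)\<close> of \<open>x\<close> contains \<open>0\<close>
  and is closed under successor, and induction inside the topos applies. The equational axioms are
  true equations between morphisms and pass through \<open>p \<rightarrow> jp\<close>; \<open>S x = 0\<close> implies \<open>\<bottom>\<close> internally
  and \<open>k\<close> preserves this implication.\<close>

text \<open>Monotonicity of forcing in \<open>j\<close> has one delicate point: the clauses for
  disjunction and \<open>\<exists>\<close> contain the operator twice, outside and inside. The
  relation \<open>j \<le> k\<close> replaces the outer occurrence while the argument stays fixed,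
  and monotonicity of \<open>k\<close> as an operator then raises the argument; this is where
  membership of \<open>k\<close> in \<open>P\<close> enters. For implication and
  \<open>\<forall>\<close>, transitivity of \<open>\<le>\<close> is the whole argument.

  No calculus of the internal logic is set up. The logical operations are given by descriptions, so
  existence has to be shown for each: meets, implications and \<open>\<forall>\<close> are exhibited
  as equations between morphisms. From then on a formula is handled only through the stages at which
  it is true.

  Substitution is treated on values and not on \<open>X\<close>-formulas, because an arithmetical
  equation becomes an atom whose morphism depends on the number of variables in scope.

  The natural numbers object is given without parameters, whereas the induction predicate and
  primitive recursion both have them. Parameters are absorbed by \<open>\<forall>\<close> in the
  first case and by an exponential in the second.\<close>

context elementary_topos
begin

section \<open>Calculus of composites, pairs and exponential transposes\<close>

abbreviation cmp :: "'a \<Rightarrow> 'a \<Rightarrow> 'a" (infixr "\<bullet>" 75) where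
  "g \<bullet> f \<equiv> Cmp E g f"

abbreviation \<Omega> :: 'o where "\<Omega> \<equiv> Omega E"

text \<open>Membership in a hom-set dissolves into conditions on \<open>Dom\<close> and
  \<open>Cod\<close>, so that the typing side conditions of the rewrite rules below become equations
  that the simplifier discharges itself.\<close>

lemma Hom_iff [simp]: "f \<in> Hom E A B \<longleftrightarrow> f \<in> Arr E \<and> Dom E f = A \<and> Cod E f = B"
  by (auto simp: Hom_def)

declare dom_obj [simp] cod_obj [simp] one_obj [simp] prod_obj [simp] exp_obj [simp] omega_obj [simp]

lemma cmp_simps [simp]:
  assumes "f \<in> Arr E" "g \<in> Arr E" "Cod E f = Dom E g"
  shows "g \<bullet> f \<in> Arr E" "Dom E (g \<bullet> f) = Dom E f" "Cod E (g \<bullet> f) = Cod E g"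
  using comp_hom[of f "Dom E f" "Dom E g" g "Cod E g"] assms by auto

text \<open>The normal form of composites is nested to the right. Proofs that have to contract the
  left part of a composite first flip this rule or delete it.\<close>

lemma cmp_assoc [simp]:
  assumes "f \<in> Arr E" "g \<in> Arr E" "h \<in> Arr E" "Cod E f = Dom E g" "Cod E g = Dom E h"
  shows "(h \<bullet> g) \<bullet> f = h \<bullet> (g \<bullet> f)"
  using comp_assoc[of f "Dom E f" "Dom E g" g "Dom E h" h "Cod E h"] assms by auto

lemma Idt_simps [simp]:
  assumes "A \<in> Obj E"
  shows "Idt E A \<in> Arr E" "Dom E (Idt E A) = A" "Cod E (Idt E A) = A"
  using id_hom[OF assms] by auto

lemma Idt_cmp [simp]: "f \<in> Arr E \<Longrightarrow> Cod E f = B \<Longrightarrow> Idt E B \<bullet> f = f"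
  using id_left[of f "Dom E f" B] by simp

lemma cmp_Idt [simp]: "f \<in> Arr E \<Longrightarrow> Dom E f = A \<Longrightarrow> f \<bullet> Idt E A = f"
  using id_right[of f A "Cod E f"] by simp

lemma bang_simps [simp]:
  assumes "A \<in> Obj E"
  shows "bang E A \<in> Arr E" "Dom E (bang E A) = A" "Cod E (bang E A) = One E"
  using theI'[OF terminal[OF assms]] unfolding bang_def by auto

lemma bang_unique: "f \<in> Arr E \<Longrightarrow> Cod E f = One E \<Longrightarrow> f = bang E (Dom E f)"
  using terminal[of "Dom E f"] bang_simps[of "Dom E f"] by auto

lemma bang_cmp [simp]: "f \<in> Arr E \<Longrightarrow> Cod E f = A \<Longrightarrow> bang E A \<bullet> f = bang E (Dom E f)"
  using bang_unique[of "bang E A \<bullet> f"] by auto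

lemma Tru_simps [simp]: "Tru E \<in> Arr E" "Dom E (Tru E) = One E" "Cod E (Tru E) = \<Omega>"
  using true_hom by auto

lemma true_at_simps [simp]:
  assumes "A \<in> Obj E"
  shows "true_at E A \<in> Arr E" "Dom E (true_at E A) = A" "Cod E (true_at E A) = \<Omega>"
  using assms by (auto simp: true_at_def)

lemma true_at_cmp [simp]:
  "f \<in> Arr E \<Longrightarrow> Cod E f = A \<Longrightarrow> true_at E A \<bullet> f = true_at E (Dom E f)"
  by (auto simp: true_at_def)

lemma Fst_simps [simp]:
  assumes "A \<in> Obj E" "B \<in> Obj E"
  shows "Fst E A B \<in> Arr E" "Dom E (Fst E A B) = Prod E A B" "Cod E (Fst E A B) = A"
  using fst_hom[OF assms] by auto

lemma Snd_simps [simp]: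
  assumes "A \<in> Obj E" "B \<in> Obj E"
  shows "Snd E A B \<in> Arr E" "Dom E (Snd E A B) = Prod E A B" "Cod E (Snd E A B) = B"
  using snd_hom[OF assms] by auto

lemma pair_simps [simp]:
  assumes "f \<in> Arr E" "g \<in> Arr E" "Dom E f = Dom E g"
  shows "pair E f g \<in> Arr E" "Dom E (pair E f g) = Dom E g"
    "Cod E (pair E f g) = Prod E (Cod E f) (Cod E g)"
    "Cod E f = A \<Longrightarrow> Cod E g = B \<Longrightarrow> Fst E A B \<bullet> pair E f g = f"
    "Cod E f = A \<Longrightarrow> Cod E g = B \<Longrightarrow> Snd E A B \<bullet> pair E f g = g"
  using theI'[OF product[of f "Dom E f" "Cod E f" g "Cod E g"]] assms
  unfolding pair_def by auto

lemma pair_eta: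
  assumes "h \<in> Arr E" "Cod E h = Prod E A B" "A \<in> Obj E" "B \<in> Obj E"
  shows "pair E (Fst E A B \<bullet> h) (Snd E A B \<bullet> h) = h"
  using the1_equality[OF product[of "Fst E A B \<bullet> h" "Dom E h" A "Snd E A B \<bullet> h" B], of h] assms
  by (simp add: pair_def)

lemma pair_unique:
  assumes "h \<in> Arr E" "Cod E h = Prod E A B" "A \<in> Obj E" "B \<in> Obj E"
    "Fst E A B \<bullet> h = f" "Snd E A B \<bullet> h = g"
  shows "h = pair E f g"
  using pair_eta[OF assms(1-4)] assms(5,6) by metis

text \<open>Substitution into a context: composition is pushed inside pairs. The rule is deleted
  where a pair has to stay visible as one morphism.\<close>

lemma pair_cmp [simp]:
  assumes "f \<in> Arr E" "g \<in> Arr E" "Dom E f = Dom E g" "h \<in> Arr E" "Cod E h = Dom E g"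
  shows "pair E f g \<bullet> h = pair E (f \<bullet> h) (g \<bullet> h)"
proof (rule pair_unique)
  show "Fst E (Cod E f) (Cod E g) \<bullet> (pair E f g \<bullet> h) = f \<bullet> h"
    "Snd E (Cod E f) (Cod E g) \<bullet> (pair E f g \<bullet> h) = g \<bullet> h"
    using assms by (simp_all flip: cmp_assoc)
qed (use assms in auto)

lemma pair_Fst_Snd [simp]:
  "A \<in> Obj E \<Longrightarrow> B \<in> Obj E \<Longrightarrow> pair E (Fst E A B) (Snd E A B) = Idt E (Prod E A B)"
  by (rule pair_unique[of _ A B, symmetric]) auto

lemma pair_inject:
  assumes "pair E f g = pair E f' g'"
    and "f \<in> Arr E" "g \<in> Arr E" "Dom E f = Dom E g"
    and "f' \<in> Arr E" "g' \<in> Arr E" "Dom E f' = Dom E g'"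
    and "Cod E f = Cod E f'" "Cod E g = Cod E g'"
  shows "f = f' \<and> g = g'"
  using assms pair_simps(4,5)[of f g] pair_simps(4,5)[of f' g'] by metis

lemma Ev_simps [simp]:
  assumes "A \<in> Obj E" "B \<in> Obj E"
  shows "Ev E A B \<in> Arr E" "Dom E (Ev E A B) = Prod E (Exp E A B) A" "Cod E (Ev E A B) = B"
  using ev_hom[OF assms] by auto

lemma curried_simps [simp]:
  assumes "A \<in> Obj E" "B \<in> Obj E" "C \<in> Obj E" "f \<in> Arr E" "Dom E f = Prod E C A" "Cod E f = B"
  shows "curried E C A B f \<in> Arr E" "Dom E (curried E C A B f) = C"
    "Cod E (curried E C A B f) = Exp E A B"
  using theI'[OF exponential[of A B C f]] assms unfolding curried_def by auto

lemma uncurried_curried: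
  assumes "A \<in> Obj E" "B \<in> Obj E" "C \<in> Obj E" "f \<in> Arr E" "Dom E f = Prod E C A" "Cod E f = B"
  shows "Ev E A B \<bullet> pair E (curried E C A B f \<bullet> Fst E C A) (Snd E C A) = f"
  using theI'[OF exponential[of A B C f]] assms unfolding curried_def by (auto simp: uncurried_def)

text \<open>The beta law at arbitrary elements. It is stated for \<open>k\<close> in place of the
  projection because, in normal form, a transpose occurs already composed with a
  substitution.\<close>

lemma Ev_curried [simp]:
  assumes "A \<in> Obj E" "B \<in> Obj E" "C \<in> Obj E" "f \<in> Arr E" "Dom E f = Prod E C A" "Cod E f = B"
    and "k \<in> Arr E" "x \<in> Arr E" "Dom E k = Dom E x" "Cod E k = C" "Cod E x = A"
  shows "Ev E A B \<bullet> pair E (curried E C A B f \<bullet> k) x = f \<bullet> pair E k x"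
proof -
  have "f \<bullet> pair E k x = (Ev E A B \<bullet> pair E (curried E C A B f \<bullet> Fst E C A) (Snd E C A)) \<bullet> pair E k x"
    using assms by (subst uncurried_curried) auto
  then show ?thesis using assms by simp
qed

text \<open>Uniqueness of transposes: morphisms into an exponential are compared at the generic
  argument.\<close>

lemma exp_ext:
  assumes "A \<in> Obj E" "B \<in> Obj E" "h \<in> Arr E" "h' \<in> Arr E" "Dom E h = Dom E h'"
    "Cod E h = Exp E A B" "Cod E h' = Exp E A B"
    and "Ev E A B \<bullet> pair E (h \<bullet> Fst E (Dom E h') A) (Snd E (Dom E h') A)
       = Ev E A B \<bullet> pair E (h' \<bullet> Fst E (Dom E h') A) (Snd E (Dom E h') A)"
  shows "h = h'"
  using exponential[of A B "Dom E h'" "uncurried E (Dom E h') A B h"] assms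
  by (auto simp: uncurried_def)

text \<open>Wrapping evaluation in one symbol lets a single rewrite rule distribute composition over
  membership. The order of the arguments is that of \<open>TMem\<close>.\<close>

definition memb :: "'a \<Rightarrow> 'a \<Rightarrow> 'a" where
  "memb x a = Ev E (Cod E x) \<Omega> \<bullet> pair E a x"

lemma pw_obj [simp]: "X \<in> Obj E \<Longrightarrow> pw E X \<in> Obj E"
  by (simp add: pw_def)

lemma memb_simps [simp]:
  assumes "x \<in> Arr E" "a \<in> Arr E" "Dom E a = Dom E x" "Cod E a = pw E (Cod E x)"
  shows "memb x a \<in> Arr E" "Dom E (memb x a) = Dom E x" "Cod E (memb x a) = \<Omega>"
    "f \<in> Arr E \<Longrightarrow> Cod E f = Dom E x \<Longrightarrow> memb x a \<bullet> f = memb (x \<bullet> f) (a \<bullet> f)"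
  using assms by (auto simp: memb_def pw_def)

lemma memb_curried [simp]:
  assumes "A \<in> Obj E" "C \<in> Obj E" "f \<in> Arr E" "Dom E f = Prod E C A" "Cod E f = \<Omega>"
    and "k \<in> Arr E" "x \<in> Arr E" "Dom E k = Dom E x" "Cod E k = C" "Cod E x = A"
  shows "memb x (curried E C A \<Omega> f \<bullet> k) = f \<bullet> pair E k x"
  using assms by (simp add: memb_def)


subsection \<open>Truth of generalized elements of the classifier\<close>

text \<open>The stage is recovered as the domain, so that "\<open>p\<close> is forced at
  \<open>f\<close>" is written \<open>tr (p \<bullet> f)\<close> without naming it.\<close>

definition tr :: "'a \<Rightarrow> bool" where
  "tr p \<longleftrightarrow> p = true_at E (Dom E p)"

lemma tr_true_at [simp]: "A \<in> Obj E \<Longrightarrow> tr (true_at E A)"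
  by (simp add: tr_def)

lemma tr_cmp: "tr p \<Longrightarrow> p \<in> Arr E \<Longrightarrow> f \<in> Arr E \<Longrightarrow> Cod E f = Dom E p \<Longrightarrow> tr (p \<bullet> f)"
  unfolding tr_def by (metis cmp_simps(2) true_at_cmp)

lemma sub_le_iff:
  assumes "p \<in> Hom E G \<Omega>" "q \<in> Hom E G \<Omega>"
  shows "sub_le E G p q \<longleftrightarrow> (\<forall>D f. f \<in> Hom E D G \<longrightarrow> tr (p \<bullet> f) \<longrightarrow> tr (q \<bullet> f))"
  using assms unfolding sub_le_def tr_def by auto

text \<open>The equalizer \<open>e\<close> of \<open>p\<close> and the constant true is the
  subobject on which \<open>p\<close> holds. If \<open>q\<close> holds at the same elements, then
  \<open>p\<close> and \<open>q\<close> both classify \<open>e\<close>, and characteristic morphisms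
  are unique.\<close>

lemma tr_ext:
  assumes "p \<in> Hom E G \<Omega>" "q \<in> Hom E G \<Omega>"
    and eq: "\<And>D f. f \<in> Hom E D G \<Longrightarrow> tr (p \<bullet> f) \<longleftrightarrow> tr (q \<bullet> f)"
  shows "p = q"
proof -
  have G: "G \<in> Obj E" using assms(1) by auto
  obtain e where e: "e \<in> Arr E" "Cod E e = G" "p \<bullet> e = true_at E G \<bullet> e"
    and u: "\<forall>D\<in>Obj E. \<forall>h\<in>Hom E D G. p \<bullet> h = true_at E G \<bullet> h \<longrightarrow>
      (\<exists>!k. k \<in> Hom E D (Dom E e) \<and> e \<bullet> k = h)"
    using equalizer[of p G \<Omega> "true_at E G"] assms(1) G by force
  have "monic E e"
    unfolding monic_def
  proof (intro conjI ballI impI)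
    fix D f g assume "D \<in> Obj E" "f \<in> Hom E D (Dom E e)" "g \<in> Hom E D (Dom E e)" "e \<bullet> f = e \<bullet> g"
    moreover have "p \<bullet> (e \<bullet> f) = true_at E G \<bullet> (e \<bullet> f)"
      using e assms \<open>f \<in> _\<close> cmp_assoc[of f e p] G by simp
    ultimately show "f = g" using u[rule_format, of D "e \<bullet> f"] e by auto
  qed (use e in simp)
  moreover have "classifies E e r"
    if r: "r \<in> Hom E G \<Omega>" "\<And>D f. f \<in> Hom E D G \<Longrightarrow> r \<bullet> f = true_at E D \<longleftrightarrow> p \<bullet> f = true_at E D" for r
    unfolding classifies_def
  proof (intro conjI ballI impI)
    fix D f assume "D \<in> Obj E" "f \<in> Hom E D (Cod E e)" "r \<bullet> f = true_at E D"
    then show "\<exists>!g. g \<in> Hom E D (Dom E e) \<and> e \<bullet> g = f"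
      using e r(2)[of f D] by (intro u[rule_format]) auto
  qed (use e r(1) r(2)[of e "Dom E e"] in auto)
  moreover have "q \<bullet> f = true_at E D \<longleftrightarrow> p \<bullet> f = true_at E D" if "f \<in> Hom E D G" for f D
    using eq[OF that] that assms by (auto simp: tr_def)
  ultimately show ?thesis using classifier[of e] assms(1,2) by blast
qed

lemma sub_le_antisym:
  assumes "p \<in> Hom E G \<Omega>" "q \<in> Hom E G \<Omega>" "sub_le E G p q" "sub_le E G q p"
  shows "p = q"
  using assms by (intro tr_ext[of p G q]) (auto simp: sub_le_iff)

lemma eq_at_classifies:
  assumes "X \<in> Obj E"
  shows "classifies E (pair E (Idt E X) (Idt E X)) (eq_at E X)"
proof -
  have "monic E (pair E (Idt E X) (Idt E X))"
    unfolding monic_def using assms by (auto dest!: pair_inject)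
  from theI'[OF classifier[OF this]] show ?thesis by (simp add: eq_at_def)
qed

lemma eq_at_simps [simp]:
  assumes "X \<in> Obj E"
  shows "eq_at E X \<in> Arr E" "Dom E (eq_at E X) = Prod E X X" "Cod E (eq_at E X) = \<Omega>"
  using eq_at_classifies[OF assms] assms by (auto simp: classifies_def)

text \<open>The pair factors through the diagonal exactly if its components coincide. Hence internal
  equality at a stage is equality of morphisms, which is what makes the explicit formulas below
  computable.\<close>

lemma tr_eq_at [simp]:
  assumes "f \<in> Arr E" "g \<in> Arr E" "Dom E f = Dom E g" "Cod E f = X" "Cod E g = X"
  shows "tr (eq_at E X \<bullet> pair E f g) \<longleftrightarrow> f = g"
proof -
  have X: "X \<in> Obj E" using assms by auto
  note c = eq_at_classifies[OF X, unfolded classifies_def]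
  show ?thesis
  proof
    assume "tr (eq_at E X \<bullet> pair E f g)"
    then have t: "eq_at E X \<bullet> pair E f g = true_at E (Dom E f)"
      using assms X by (simp add: tr_def)
    have "\<exists>!k. k \<in> Hom E (Dom E f) X \<and> pair E (Idt E X) (Idt E X) \<bullet> k = pair E f g"
      using c[THEN conjunct2, THEN conjunct2, THEN conjunct2, rule_format, of "Dom E f" "pair E f g", OF _ _ t]
        assms X by (simp del: pair_cmp)
    then obtain k where k: "k \<in> Hom E (Dom E f) X" "pair E (Idt E X) (Idt E X) \<bullet> k = pair E f g"
      by blast
    then have "pair E k k = pair E f g" using X by simp
    then show "f = g" using k assms by (auto dest: pair_inject)
  next
    assume "f = g"
    then have "pair E f g = pair E (Idt E X) (Idt E X) \<bullet> f" using assms X by simp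
    then have "eq_at E X \<bullet> pair E f g = (eq_at E X \<bullet> pair E (Idt E X) (Idt E X)) \<bullet> f"
      using assms X by simp
    also have "\<dots> = true_at E (Dom E f)" using c assms X by simp
    finally show "tr (eq_at E X \<bullet> pair E f g)" using assms X by (simp add: tr_def)
  qed
qed


subsection \<open>Kripke--Joyal semantics of the logical operations\<close>

text \<open>An element of the order is determined by what lies below it: test with each of the two
  candidates in turn. So any explicit \<open>c\<close> with the universal property is the value of
  the description; \<open>the_least\<close> is the dual form for joins and existentials.\<close>

lemma the_greatest:
  assumes "c \<in> Hom E G \<Omega>" "\<And>d. d \<in> Hom E G \<Omega> \<Longrightarrow> sub_le E G d c \<longleftrightarrow> Q d"
  shows "(THE c. c \<in> Hom E G \<Omega> \<and> (\<forall>d\<in>Hom E G \<Omega>. sub_le E G d c \<longleftrightarrow> Q d)) = c"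
proof (rule the_equality)
  fix b assume "b \<in> Hom E G \<Omega> \<and> (\<forall>d\<in>Hom E G \<Omega>. sub_le E G d b \<longleftrightarrow> Q d)"
  then show "b = c"
    using assms by (intro sub_le_antisym[of b G c]) (auto simp: sub_le_def)
qed (use assms in auto)

lemma the_least:
  assumes "c \<in> Hom E G \<Omega>" "\<And>d. d \<in> Hom E G \<Omega> \<Longrightarrow> sub_le E G c d \<longleftrightarrow> Q d"
  shows "(THE c. c \<in> Hom E G \<Omega> \<and> (\<forall>d\<in>Hom E G \<Omega>. sub_le E G c d \<longleftrightarrow> Q d)) = c"
proof (rule the_equality)
  fix b assume "b \<in> Hom E G \<Omega> \<and> (\<forall>d\<in>Hom E G \<Omega>. sub_le E G b d \<longleftrightarrow> Q d)"
  then show "b = c"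
    using assms by (intro sub_le_antisym[of b G c]) (auto simp: sub_le_def)
qed (use assms in auto)

text \<open>Conjunction is the equation \<open>(p, q) = (true, true)\<close>.\<close>

lemma sub_meet_eq:
  assumes "p \<in> Hom E G \<Omega>" "q \<in> Hom E G \<Omega>"
  defines "c \<equiv> eq_at E (Prod E \<Omega> \<Omega>) \<bullet> pair E (pair E p q) (pair E (true_at E G) (true_at E G))"
  shows "c \<in> Hom E G \<Omega>" "sub_meet E G p q = c"
    "\<And>D f. f \<in> Hom E D G \<Longrightarrow> tr (c \<bullet> f) \<longleftrightarrow> tr (p \<bullet> f) \<and> tr (q \<bullet> f)"
proof -
  have G: "G \<in> Obj E" using assms(1) by auto
  show c: "c \<in> Hom E G \<Omega>" using assms(1,2) G by (simp add: c_def)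
  show t: "tr (c \<bullet> f) \<longleftrightarrow> tr (p \<bullet> f) \<and> tr (q \<bullet> f)" if "f \<in> Hom E D G" for D f
  proof -
    have D: "D \<in> Obj E" using that by auto
    have "tr (c \<bullet> f) \<longleftrightarrow> pair E (p \<bullet> f) (q \<bullet> f) = pair E (true_at E D) (true_at E D)"
      using assms(1,2) that G D by (simp add: c_def)
    also have "\<dots> \<longleftrightarrow> p \<bullet> f = true_at E D \<and> q \<bullet> f = true_at E D"
      using assms(1,2) that G D by (auto dest: pair_inject)
    finally show ?thesis using assms(1,2) that by (simp add: tr_def)
  qed
  show "sub_meet E G p q = c"
    unfolding sub_meet_def using assms(1,2) c t by (intro the_greatest) (auto simp: sub_le_iff)
qed

lemma sub_meet_simps [simp]:
  assumes "p \<in> Arr E" "q \<in> Arr E" "Dom E p = G" "Dom E q = G" "Cod E p = \<Omega>" "Cod E q = \<Omega>"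
  shows "sub_meet E G p q \<in> Arr E" "Dom E (sub_meet E G p q) = G" "Cod E (sub_meet E G p q) = \<Omega>"
    "f \<in> Arr E \<Longrightarrow> Cod E f = G \<Longrightarrow>
      sub_meet E G p q \<bullet> f = sub_meet E (Dom E f) (p \<bullet> f) (q \<bullet> f)"
    "tr (sub_meet E G p q) \<longleftrightarrow> tr p \<and> tr q"
proof -
  have pq: "p \<in> Hom E G \<Omega>" "q \<in> Hom E G \<Omega>" using assms by auto
  note m = sub_meet_eq[OF pq]
  show "sub_meet E G p q \<in> Arr E" "Dom E (sub_meet E G p q) = G" "Cod E (sub_meet E G p q) = \<Omega>"
    using m by auto
  show "tr (sub_meet E G p q) \<longleftrightarrow> tr p \<and> tr q"
    using m(3)[of "Idt E G" G] m(1,2) assms by auto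
  show "sub_meet E G p q \<bullet> f = sub_meet E (Dom E f) (p \<bullet> f) (q \<bullet> f)"
    if "f \<in> Arr E" "Cod E f = G"
    using assms that m sub_meet_eq[of "p \<bullet> f" "Dom E f" "q \<bullet> f"]
    by (intro tr_ext[of _ "Dom E f"]) auto
qed

text \<open>Implication is the equation \<open>p \<and> q = p\<close>. By \<open>tr_ext\<close> this
  equation holds at \<open>f\<close> iff truth of \<open>p\<close> passes to \<open>q\<close> at all
  stages over \<open>f\<close>.\<close>

lemma sub_imp_eq:
  assumes "p \<in> Hom E G \<Omega>" "q \<in> Hom E G \<Omega>"
  defines "c \<equiv> eq_at E \<Omega> \<bullet> pair E (sub_meet E G p q) p"
  shows "c \<in> Hom E G \<Omega>" "sub_imp E G p q = c"
    "\<And>D f. f \<in> Hom E D G \<Longrightarrow>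
      tr (c \<bullet> f) \<longleftrightarrow> (\<forall>D' l. l \<in> Hom E D' D \<longrightarrow> tr (p \<bullet> f \<bullet> l) \<longrightarrow> tr (q \<bullet> f \<bullet> l))"
proof -
  have G: "G \<in> Obj E" using assms(1) by auto
  show c: "c \<in> Hom E G \<Omega>" using assms(1,2) G by (simp add: c_def)
  show t: "tr (c \<bullet> f) \<longleftrightarrow> (\<forall>D' l. l \<in> Hom E D' D \<longrightarrow> tr (p \<bullet> f \<bullet> l) \<longrightarrow> tr (q \<bullet> f \<bullet> l))"
    if f: "f \<in> Hom E D G" for D f
  proof -
    have "tr (c \<bullet> f) \<longleftrightarrow> sub_meet E D (p \<bullet> f) (q \<bullet> f) = p \<bullet> f"
      using assms(1,2) f G by (simp add: c_def)
    also have "\<dots> \<longleftrightarrow> (\<forall>D' l. l \<in> Hom E D' D \<longrightarrow> tr (p \<bullet> f \<bullet> l) \<longrightarrow> tr (q \<bullet> f \<bullet> l))"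
      (is "?l = p \<bullet> f \<longleftrightarrow> ?r")
    proof
      assume eq: "?l = p \<bullet> f"
      show ?r
      proof (intro allI impI)
        fix D' l assume l: "l \<in> Hom E D' D" "tr (p \<bullet> f \<bullet> l)"
        then have "tr (?l \<bullet> l)" using eq assms(1,2) f by simp
        then show "tr (q \<bullet> f \<bullet> l)" using assms(1,2) f l(1) by simp
      qed
    next
      assume ?r
      then show "?l = p \<bullet> f"
        using assms(1,2) f by (intro tr_ext[of _ D]) auto
    qed
    finally show ?thesis .
  qed
  show "sub_imp E G p q = c"
    unfolding sub_imp_def
  proof (rule the_greatest[OF c])
    fix d assume d: "d \<in> Hom E G \<Omega>"
    show "sub_le E G d c \<longleftrightarrow> sub_le E G (sub_meet E G d p) q" (is "?l \<longleftrightarrow> ?r")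
    proof
      assume l: ?l
      have "tr (q \<bullet> f)" if f: "f \<in> Hom E D G" "tr (d \<bullet> f)" "tr (p \<bullet> f)" for D f
      proof -
        have "tr (c \<bullet> f)" using l f d c by (auto simp: sub_le_iff)
        then show ?thesis using t[OF f(1), THEN iffD1, rule_format, of "Idt E D" D] f assms(1,2) by auto
      qed
      then show ?r using d assms(1,2) by (auto simp: sub_le_iff)
    next
      assume r: ?r
      have "tr (c \<bullet> f)" if f: "f \<in> Hom E D G" "tr (d \<bullet> f)" for D f
      proof (rule t[OF f(1), THEN iffD2], intro allI impI)
        fix D' l assume l: "l \<in> Hom E D' D" "tr (p \<bullet> f \<bullet> l)"
        have "tr (d \<bullet> f \<bullet> l)" using tr_cmp[OF f(2), of l] f l d by auto
        then show "tr (q \<bullet> f \<bullet> l)"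
          using r l f d assms(1,2) by (auto simp: sub_le_iff)
      qed
      then show ?l using d c by (simp add: sub_le_iff)
    qed
  qed
qed

lemma sub_imp_simps [simp]:
  assumes "p \<in> Arr E" "q \<in> Arr E" "Dom E p = G" "Dom E q = G" "Cod E p = \<Omega>" "Cod E q = \<Omega>"
  shows "sub_imp E G p q \<in> Arr E" "Dom E (sub_imp E G p q) = G" "Cod E (sub_imp E G p q) = \<Omega>"
    "f \<in> Arr E \<Longrightarrow> Cod E f = G \<Longrightarrow>
      sub_imp E G p q \<bullet> f = sub_imp E (Dom E f) (p \<bullet> f) (q \<bullet> f)"
proof -
  have pq: "p \<in> Hom E G \<Omega>" "q \<in> Hom E G \<Omega>" using assms by auto
  note m = sub_imp_eq[OF pq]
  show "sub_imp E G p q \<in> Arr E" "Dom E (sub_imp E G p q) = G" "Cod E (sub_imp E G p q) = \<Omega>"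
    using m by auto
  show "sub_imp E G p q \<bullet> f = sub_imp E (Dom E f) (p \<bullet> f) (q \<bullet> f)"
    if "f \<in> Arr E" "Cod E f = G"
    using assms that m sub_imp_eq[of "p \<bullet> f" "Dom E f" "q \<bullet> f"] by simp
qed

lemma tr_sub_imp:
  assumes "p \<in> Hom E G \<Omega>" "q \<in> Hom E G \<Omega>"
  shows "tr (sub_imp E G p q) \<longleftrightarrow> (\<forall>D f. f \<in> Hom E D G \<longrightarrow> tr (p \<bullet> f) \<longrightarrow> tr (q \<bullet> f))"
  using sub_imp_eq(3)[OF assms, of "Idt E G" G] sub_imp_eq(1,2)[OF assms] assms by auto

text \<open>Universal quantification is the equation, in the power object, between the transpose of
  \<open>p\<close> and the transpose of the constant true.\<close>

lemma sub_all_eq: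
  assumes "X \<in> Obj E" "G \<in> Obj E" "p \<in> Hom E (Prod E G X) \<Omega>"
  defines "c \<equiv> eq_at E (pw E X) \<bullet> pair E (curried E G X \<Omega> p) (curried E G X \<Omega> (true_at E (Prod E G X)))"
  shows "c \<in> Hom E G \<Omega>" "sub_all E G X p = c"
    "\<And>D f. f \<in> Hom E D G \<Longrightarrow>
      tr (c \<bullet> f) \<longleftrightarrow> (\<forall>D' k x. k \<in> Hom E D' D \<longrightarrow> x \<in> Hom E D' X \<longrightarrow> tr (p \<bullet> pair E (f \<bullet> k) x))"
proof -
  let ?t = "true_at E (Prod E G X)"
  have [simp]: "Exp E X \<Omega> = pw E X" by (simp add: pw_def)
  show c: "c \<in> Hom E G \<Omega>" using assms(1-3) by (simp add: c_def)
  show t: "tr (c \<bullet> f) \<longleftrightarrow> (\<forall>D' k x. k \<in> Hom E D' D \<longrightarrow> x \<in> Hom E D' X \<longrightarrow> tr (p \<bullet> pair E (f \<bullet> k) x))"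
    (is "_ \<longleftrightarrow> ?r") if f: "f \<in> Hom E D G" for D f
  proof -
    have D: "D \<in> Obj E" using f by auto
    have "tr (c \<bullet> f) \<longleftrightarrow> curried E G X \<Omega> p \<bullet> f = curried E G X \<Omega> ?t \<bullet> f" (is "_ \<longleftrightarrow> ?l")
      using assms(1-3) f by (simp add: c_def)
    also have "?l \<longleftrightarrow> ?r"
    proof
      assume l: ?l
      show ?r
      proof (intro allI impI)
        fix D' k x assume k: "k \<in> Hom E D' D" "x \<in> Hom E D' X"
        have "p \<bullet> pair E (f \<bullet> k) x = memb x ((curried E G X \<Omega> p \<bullet> f) \<bullet> k)"
          using assms(1-3) f k by simp
        also have "\<dots> = true_at E D'"
          unfolding l using assms(1-3) f k by simp
        finally show "tr (p \<bullet> pair E (f \<bullet> k) x)" using assms(1-3) f k by (auto simp: tr_def)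
      qed
    next
      assume ?r
      \<comment> \<open>The generic element of \<open>X\<close> over \<open>D\<close> recovers the
        equation on all of \<open>D \<times> X\<close>, which is then transposed.\<close>
      from this[rule_format, of "Fst E D X" "Prod E D X" "Snd E D X"]
      have "p \<bullet> pair E (f \<bullet> Fst E D X) (Snd E D X) = true_at E (Prod E D X)"
        using assms(1-3) f D by (simp add: tr_def)
      then have "Ev E X \<Omega> \<bullet> pair E ((curried E G X \<Omega> p \<bullet> f) \<bullet> Fst E D X) (Snd E D X)
        = Ev E X \<Omega> \<bullet> pair E ((curried E G X \<Omega> ?t \<bullet> f) \<bullet> Fst E D X) (Snd E D X)"
        using assms(1-3) f D by simp
      then show ?l
        using exp_ext[of X \<Omega> "curried E G X \<Omega> p \<bullet> f" "curried E G X \<Omega> ?t \<bullet> f"]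
          assms(1-3) f D by simp
    qed
    finally show ?thesis .
  qed
  show "sub_all E G X p = c"
    unfolding sub_all_def
  proof (rule the_greatest[OF c])
    fix d assume d: "d \<in> Hom E G \<Omega>"
    show "sub_le E G d c \<longleftrightarrow> sub_le E (Prod E G X) (d \<bullet> Fst E G X) p" (is "?l \<longleftrightarrow> ?r")
    proof
      assume l: ?l
      have "tr (p \<bullet> f)" if f: "f \<in> Hom E D (Prod E G X)" "tr (d \<bullet> Fst E G X \<bullet> f)" for D f
      proof -
        let ?f = "Fst E G X \<bullet> f"
        have "tr (c \<bullet> ?f)" using l f d c assms(1-3) by (auto simp: sub_le_iff)
        then have "tr (p \<bullet> pair E (?f \<bullet> Idt E D) (Snd E G X \<bullet> f))"
          using t[of ?f D, THEN iffD1, rule_format, of "Idt E D" D "Snd E G X \<bullet> f"] f assms(1-3) by auto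
        then show ?thesis using f assms(1-3) by (auto simp: pair_eta)
      qed
      then show ?r using d assms(1-3) by (auto simp: sub_le_iff)
    next
      assume r: ?r
      have "tr (c \<bullet> f)" if f: "f \<in> Hom E D G" "tr (d \<bullet> f)" for D f
      proof (rule t[OF f(1), THEN iffD2], intro allI impI)
        fix D' k x assume k: "k \<in> Hom E D' D" "x \<in> Hom E D' X"
        have "tr (d \<bullet> f \<bullet> k)" using tr_cmp[OF f(2), of k] f k d by auto
        then show "tr (p \<bullet> pair E (f \<bullet> k) x)"
          using r k f d assms(1-3)
          by (subst (asm) sub_le_iff) (auto dest!: spec[of _ "D'"] spec[of _ "pair E (f \<bullet> k) x"])
      qed
      then show ?l using d c by (simp add: sub_le_iff)
    qed
  qed
qed

text \<open>The last clause is the Beck-Chevalley condition: both sides have the same Kripke-Joyal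
  clause, because this clause sees \<open>f\<close> only inside composites.\<close>

lemma sub_all_simps [simp]:
  assumes "X \<in> Obj E" "G \<in> Obj E" "p \<in> Arr E" "Dom E p = Prod E G X" "Cod E p = \<Omega>"
  shows "sub_all E G X p \<in> Arr E" "Dom E (sub_all E G X p) = G" "Cod E (sub_all E G X p) = \<Omega>"
    "f \<in> Arr E \<Longrightarrow> Cod E f = G \<Longrightarrow> sub_all E G X p \<bullet> f =
      sub_all E (Dom E f) X (p \<bullet> pair E (f \<bullet> Fst E (Dom E f) X) (Snd E (Dom E f) X))"
proof -
  have p: "p \<in> Hom E (Prod E G X) \<Omega>" using assms by auto
  note m = sub_all_eq[OF assms(1,2) p]
  show "sub_all E G X p \<in> Arr E" "Dom E (sub_all E G X p) = G" "Cod E (sub_all E G X p) = \<Omega>"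
    using m by auto
  show "sub_all E G X p \<bullet> f =
      sub_all E (Dom E f) X (p \<bullet> pair E (f \<bullet> Fst E (Dom E f) X) (Snd E (Dom E f) X))"
    (is "_ = sub_all E ?D X ?q") if f: "f \<in> Arr E" "Cod E f = G"
  proof (rule tr_ext[of _ ?D])
    have q: "?q \<in> Hom E (Prod E ?D X) \<Omega>" using f assms by simp
    note n = sub_all_eq[OF assms(1) dom_obj[OF f(1)] q]
    show "sub_all E G X p \<bullet> f \<in> Hom E ?D \<Omega>" "sub_all E ?D X ?q \<in> Hom E ?D \<Omega>"
      using m(1,2) n(1,2) f by auto
    fix D g assume g: "g \<in> Hom E D ?D"
    have "tr ((sub_all E G X p \<bullet> f) \<bullet> g) \<longleftrightarrow> tr (sub_all E G X p \<bullet> f \<bullet> g)"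
      using m(1,2) f g by simp
    also have "\<dots> \<longleftrightarrow> (\<forall>D' k x. k \<in> Hom E D' D \<longrightarrow> x \<in> Hom E D' X \<longrightarrow> tr (p \<bullet> pair E (f \<bullet> g \<bullet> k) x))"
      unfolding m(2) using m(3)[of "f \<bullet> g" D] f g by auto
    also have "\<dots> \<longleftrightarrow> (\<forall>D' k x. k \<in> Hom E D' D \<longrightarrow> x \<in> Hom E D' X \<longrightarrow> tr (?q \<bullet> pair E (g \<bullet> k) x))"
      using f g assms by auto
    also have "\<dots> \<longleftrightarrow> tr (sub_all E ?D X ?q \<bullet> g)"
      unfolding n(2) using n(3)[OF g] by simp
    finally show "tr ((sub_all E G X p \<bullet> f) \<bullet> g) \<longleftrightarrow> tr (sub_all E ?D X ?q \<bullet> g)" .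
  qed
qed

lemma tr_sub_all:
  assumes "X \<in> Obj E" "G \<in> Obj E" "p \<in> Hom E (Prod E G X) \<Omega>"
  shows "tr (sub_all E G X p) \<longleftrightarrow>
    (\<forall>D f x. f \<in> Hom E D G \<longrightarrow> x \<in> Hom E D X \<longrightarrow> tr (p \<bullet> pair E f x))"
  using sub_all_eq(3)[OF assms, of "Idt E G" G] sub_all_eq(1,2)[OF assms] assms by auto

text \<open>The later stages introduced by \<open>\<forall>\<close> already cover those introduced
  by the implication, so one quantifier over stages is left. Bounded quantifiers are unfolded in
  this form throughout.\<close>

lemma tr_sub_all_imp:
  assumes "X \<in> Obj E" "G \<in> Obj E" "p \<in> Hom E (Prod E G X) \<Omega>" "q \<in> Hom E (Prod E G X) \<Omega>"
  shows "tr (sub_all E G X (sub_imp E (Prod E G X) p q)) \<longleftrightarrow>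
    (\<forall>D f x. f \<in> Hom E D G \<longrightarrow> x \<in> Hom E D X \<longrightarrow> tr (p \<bullet> pair E f x) \<longrightarrow> tr (q \<bullet> pair E f x))"
    (is "?l \<longleftrightarrow> ?r")
proof -
  have "?l \<longleftrightarrow> (\<forall>D f x. f \<in> Hom E D G \<longrightarrow> x \<in> Hom E D X \<longrightarrow>
     tr (sub_imp E (Prod E G X) p q \<bullet> pair E f x))"
    using assms by (intro tr_sub_all) auto
  also have "\<dots> \<longleftrightarrow> (\<forall>D f x. f \<in> Hom E D G \<longrightarrow> x \<in> Hom E D X \<longrightarrow>
     (\<forall>D' l. l \<in> Hom E D' D \<longrightarrow> tr (p \<bullet> pair E f x \<bullet> l) \<longrightarrow> tr (q \<bullet> pair E f x \<bullet> l)))"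
    using assms sub_imp_eq[OF assms(3,4)] by (simp del: pair_cmp)
  also have "\<dots> \<longleftrightarrow> ?r"
  proof (intro iffI allI impI)
    fix D f x
    assume *: "\<forall>D f x. f \<in> Hom E D G \<longrightarrow> x \<in> Hom E D X \<longrightarrow>
     (\<forall>D' l. l \<in> Hom E D' D \<longrightarrow> tr (p \<bullet> pair E f x \<bullet> l) \<longrightarrow> tr (q \<bullet> pair E f x \<bullet> l))"
    assume f: "f \<in> Hom E D G" "x \<in> Hom E D X" "tr (p \<bullet> pair E f x)"
    then have "tr (q \<bullet> pair E f x \<bullet> Idt E D)"
      using assms by (intro *[rule_format]) auto
    then show "tr (q \<bullet> pair E f x)" using f assms by auto
  next
    fix D f x D' l
    assume *: ?r
    assume f: "f \<in> Hom E D G" "x \<in> Hom E D X" "l \<in> Hom E D' D" "tr (p \<bullet> pair E f x \<bullet> l)"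
    then show "tr (q \<bullet> pair E f x \<bullet> l)"
      using *[rule_format, of "f \<bullet> l" D' "x \<bullet> l"] assms by auto
  qed
  finally show ?thesis .
qed

text \<open>\<open>\<bottom>\<close>, \<open>\<or>\<close> and \<open>\<exists>\<close> are least upper bounds of sieves \<open>S\<close>; they are obtained by the
  second-order encoding \<open>\<forall>p:\<Omega>. (S \<rightarrow> p) \<rightarrow> p\<close>, where \<open>w\<close> is the formula \<open>S \<rightarrow> p\<close>. This makes
  their stability under substitution evident, without image factorizations.\<close>

lemma sub_sup:
  assumes G: "G \<in> Obj E" and w: "w \<in> Hom E (Prod E G \<Omega>) \<Omega>"
    and tr_w: "\<And>D f p. f \<in> Hom E D G \<Longrightarrow> p \<in> Hom E D \<Omega> \<Longrightarrow>
      tr (w \<bullet> pair E f p) \<longleftrightarrow> (\<forall>D' l. l \<in> Hom E D' D \<longrightarrow> S (f \<bullet> l) \<longrightarrow> tr (p \<bullet> l))"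
    and S: "\<And>D D' f l. f \<in> Hom E D G \<Longrightarrow> l \<in> Hom E D' D \<Longrightarrow> S f \<Longrightarrow> S (f \<bullet> l)"
  obtains c where "c \<in> Hom E G \<Omega>"
    "\<And>d. d \<in> Hom E G \<Omega> \<Longrightarrow> sub_le E G c d \<longleftrightarrow> (\<forall>D f. f \<in> Hom E D G \<longrightarrow> S f \<longrightarrow> tr (d \<bullet> f))"
    "\<And>D f. f \<in> Hom E D G \<Longrightarrow> tr (c \<bullet> f) \<longleftrightarrow> (\<forall>D' k p. k \<in> Hom E D' D \<longrightarrow> p \<in> Hom E D' \<Omega> \<longrightarrow>
      (\<forall>D'' l. l \<in> Hom E D'' D' \<longrightarrow> S (f \<bullet> k \<bullet> l) \<longrightarrow> tr (p \<bullet> l)) \<longrightarrow> tr p)"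
proof
  let ?c = "sub_all E G \<Omega> (sub_imp E (Prod E G \<Omega>) w (Snd E G \<Omega>))"
  show c: "?c \<in> Hom E G \<Omega>" using G w by simp
  show t: "tr (?c \<bullet> f) \<longleftrightarrow> (\<forall>D' k p. k \<in> Hom E D' D \<longrightarrow> p \<in> Hom E D' \<Omega> \<longrightarrow>
      (\<forall>D'' l. l \<in> Hom E D'' D' \<longrightarrow> S (f \<bullet> k \<bullet> l) \<longrightarrow> tr (p \<bullet> l)) \<longrightarrow> tr p)"
    if f: "f \<in> Hom E D G" for D f
  proof -
    have D: "D \<in> Obj E" using f by auto
    have eq: "?c \<bullet> f = sub_all E D \<Omega> (sub_imp E (Prod E D \<Omega>)
        (w \<bullet> pair E (f \<bullet> Fst E D \<Omega>) (Snd E D \<Omega>)) (Snd E D \<Omega>))"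
      using f G w D by simp
    have "tr (?c \<bullet> f) \<longleftrightarrow> (\<forall>D' k p. k \<in> Hom E D' D \<longrightarrow> p \<in> Hom E D' \<Omega> \<longrightarrow>
        tr ((w \<bullet> pair E (f \<bullet> Fst E D \<Omega>) (Snd E D \<Omega>)) \<bullet> pair E k p) \<longrightarrow> tr (Snd E D \<Omega> \<bullet> pair E k p))"
      unfolding eq using f G w D by (intro tr_sub_all_imp) auto
    also have "\<dots> \<longleftrightarrow> (\<forall>D' k p. k \<in> Hom E D' D \<longrightarrow> p \<in> Hom E D' \<Omega> \<longrightarrow> tr (w \<bullet> pair E (f \<bullet> k) p) \<longrightarrow> tr p)"
      by (intro all_cong1 imp_cong refl) (use f G w D in simp_all)
    also have "\<dots> \<longleftrightarrow> (\<forall>D' k p. k \<in> Hom E D' D \<longrightarrow> p \<in> Hom E D' \<Omega> \<longrightarrow>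
      (\<forall>D'' l. l \<in> Hom E D'' D' \<longrightarrow> S (f \<bullet> k \<bullet> l) \<longrightarrow> tr (p \<bullet> l)) \<longrightarrow> tr p)"
    proof (intro all_cong1 imp_cong refl)
      fix D' k p assume "k \<in> Hom E D' D" "p \<in> Hom E D' \<Omega>"
      then show "tr (w \<bullet> pair E (f \<bullet> k) p) \<longleftrightarrow>
          (\<forall>D'' l. l \<in> Hom E D'' D' \<longrightarrow> S (f \<bullet> k \<bullet> l) \<longrightarrow> tr (p \<bullet> l))"
        using f by (subst tr_w[of _ D']) auto
    qed
    finally show ?thesis .
  qed
  fix d assume d: "d \<in> Hom E G \<Omega>"
  show "sub_le E G ?c d \<longleftrightarrow> (\<forall>D f. f \<in> Hom E D G \<longrightarrow> S f \<longrightarrow> tr (d \<bullet> f))" (is "?l \<longleftrightarrow> ?r")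
  proof
    assume l: ?l
    show ?r
    proof (intro allI impI)
      fix D f assume f: "f \<in> Hom E D G" "S f"
      have "tr (?c \<bullet> f)"
        unfolding t[OF f(1)]
      proof (intro allI impI)
        fix D' k p assume k: "k \<in> Hom E D' D" "p \<in> Hom E D' \<Omega>"
          and *: "\<forall>D'' l. l \<in> Hom E D'' D' \<longrightarrow> S (f \<bullet> k \<bullet> l) \<longrightarrow> tr (p \<bullet> l)"
        have "S (f \<bullet> k)" using S[OF f(1) k(1) f(2)] .
        then have "tr (p \<bullet> Idt E D')" using f k by (intro *[rule_format]) auto
        then show "tr p" using k by auto
      qed
      then show "tr (d \<bullet> f)" using l f d c by (auto simp: sub_le_iff)
    qed
  next
    assume r: ?r
    have "tr (d \<bullet> f)" if f: "f \<in> Hom E D G" "tr (?c \<bullet> f)" for D f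
    proof -
      have D: "D \<in> Obj E" using f by auto
      have "tr ((d \<bullet> f) \<bullet> l)" if l: "l \<in> Hom E D'' D" "S (f \<bullet> l)" for D'' l
        using r[rule_format, of "f \<bullet> l" D''] l f d by auto
      then show ?thesis
        \<comment> \<open>The encoding is instantiated with the proposition
          \<open>d \<bullet> f\<close> itself.\<close>
        using f(2)[unfolded t[OF f(1)], rule_format, of "Idt E D" D "d \<bullet> f"] f D d by auto
    qed
    then show ?l using c d by (simp add: sub_le_iff)
  qed
qed

text \<open>The bottom element is the bound of the empty sieve, for which
  \<open>S \<rightarrow> p\<close> is vacuous; hence \<open>w\<close> is constantly true. The last
  clause is ex falso at a stage: where bottom holds, every proposition holds.\<close>

lemma sub_bot_simps [simp]:
  assumes "G \<in> Obj E"
  shows "sub_bot E G \<in> Arr E" "Dom E (sub_bot E G) = G" "Cod E (sub_bot E G) = \<Omega>"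
    and tr_sub_bot: "f \<in> Hom E D G \<Longrightarrow> tr (sub_bot E G \<bullet> f) \<Longrightarrow> p \<in> Hom E D \<Omega> \<Longrightarrow> tr p"
proof -
  obtain c where c: "c \<in> Hom E G \<Omega>" "\<And>d. d \<in> Hom E G \<Omega> \<Longrightarrow> sub_le E G c d"
    "\<And>D f p. f \<in> Hom E D G \<Longrightarrow> tr (c \<bullet> f) \<Longrightarrow> p \<in> Hom E D \<Omega> \<Longrightarrow> tr p"
  proof (rule sub_sup[of G "true_at E (Prod E G \<Omega>)" "\<lambda>_. False"])
    fix c assume *: "c \<in> Hom E G \<Omega>"
      "\<And>d. d \<in> Hom E G \<Omega> \<Longrightarrow> sub_le E G c d \<longleftrightarrow> (\<forall>D f. f \<in> Hom E D G \<longrightarrow> False \<longrightarrow> tr (d \<bullet> f))"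
      "\<And>D f. f \<in> Hom E D G \<Longrightarrow> tr (c \<bullet> f) \<longleftrightarrow> (\<forall>D' k p. k \<in> Hom E D' D \<longrightarrow> p \<in> Hom E D' \<Omega> \<longrightarrow>
        (\<forall>D'' l. l \<in> Hom E D'' D' \<longrightarrow> False \<longrightarrow> tr (p \<bullet> l)) \<longrightarrow> tr p)"
    have "tr p" if f: "f \<in> Hom E D G" "tr (c \<bullet> f)" "p \<in> Hom E D \<Omega>" for D f p
      using *(3)[OF f(1), THEN iffD1, OF f(2), rule_format, of "Idt E D" D p] f by auto
    then show thesis using that[of c] *(1,2) by blast
  qed (use assms in auto)
  have "sub_bot E G = c"
    unfolding sub_bot_def
  proof (rule the_equality)
    fix b assume "b \<in> Hom E G \<Omega> \<and> (\<forall>d\<in>Hom E G \<Omega>. sub_le E G b d)"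
    then show "b = c" using sub_le_antisym[of b G c] c by auto
  qed (use c in auto)
  then show "sub_bot E G \<in> Arr E" "Dom E (sub_bot E G) = G" "Cod E (sub_bot E G) = \<Omega>"
    "f \<in> Hom E D G \<Longrightarrow> tr (sub_bot E G \<bullet> f) \<Longrightarrow> p \<in> Hom E D \<Omega> \<Longrightarrow> tr p"
    using c by auto
qed

text \<open>Here \<open>S\<close> is the union of two sieves, and \<open>S \<rightarrow> r\<close>
  is the conjunction of \<open>p \<rightarrow> r\<close> and \<open>q \<rightarrow> r\<close>.
  Instead of asking for a cover on which one disjunct holds, the third clause quantifies over the
  consequences \<open>r\<close> of the disjunction.\<close>

lemma sub_join_props:
  assumes "p \<in> Hom E G \<Omega>" "q \<in> Hom E G \<Omega>"
  shows "sub_join E G p q \<in> Hom E G \<Omega>"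
    "\<And>d. d \<in> Hom E G \<Omega> \<Longrightarrow> sub_le E G (sub_join E G p q) d \<longleftrightarrow> sub_le E G p d \<and> sub_le E G q d"
    "\<And>D f. f \<in> Hom E D G \<Longrightarrow> tr (sub_join E G p q \<bullet> f) \<longleftrightarrow>
      (\<forall>D' k r. k \<in> Hom E D' D \<longrightarrow> r \<in> Hom E D' \<Omega> \<longrightarrow>
        (\<forall>D'' l. l \<in> Hom E D'' D' \<longrightarrow> tr (p \<bullet> f \<bullet> k \<bullet> l) \<or> tr (q \<bullet> f \<bullet> k \<bullet> l) \<longrightarrow> tr (r \<bullet> l)) \<longrightarrow> tr r)"
proof -
  let ?S = "\<lambda>f. tr (p \<bullet> f) \<or> tr (q \<bullet> f)"
  let ?F = "Fst E G \<Omega>" and ?P = "Snd E G \<Omega>" and ?G = "Prod E G \<Omega>"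
  let ?w = "sub_meet E ?G (sub_imp E ?G (p \<bullet> ?F) ?P) (sub_imp E ?G (q \<bullet> ?F) ?P)"
  have G: "G \<in> Obj E" using assms by auto
  obtain c where c: "c \<in> Hom E G \<Omega>"
    "\<And>d. d \<in> Hom E G \<Omega> \<Longrightarrow> sub_le E G c d \<longleftrightarrow> (\<forall>D f. f \<in> Hom E D G \<longrightarrow> ?S f \<longrightarrow> tr (d \<bullet> f))"
    "\<And>D f. f \<in> Hom E D G \<Longrightarrow> tr (c \<bullet> f) \<longleftrightarrow> (\<forall>D' k p. k \<in> Hom E D' D \<longrightarrow> p \<in> Hom E D' \<Omega> \<longrightarrow>
      (\<forall>D'' l. l \<in> Hom E D'' D' \<longrightarrow> ?S (f \<bullet> k \<bullet> l) \<longrightarrow> tr (p \<bullet> l)) \<longrightarrow> tr p)"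
  proof (rule sub_sup[of G ?w ?S, OF G])
    show "?w \<in> Hom E ?G \<Omega>" using assms G by simp
    fix D f r assume f: "f \<in> Hom E D G" "r \<in> Hom E D \<Omega>"
    have "?w \<bullet> pair E f r = sub_meet E D (sub_imp E D (p \<bullet> f) r) (sub_imp E D (q \<bullet> f) r)"
      using assms G f by simp
    then have "tr (?w \<bullet> pair E f r) \<longleftrightarrow> tr (sub_imp E D (p \<bullet> f) r) \<and> tr (sub_imp E D (q \<bullet> f) r)"
      using assms f by simp
    also have "\<dots> \<longleftrightarrow> (\<forall>D' l. l \<in> Hom E D' D \<longrightarrow> ?S (f \<bullet> l) \<longrightarrow> tr (r \<bullet> l))"
      using assms f tr_sub_imp[of "p \<bullet> f" D r] tr_sub_imp[of "q \<bullet> f" D r] by auto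
    finally show "tr (?w \<bullet> pair E f r) \<longleftrightarrow> \<dots>" .
  next
    fix D D' f l assume f: "f \<in> Hom E D G" "l \<in> Hom E D' D" "?S f"
    then show "?S (f \<bullet> l)"
      using assms tr_cmp[of "p \<bullet> f" l] tr_cmp[of "q \<bullet> f" l] by auto
  qed blast
  have "sub_join E G p q = c"
    unfolding sub_join_def
    by (rule the_least[OF c(1)], subst c(2)) (use assms in \<open>auto simp: sub_le_iff\<close>)
  then show "sub_join E G p q \<in> Hom E G \<Omega>"
    "\<And>d. d \<in> Hom E G \<Omega> \<Longrightarrow> sub_le E G (sub_join E G p q) d \<longleftrightarrow> sub_le E G p d \<and> sub_le E G q d"
    "\<And>D f. f \<in> Hom E D G \<Longrightarrow> tr (sub_join E G p q \<bullet> f) \<longleftrightarrow>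
      (\<forall>D' k r. k \<in> Hom E D' D \<longrightarrow> r \<in> Hom E D' \<Omega> \<longrightarrow>
        (\<forall>D'' l. l \<in> Hom E D'' D' \<longrightarrow> tr (p \<bullet> f \<bullet> k \<bullet> l) \<or> tr (q \<bullet> f \<bullet> k \<bullet> l) \<longrightarrow> tr (r \<bullet> l)) \<longrightarrow> tr r)"
    using c assms by (auto simp: sub_le_iff)
qed

text \<open>Stability is read off from the third clause of \<open>sub_join_props\<close>, in which
  \<open>f\<close> occurs only inside composites.\<close>

lemma sub_join_simps [simp]:
  assumes "p \<in> Arr E" "q \<in> Arr E" "Dom E p = G" "Dom E q = G" "Cod E p = \<Omega>" "Cod E q = \<Omega>"
  shows "sub_join E G p q \<in> Arr E" "Dom E (sub_join E G p q) = G" "Cod E (sub_join E G p q) = \<Omega>"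
    "f \<in> Arr E \<Longrightarrow> Cod E f = G \<Longrightarrow>
      sub_join E G p q \<bullet> f = sub_join E (Dom E f) (p \<bullet> f) (q \<bullet> f)"
proof -
  have pq: "p \<in> Hom E G \<Omega>" "q \<in> Hom E G \<Omega>" using assms by auto
  note m = sub_join_props[OF pq]
  show "sub_join E G p q \<in> Arr E" "Dom E (sub_join E G p q) = G" "Cod E (sub_join E G p q) = \<Omega>"
    using m(1) by auto
  show "sub_join E G p q \<bullet> f = sub_join E (Dom E f) (p \<bullet> f) (q \<bullet> f)"
    if f: "f \<in> Arr E" "Cod E f = G"
  proof (rule tr_ext[of _ "Dom E f"])
    have pf: "p \<bullet> f \<in> Hom E (Dom E f) \<Omega>" "q \<bullet> f \<in> Hom E (Dom E f) \<Omega>" using assms f by auto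
    note n = sub_join_props[OF pf]
    show "sub_join E G p q \<bullet> f \<in> Hom E (Dom E f) \<Omega>"
      "sub_join E (Dom E f) (p \<bullet> f) (q \<bullet> f) \<in> Hom E (Dom E f) \<Omega>"
      using m(1) n(1) f by auto
    fix D g assume g: "g \<in> Hom E D (Dom E f)"
    have "tr ((sub_join E G p q \<bullet> f) \<bullet> g) \<longleftrightarrow> tr (sub_join E G p q \<bullet> f \<bullet> g)"
      using m(1) f g by simp
    also have "\<dots> \<longleftrightarrow> tr (sub_join E (Dom E f) (p \<bullet> f) (q \<bullet> f) \<bullet> g)"
      using m(3)[of "f \<bullet> g" D] n(3)[OF g] f g assms by auto
    finally show "tr ((sub_join E G p q \<bullet> f) \<bullet> g) \<longleftrightarrow> tr (sub_join E (Dom E f) (p \<bullet> f) (q \<bullet> f) \<bullet> g)" .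
  qed
qed

text \<open>Here \<open>S\<close> consists of the elements at whose stage a witness exists, and
  \<open>S \<rightarrow> r\<close> is \<open>\<forall>x. p \<rightarrow> r\<close> with
  \<open>r\<close> weakened to the larger context.\<close>

lemma sub_ex_props:
  assumes X: "X \<in> Obj E" and G: "G \<in> Obj E" and p: "p \<in> Hom E (Prod E G X) \<Omega>"
  shows "sub_ex E G X p \<in> Hom E G \<Omega>"
    "\<And>d. d \<in> Hom E G \<Omega> \<Longrightarrow> sub_le E G (sub_ex E G X p) d \<longleftrightarrow> sub_le E (Prod E G X) p (d \<bullet> Fst E G X)"
    "\<And>D f. f \<in> Hom E D G \<Longrightarrow> tr (sub_ex E G X p \<bullet> f) \<longleftrightarrow>
      (\<forall>D' k r. k \<in> Hom E D' D \<longrightarrow> r \<in> Hom E D' \<Omega> \<longrightarrow>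
        (\<forall>D'' l. l \<in> Hom E D'' D' \<longrightarrow>
          (\<exists>x. x \<in> Hom E D'' X \<and> tr (p \<bullet> pair E (f \<bullet> k \<bullet> l) x)) \<longrightarrow> tr (r \<bullet> l)) \<longrightarrow> tr r)"
proof -
  let ?S = "\<lambda>f. \<exists>x. x \<in> Hom E (Dom E f) X \<and> tr (p \<bullet> pair E f x)"
  let ?F = "Fst E G \<Omega>" and ?P = "Snd E G \<Omega>" and ?G = "Prod E G \<Omega>"
  let ?w = "sub_all E ?G X (sub_imp E (Prod E ?G X)
    (p \<bullet> pair E (?F \<bullet> Fst E ?G X) (Snd E ?G X)) (?P \<bullet> Fst E ?G X))"
  obtain c where c: "c \<in> Hom E G \<Omega>"
    "\<And>d. d \<in> Hom E G \<Omega> \<Longrightarrow> sub_le E G c d \<longleftrightarrow> (\<forall>D f. f \<in> Hom E D G \<longrightarrow> ?S f \<longrightarrow> tr (d \<bullet> f))"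
    "\<And>D f. f \<in> Hom E D G \<Longrightarrow> tr (c \<bullet> f) \<longleftrightarrow> (\<forall>D' k p. k \<in> Hom E D' D \<longrightarrow> p \<in> Hom E D' \<Omega> \<longrightarrow>
      (\<forall>D'' l. l \<in> Hom E D'' D' \<longrightarrow> ?S (f \<bullet> k \<bullet> l) \<longrightarrow> tr (p \<bullet> l)) \<longrightarrow> tr p)"
  proof (rule sub_sup[of G ?w ?S, OF G])
    show "?w \<in> Hom E ?G \<Omega>" using assms by simp
    fix D f r assume f: "f \<in> Hom E D G" "r \<in> Hom E D \<Omega>"
    then have D: "D \<in> Obj E" by auto
    have eq: "?w \<bullet> pair E f r = sub_all E D X (sub_imp E (Prod E D X)
      (p \<bullet> pair E (f \<bullet> Fst E D X) (Snd E D X)) (r \<bullet> Fst E D X))"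
      using assms f D by simp
    have red: "(p \<bullet> pair E (f \<bullet> Fst E D X) (Snd E D X)) \<bullet> pair E l x = p \<bullet> pair E (f \<bullet> l) x"
      "(r \<bullet> Fst E D X) \<bullet> pair E l x = r \<bullet> l"
      if "l \<in> Hom E D' D" "x \<in> Hom E D' X" for D' l x
      using that assms f D by simp_all
    have "tr (?w \<bullet> pair E f r) \<longleftrightarrow> (\<forall>D' l x. l \<in> Hom E D' D \<longrightarrow> x \<in> Hom E D' X \<longrightarrow>
        tr ((p \<bullet> pair E (f \<bullet> Fst E D X) (Snd E D X)) \<bullet> pair E l x) \<longrightarrow> tr ((r \<bullet> Fst E D X) \<bullet> pair E l x))"
      unfolding eq using assms f D by (intro tr_sub_all_imp) auto
    also have "\<dots> \<longleftrightarrow> (\<forall>D' l x. l \<in> Hom E D' D \<longrightarrow> x \<in> Hom E D' X \<longrightarrow>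
        tr (p \<bullet> pair E (f \<bullet> l) x) \<longrightarrow> tr (r \<bullet> l))"
      by (intro all_cong1 imp_cong refl arg_cong[of _ _ tr]; rule red; assumption)
    also have "\<dots> \<longleftrightarrow> (\<forall>D' l. l \<in> Hom E D' D \<longrightarrow>
        (\<exists>x. x \<in> Hom E D' X \<and> tr (p \<bullet> pair E (f \<bullet> l) x)) \<longrightarrow> tr (r \<bullet> l))"
      by blast
    also have "\<dots> \<longleftrightarrow> (\<forall>D' l. l \<in> Hom E D' D \<longrightarrow> ?S (f \<bullet> l) \<longrightarrow> tr (r \<bullet> l))"
      by (intro all_cong1 imp_cong refl) (use f in simp_all)
    finally show "tr (?w \<bullet> pair E f r) \<longleftrightarrow> \<dots>" .
  next
    fix D D' f l assume f: "f \<in> Hom E D G" "l \<in> Hom E D' D" "?S f"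
    then obtain x where x: "x \<in> Hom E D X" "tr (p \<bullet> pair E f x)" by auto
    then have "tr ((p \<bullet> pair E f x) \<bullet> l)" using f p tr_cmp[of "p \<bullet> pair E f x" l] by auto
    then show "?S (f \<bullet> l)"
      using f x p by (intro exI[of _ "x \<bullet> l"]) auto
  qed blast
  have le: "sub_le E G c d \<longleftrightarrow> sub_le E (Prod E G X) p (d \<bullet> Fst E G X)" (is "?l \<longleftrightarrow> ?r")
    if d: "d \<in> Hom E G \<Omega>" for d
  proof
    assume l: ?l
    have "tr ((d \<bullet> Fst E G X) \<bullet> f)" if f: "f \<in> Hom E D (Prod E G X)" "tr (p \<bullet> f)" for D f
    proof -
      have "?S (Fst E G X \<bullet> f)"
        using f X G by (intro exI[of _ "Snd E G X \<bullet> f"]) (simp add: pair_eta)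
      then have "tr (d \<bullet> Fst E G X \<bullet> f)"
        using l[unfolded c(2)[OF d], rule_format, of "Fst E G X \<bullet> f" D] f X G by auto
      then show ?thesis using f X G d by simp
    qed
    then show ?r using X G p d by (simp add: sub_le_iff)
  next
    assume r: ?r
    show ?l unfolding c(2)[OF d]
    proof (intro allI impI)
      fix D f assume f: "f \<in> Hom E D G" "?S f"
      then obtain x where x: "x \<in> Hom E D X" "tr (p \<bullet> pair E f x)" by auto
      have "pair E f x \<in> Hom E D (Prod E G X)" using f x by simp
      then have "tr ((d \<bullet> Fst E G X) \<bullet> pair E f x)"
        using x(2) r X G p d sub_le_iff[of p "Prod E G X" "d \<bullet> Fst E G X"] by auto
      moreover have "(d \<bullet> Fst E G X) \<bullet> pair E f x = d \<bullet> f" using f(1) x(1) X G d by simp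
      ultimately show "tr (d \<bullet> f)" by simp
    qed
  qed
  have "sub_ex E G X p = c"
    unfolding sub_ex_def by (rule the_least[OF c(1) le])
  then show "sub_ex E G X p \<in> Hom E G \<Omega>"
    "\<And>d. d \<in> Hom E G \<Omega> \<Longrightarrow> sub_le E G (sub_ex E G X p) d \<longleftrightarrow> sub_le E (Prod E G X) p (d \<bullet> Fst E G X)"
    "\<And>D f. f \<in> Hom E D G \<Longrightarrow> tr (sub_ex E G X p \<bullet> f) \<longleftrightarrow>
      (\<forall>D' k r. k \<in> Hom E D' D \<longrightarrow> r \<in> Hom E D' \<Omega> \<longrightarrow>
        (\<forall>D'' l. l \<in> Hom E D'' D' \<longrightarrow>
          (\<exists>x. x \<in> Hom E D'' X \<and> tr (p \<bullet> pair E (f \<bullet> k \<bullet> l) x)) \<longrightarrow> tr (r \<bullet> l)) \<longrightarrow> tr r)"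
    using c(1) le by (simp_all add: c(3))
qed

text \<open>Beck-Chevalley for the existential quantifier, again from the second-order clause, with
  witnesses over \<open>?D\<close> matched by \<open>q_pair\<close>.\<close>

lemma sub_ex_simps [simp]:
  assumes "X \<in> Obj E" "G \<in> Obj E" "p \<in> Arr E" "Dom E p = Prod E G X" "Cod E p = \<Omega>"
  shows "sub_ex E G X p \<in> Arr E" "Dom E (sub_ex E G X p) = G" "Cod E (sub_ex E G X p) = \<Omega>"
    "f \<in> Arr E \<Longrightarrow> Cod E f = G \<Longrightarrow> sub_ex E G X p \<bullet> f =
      sub_ex E (Dom E f) X (p \<bullet> pair E (f \<bullet> Fst E (Dom E f) X) (Snd E (Dom E f) X))"
proof -
  have p: "p \<in> Hom E (Prod E G X) \<Omega>" using assms by auto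
  note m = sub_ex_props[OF assms(1,2) p]
  show "sub_ex E G X p \<in> Arr E" "Dom E (sub_ex E G X p) = G" "Cod E (sub_ex E G X p) = \<Omega>"
    using m(1) by auto
  show "sub_ex E G X p \<bullet> f =
      sub_ex E (Dom E f) X (p \<bullet> pair E (f \<bullet> Fst E (Dom E f) X) (Snd E (Dom E f) X))"
    (is "_ = sub_ex E ?D X ?q") if f: "f \<in> Arr E" "Cod E f = G"
  proof (rule tr_ext[of _ ?D])
    have q: "?q \<in> Hom E (Prod E ?D X) \<Omega>" using f assms by simp
    note n = sub_ex_props[OF assms(1) dom_obj[OF f(1)] q]
    show "sub_ex E G X p \<bullet> f \<in> Hom E ?D \<Omega>" "sub_ex E ?D X ?q \<in> Hom E ?D \<Omega>"
      using m(1) n(1) f by auto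
    fix D g assume g: "g \<in> Hom E D ?D"
    have q_pair: "?q \<bullet> pair E (g \<bullet> k \<bullet> l) x = p \<bullet> pair E (f \<bullet> g \<bullet> k \<bullet> l) x"
      if "k \<in> Hom E D' D" "l \<in> Hom E D'' D'" "x \<in> Hom E D'' X" for k l x D' D''
      using that f g assms by simp
    have "tr ((sub_ex E G X p \<bullet> f) \<bullet> g) \<longleftrightarrow> tr (sub_ex E G X p \<bullet> f \<bullet> g)"
      using m(1) f g by simp
    also have "\<dots> \<longleftrightarrow> tr (sub_ex E ?D X ?q \<bullet> g)"
    proof -
      have fg: "f \<bullet> g \<in> Hom E D G" using f g by simp
      show ?thesis
        unfolding m(3)[OF fg] n(3)[OF g]
        by (intro all_cong1 imp_cong refl ex_cong1 conj_cong arg_cong[of _ _ tr])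
          (subst q_pair, use f g in simp_all)
    qed
    finally show "tr ((sub_ex E G X p \<bullet> f) \<bullet> g) \<longleftrightarrow> tr (sub_ex E ?D X ?q \<bullet> g)" .
  qed
qed

subsection \<open>Semantic values of the forcing translation\<close>

lemma ctx_obj [simp]: "set \<Gamma> \<subseteq> Obj E \<Longrightarrow> ctx E \<Gamma> \<in> Obj E"
  by (induction \<Gamma>) auto

lemma proj_simps [simp]:
  assumes "set \<Gamma> \<subseteq> Obj E" "i < length \<Gamma>"
  shows "proj E \<Gamma> i \<in> Arr E" "Dom E (proj E \<Gamma> i) = ctx E \<Gamma>" "Cod E (proj E \<Gamma> i) = \<Gamma> ! i"
  using assms
proof (induction \<Gamma> arbitrary: i)
  case (Cons X \<Gamma>)
  { case 1 then show ?case using Cons.IH by (cases i) auto }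
  { case 2 then show ?case using Cons.IH by (cases i) auto }
  { case 3 then show ?case using Cons.IH by (cases i) auto }
qed auto

text \<open>One object suffices for all entries, because every variable of an
  \<open>X\<close>-formula has type \<open>X\<close>; entry \<open>i\<close> is the value of
  variable \<open>i\<close>.\<close>

definition env :: "'o \<Rightarrow> 'o \<Rightarrow> 'a list \<Rightarrow> bool" where
  "env X D \<rho> \<longleftrightarrow> (\<forall>r\<in>set \<rho>. r \<in> Hom E D X)"

definition shift :: "'a \<Rightarrow> 'a list \<Rightarrow> 'a list" where
  "shift f \<rho> = map (\<lambda>r. r \<bullet> f) \<rho>"

lemma length_shift [simp]: "length (shift f \<rho>) = length \<rho>"
  by (simp add: shift_def)

lemma shift_Cons [simp]: "shift f (r # \<rho>) = (r \<bullet> f) # shift f \<rho>"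
  by (simp add: shift_def)

lemma env_Cons [simp]: "env X D (r # \<rho>) \<longleftrightarrow> r \<in> Hom E D X \<and> env X D \<rho>"
  by (simp add: env_def)

lemma env_nth: "env X D \<rho> \<Longrightarrow> i < length \<rho> \<Longrightarrow> \<rho> ! i \<in> Arr E \<and> Dom E (\<rho> ! i) = D \<and> Cod E (\<rho> ! i) = X"
  unfolding env_def using nth_mem by auto

lemma env_shift [simp]: "env X (Cod E f) \<rho> \<Longrightarrow> f \<in> Arr E \<Longrightarrow> D = Dom E f \<Longrightarrow> env X D (shift f \<rho>)"
  by (auto simp: env_def shift_def)

lemma shift_shift [simp]:
  "env X (Cod E f) \<rho> \<Longrightarrow> f \<in> Arr E \<Longrightarrow> g \<in> Arr E \<Longrightarrow> Cod E g = Dom E f \<Longrightarrow>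
    shift g (shift f \<rho>) = shift (f \<bullet> g) \<rho>"
  by (auto simp: env_def shift_def)

lemma shift_Idt [simp]: "env X D \<rho> \<Longrightarrow> shift (Idt E D) \<rho> = \<rho>"
  by (induction \<rho>) (auto simp: shift_def)

lemma mor_tuple_Cons: "mor_tuple E D (f # fs) = pair E (mor_tuple E D fs) f"
  by (simp add: mor_tuple_def)

lemma mor_tuple_simps [simp]:
  assumes "D \<in> Obj E" "env X D fs"
  shows "mor_tuple E D fs \<in> Arr E" "Dom E (mor_tuple E D fs) = D"
    "Cod E (mor_tuple E D fs) = ctx E (replicate (length fs) X)"
    "g \<in> Arr E \<Longrightarrow> Cod E g = D \<Longrightarrow> mor_tuple E D fs \<bullet> g = mor_tuple E (Dom E g) (shift g fs)"
  using assms(2)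
proof (induction fs)
  case Nil
  { case 1 then show ?case using assms(1) by (simp add: mor_tuple_def) }
  { case 2 then show ?case using assms(1) by (simp add: mor_tuple_def) }
  { case 3 then show ?case using assms(1) by (simp add: mor_tuple_def) }
  { case 4 then show ?case using assms(1) by (simp add: mor_tuple_def shift_def) }
next
  case (Cons f fs)
  { case 1 then show ?case using Cons.IH by (simp add: mor_tuple_Cons) }
  { case 2 then show ?case using Cons.IH by (simp add: mor_tuple_Cons) }
  { case 3 then show ?case using Cons.IH by (simp add: mor_tuple_Cons) }
  { case 4 then show ?case using Cons.IH by (simp add: mor_tuple_Cons) }
qed

lemma proj_mor_tuple:
  assumes "D \<in> Obj E" "X \<in> Obj E" "env X D fs" "i < length fs"
  shows "proj E (replicate (length fs) X) i \<bullet> mor_tuple E D fs = fs ! i"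
  using assms(3,4)
proof (induction fs arbitrary: i)
  case (Cons f fs)
  have s: "set (replicate (length fs) X) \<subseteq> Obj E" using assms(2) by auto
  have f: "f \<in> Arr E" "Dom E f = D" "Cod E f = X" "env X D fs" using Cons.prems by auto
  show ?case
  proof (cases i)
    case 0
    then show ?thesis using f assms(1,2) s by (simp add: mor_tuple_Cons)
  next
    case (Suc i')
    then show ?thesis using f Cons assms(1,2) s by (simp add: mor_tuple_Cons)
  qed
qed simp

text \<open>The value of \<open>op_le\<close> at two generalized elements, detached from any
  context; \<open>sem_op_le\<close> is the case of two variables.\<close>

definition le_val :: "'o \<Rightarrow> 'a \<Rightarrow> 'a \<Rightarrow> 'a" where
  "le_val D j k = sub_all E D \<Omega> (sub_imp E (Prod E D \<Omega>)
     (memb (Snd E D \<Omega>) (j \<bullet> Fst E D \<Omega>)) (memb (Snd E D \<Omega>) (k \<bullet> Fst E D \<Omega>)))"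

lemma le_val_simps [simp]:
  assumes "j \<in> Arr E" "k \<in> Arr E" "Dom E j = D" "Dom E k = D" "Cod E j = pw E \<Omega>" "Cod E k = pw E \<Omega>"
    "D \<in> Obj E"
  shows "le_val D j k \<in> Arr E" "Dom E (le_val D j k) = D" "Cod E (le_val D j k) = \<Omega>"
    "f \<in> Arr E \<Longrightarrow> Cod E f = D \<Longrightarrow> le_val D j k \<bullet> f = le_val (Dom E f) (j \<bullet> f) (k \<bullet> f)"
  using assms by (auto simp: le_val_def)

lemma tr_le_val:
  assumes "j \<in> Hom E D (pw E \<Omega>)" "k \<in> Hom E D (pw E \<Omega>)"
  shows "tr (le_val D j k) \<longleftrightarrow> (\<forall>D' f p. f \<in> Hom E D' D \<longrightarrow> p \<in> Hom E D' \<Omega> \<longrightarrow>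
    tr (memb p (j \<bullet> f)) \<longrightarrow> tr (memb p (k \<bullet> f)))"
proof -
  have D: "D \<in> Obj E" using assms by auto
  have "tr (le_val D j k) \<longleftrightarrow> (\<forall>D' f p. f \<in> Hom E D' D \<longrightarrow> p \<in> Hom E D' \<Omega> \<longrightarrow>
    tr (memb (Snd E D \<Omega>) (j \<bullet> Fst E D \<Omega>) \<bullet> pair E f p) \<longrightarrow> tr (memb (Snd E D \<Omega>) (k \<bullet> Fst E D \<Omega>) \<bullet> pair E f p))"
    unfolding le_val_def using assms D by (intro tr_sub_all_imp) auto
  also have "\<dots> \<longleftrightarrow> (\<forall>D' f p. f \<in> Hom E D' D \<longrightarrow> p \<in> Hom E D' \<Omega> \<longrightarrow>
    tr (memb p (j \<bullet> f)) \<longrightarrow> tr (memb p (k \<bullet> f)))"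
    by (intro all_cong1 imp_cong refl) (use assms D in simp_all)
  finally show ?thesis .
qed

text \<open>Currying. It merges the two premises of a bounded quantifier over operators, so that
  \<open>tr_sub_all_imp\<close> applies.\<close>

lemma sub_imp_sub_imp:
  assumes "p \<in> Hom E G \<Omega>" "q \<in> Hom E G \<Omega>" "r \<in> Hom E G \<Omega>"
  shows "sub_imp E G p (sub_imp E G q r) = sub_imp E G (sub_meet E G p q) r"
proof (rule tr_ext)
  show "sub_imp E G p (sub_imp E G q r) \<in> Hom E G \<Omega>" "sub_imp E G (sub_meet E G p q) r \<in> Hom E G \<Omega>"
    using assms by simp_all
  fix D f assume f: "f \<in> Hom E D G"
  have "tr (sub_imp E G p (sub_imp E G q r) \<bullet> f) \<longleftrightarrow>
     tr (sub_imp E D (p \<bullet> f) (sub_imp E D (q \<bullet> f) (r \<bullet> f)))"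
    using assms f by simp
  also have "\<dots> \<longleftrightarrow> tr (sub_imp E D (sub_meet E D (p \<bullet> f) (q \<bullet> f)) (r \<bullet> f))" (is "?l \<longleftrightarrow> ?r")
  proof -
    let ?p = "p \<bullet> f" and ?q = "q \<bullet> f" and ?r' = "r \<bullet> f"
    have h: "?p \<in> Hom E D \<Omega>" "?q \<in> Hom E D \<Omega>" "?r' \<in> Hom E D \<Omega>" using assms f by auto
    have "?l \<longleftrightarrow> (\<forall>D' g. g \<in> Hom E D' D \<longrightarrow> tr (?p \<bullet> g) \<longrightarrow> tr (sub_imp E D ?q ?r' \<bullet> g))"
      by (rule tr_sub_imp) (use h in simp_all)
    also have "\<dots> \<longleftrightarrow> (\<forall>D' g. g \<in> Hom E D' D \<longrightarrow> tr (?p \<bullet> g) \<longrightarrow> tr (?q \<bullet> g) \<longrightarrow> tr (?r' \<bullet> g))"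
    proof (intro iffI allI impI)
      fix D' g
      assume *: "\<forall>D' g. g \<in> Hom E D' D \<longrightarrow> tr (?p \<bullet> g) \<longrightarrow> tr (sub_imp E D ?q ?r' \<bullet> g)"
        and g: "g \<in> Hom E D' D" "tr (?p \<bullet> g)" "tr (?q \<bullet> g)"
      have "D' \<in> Obj E" using g by auto
      then show "tr (?r' \<bullet> g)"
        using sub_imp_eq(3)[OF h(2,3) g(1), THEN iffD1, rule_format, of "Idt E D'" D'] *[rule_format, OF g(1,2)]
          sub_imp_eq(2)[OF h(2,3)] g h by simp
    next
      fix D' g
      assume *: "\<forall>D' g. g \<in> Hom E D' D \<longrightarrow> tr (?p \<bullet> g) \<longrightarrow> tr (?q \<bullet> g) \<longrightarrow> tr (?r' \<bullet> g)"
        and g: "g \<in> Hom E D' D" "tr (?p \<bullet> g)"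
      show "tr (sub_imp E D ?q ?r' \<bullet> g)"
        unfolding sub_imp_eq(2)[OF h(2,3)] sub_imp_eq(3)[OF h(2,3) g(1)]
      proof (intro allI impI)
        fix D'' l assume l: "l \<in> Hom E D'' D'" "tr (?q \<bullet> g \<bullet> l)"
        have "tr (?p \<bullet> g \<bullet> l)" using tr_cmp[OF g(2), of l] g(1) l(1) assms f by simp
        then show "tr (?r' \<bullet> g \<bullet> l)" using *[rule_format, of "g \<bullet> l" D''] g(1) l by simp
      qed
    qed
    also have "\<dots> \<longleftrightarrow> (\<forall>D' g. g \<in> Hom E D' D \<longrightarrow> tr (sub_meet E D ?p ?q \<bullet> g) \<longrightarrow> tr (?r' \<bullet> g))"
    proof (intro all_cong1)
      fix D' g
      have "tr (sub_meet E D ?p ?q \<bullet> g) \<longleftrightarrow> tr (?p \<bullet> g) \<and> tr (?q \<bullet> g)" if "g \<in> Hom E D' D"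
        using sub_meet_eq[OF h(1,2)] that by simp
      then show "(g \<in> Hom E D' D \<longrightarrow> tr (?p \<bullet> g) \<longrightarrow> tr (?q \<bullet> g) \<longrightarrow> tr (?r' \<bullet> g)) \<longleftrightarrow>
        (g \<in> Hom E D' D \<longrightarrow> tr (sub_meet E D ?p ?q \<bullet> g) \<longrightarrow> tr (?r' \<bullet> g))"
        by blast
    qed
    also have "\<dots> \<longleftrightarrow> ?r"
      by (rule tr_sub_imp[symmetric]) (use h in simp_all)
    finally show ?thesis .
  qed
  also have "\<dots> \<longleftrightarrow> tr (sub_imp E G (sub_meet E G p q) r \<bullet> f)"
    using assms f by simp
  finally show "tr (sub_imp E G p (sub_imp E G q r) \<bullet> f) \<longleftrightarrow> tr (sub_imp E G (sub_meet E G p q) r \<bullet> f)" .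
qed

text \<open>The value of \<open>all_ge\<close>. The body \<open>c\<close> lives over
  \<open>D \<times> P\<Omega>\<close>, whose last factor is the bound operator.\<close>

definition all_ge_val :: "'o \<Rightarrow> 'a \<Rightarrow> 'a \<Rightarrow> 'a \<Rightarrow> 'a" where
  "all_ge_val D P j c = (let D' = Prod E D (pw E \<Omega>); f = Fst E D (pw E \<Omega>); k = Snd E D (pw E \<Omega>) in
     sub_all E D (pw E \<Omega>) (sub_imp E D' (memb k (P \<bullet> f)) (sub_imp E D' (le_val D' (j \<bullet> f) k) c)))"

lemma all_ge_val_simps [simp]:
  assumes "P \<in> Arr E" "j \<in> Arr E" "c \<in> Arr E" "Dom E P = D" "Dom E j = D" "Dom E c = Prod E D (pw E \<Omega>)"
    "Cod E P = pw E (pw E \<Omega>)" "Cod E j = pw E \<Omega>" "Cod E c = \<Omega>" "D \<in> Obj E"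
  shows "all_ge_val D P j c \<in> Arr E" "Dom E (all_ge_val D P j c) = D" "Cod E (all_ge_val D P j c) = \<Omega>"
    "f \<in> Arr E \<Longrightarrow> Cod E f = D \<Longrightarrow> all_ge_val D P j c \<bullet> f =
      all_ge_val (Dom E f) (P \<bullet> f) (j \<bullet> f)
        (c \<bullet> pair E (f \<bullet> Fst E (Dom E f) (pw E \<Omega>)) (Snd E (Dom E f) (pw E \<Omega>)))"
  using assms by (simp_all add: all_ge_val_def Let_def)

lemma tr_all_ge_val:
  assumes "P \<in> Hom E D (pw E (pw E \<Omega>))" "j \<in> Hom E D (pw E \<Omega>)" "c \<in> Hom E (Prod E D (pw E \<Omega>)) \<Omega>"
  shows "tr (all_ge_val D P j c) \<longleftrightarrow> (\<forall>D' f k. f \<in> Hom E D' D \<longrightarrow> k \<in> Hom E D' (pw E \<Omega>) \<longrightarrow>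
    tr (memb k (P \<bullet> f)) \<longrightarrow> tr (le_val D' (j \<bullet> f) k) \<longrightarrow> tr (c \<bullet> pair E f k))"
proof -
  let ?X = "pw E \<Omega>"
  let ?D = "Prod E D ?X" and ?F = "Fst E D ?X" and ?K = "Snd E D ?X"
  let ?p = "memb ?K (P \<bullet> ?F)" and ?q = "le_val ?D (j \<bullet> ?F) ?K"
  have D: "D \<in> Obj E" using assms by auto
  have h: "?p \<in> Hom E ?D \<Omega>" "?q \<in> Hom E ?D \<Omega>" using assms D by simp_all
  have eq: "all_ge_val D P j c = sub_all E D ?X (sub_imp E ?D (sub_meet E ?D ?p ?q) c)"
    using sub_imp_sub_imp[OF h assms(3)] by (simp add: all_ge_val_def Let_def)
  have red: "sub_meet E ?D ?p ?q \<bullet> pair E f k = sub_meet E D' (memb k (P \<bullet> f)) (le_val D' (j \<bullet> f) k)"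
    if "f \<in> Hom E D' D" "k \<in> Hom E D' ?X" for D' f k
    using that assms D by simp
  have "tr (all_ge_val D P j c) \<longleftrightarrow> (\<forall>D' f k. f \<in> Hom E D' D \<longrightarrow> k \<in> Hom E D' ?X \<longrightarrow>
      tr (sub_meet E ?D ?p ?q \<bullet> pair E f k) \<longrightarrow> tr (c \<bullet> pair E f k))"
    unfolding eq using assms D h by (intro tr_sub_all_imp) auto
  also have "\<dots> \<longleftrightarrow> (\<forall>D' f k. f \<in> Hom E D' D \<longrightarrow> k \<in> Hom E D' ?X \<longrightarrow>
      tr (memb k (P \<bullet> f)) \<and> tr (le_val D' (j \<bullet> f) k) \<longrightarrow> tr (c \<bullet> pair E f k))"
  proof (intro all_cong1 imp_cong refl)
    fix D' f k assume fk: "f \<in> Hom E D' D" "k \<in> Hom E D' ?X"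
    then have "D' \<in> Obj E" by auto
    then show "tr (sub_meet E ?D ?p ?q \<bullet> pair E f k) \<longleftrightarrow> tr (memb k (P \<bullet> f)) \<and> tr (le_val D' (j \<bullet> f) k)"
      unfolding red[OF fk] using fk assms by simp
  qed
  finally show ?thesis unfolding imp_conjL .
qed

text \<open>\<open>fval X D P j \<rho> \<phi>\<close> is the value of \<open>j \<tturnstile>\<^sub>P \<phi>\<close> at generalized elements \<open>P\<close>, \<open>j\<close> and
  variables \<open>\<rho>\<close> of stage \<open>D\<close>. Unlike the terms of the translation it does not depend on a
  context, so that weakening and substitution become composition with a morphism.\<close>

primrec fval :: "'o \<Rightarrow> 'o \<Rightarrow> 'a \<Rightarrow> 'a \<Rightarrow> 'a list \<Rightarrow> 'a lfm \<Rightarrow> 'a" where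
  "fval X D P j \<rho> (LAtom R is) = memb (R \<bullet> mor_tuple E D (map (nth \<rho>) is)) j"
| "fval X D P j \<rho> (LAnd \<phi> \<psi>) = sub_meet E D (fval X D P j \<rho> \<phi>) (fval X D P j \<rho> \<psi>)"
| "fval X D P j \<rho> (LOr \<phi> \<psi>) = memb (sub_join E D (fval X D P j \<rho> \<phi>) (fval X D P j \<rho> \<psi>)) j"
| "fval X D P j \<rho> (LImp \<phi> \<psi>) =
     (let D' = Prod E D (pw E \<Omega>); f = Fst E D (pw E \<Omega>); k = Snd E D (pw E \<Omega>) in
      all_ge_val D P j (sub_imp E D' (fval X D' (P \<bullet> f) k (shift f \<rho>) \<phi>)
        (fval X D' (P \<bullet> f) k (shift f \<rho>) \<psi>)))"
| "fval X D P j \<rho> (LEx \<phi>) = (let f = Fst E D X in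
     memb (sub_ex E D X (fval X (Prod E D X) (P \<bullet> f) (j \<bullet> f) (Snd E D X # shift f \<rho>) \<phi>)) j)"
| "fval X D P j \<rho> (LAll \<phi>) =
     (let D' = Prod E D (pw E \<Omega>); f = Fst E D (pw E \<Omega>); k = Snd E D (pw E \<Omega>); g = Fst E D' X in
      all_ge_val D P j (sub_all E D' X
        (fval X (Prod E D' X) (P \<bullet> f \<bullet> g) (k \<bullet> g) (Snd E D' X # shift (f \<bullet> g) \<rho>) \<phi>)))"

text \<open>The datatype \<open>lfm\<close> carries raw morphisms; this supplies their arity and
  codomain and bounds the free variables by \<open>n\<close>.\<close>

fun lwf :: "'o \<Rightarrow> nat \<Rightarrow> 'a lfm \<Rightarrow> bool" where
  "lwf X n (LAtom R is) \<longleftrightarrow> R \<in> Hom E (ctx E (replicate (length is) X)) \<Omega> \<and> (\<forall>i\<in>set is. i < n)"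
| "lwf X n (LAnd \<phi> \<psi>) \<longleftrightarrow> lwf X n \<phi> \<and> lwf X n \<psi>"
| "lwf X n (LOr \<phi> \<psi>) \<longleftrightarrow> lwf X n \<phi> \<and> lwf X n \<psi>"
| "lwf X n (LImp \<phi> \<psi>) \<longleftrightarrow> lwf X n \<phi> \<and> lwf X n \<psi>"
| "lwf X n (LEx \<phi>) \<longleftrightarrow> lwf X (Suc n) \<phi>"
| "lwf X n (LAll \<phi>) \<longleftrightarrow> lwf X (Suc n) \<phi>"

definition stage :: "'o \<Rightarrow> 'o \<Rightarrow> 'a \<Rightarrow> 'a \<Rightarrow> 'a list \<Rightarrow> bool" where
  "stage X D P j \<rho> \<longleftrightarrow> X \<in> Obj E \<and> D \<in> Obj E \<and> P \<in> Hom E D (pw E (pw E \<Omega>)) \<and>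
     j \<in> Hom E D (pw E \<Omega>) \<and> env X D \<rho>"

lemma stageD:
  assumes "stage X D P j \<rho>"
  shows "X \<in> Obj E" "D \<in> Obj E" "P \<in> Arr E" "Dom E P = D" "Cod E P = pw E (pw E \<Omega>)"
    "j \<in> Arr E" "Dom E j = D" "Cod E j = pw E \<Omega>" "env X D \<rho>"
  using assms by (auto simp: stage_def)

lemma env_map_nth: "env X D \<rho> \<Longrightarrow> \<forall>i\<in>set is. i < length \<rho> \<Longrightarrow> env X D (map (nth \<rho>) is)"
  unfolding env_def using nth_mem by auto

lemma shift_map_nth: "\<forall>i\<in>set is. i < length \<rho> \<Longrightarrow> shift f (map (nth \<rho>) is) = map (nth (shift f \<rho>)) is"
  by (auto simp: shift_def)

text \<open>Typing and stability under change of stage are proved in one induction, since rewriting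
  a composite with a compound value requires the types of its parts over the extended stage.\<close>

lemma fval_props:
  assumes "lwf X n \<phi>" "stage X D P j \<rho>" "length \<rho> = n"
  shows "fval X D P j \<rho> \<phi> \<in> Hom E D \<Omega> \<and> (\<forall>D' f. f \<in> Hom E D' D \<longrightarrow>
    fval X D P j \<rho> \<phi> \<bullet> f = fval X D' (P \<bullet> f) (j \<bullet> f) (shift f \<rho>) \<phi>)"
  using assms
proof (induction \<phi> arbitrary: n D P j \<rho>)
  case (LAtom R "is")
  note s = stageD[OF LAtom.prems(2)]
  have e: "env X D (map (nth \<rho>) is)" using LAtom.prems s by (simp add: env_map_nth)
  show ?case using LAtom.prems s e mor_tuple_simps[OF _ e] by (auto simp: shift_map_nth)
next
  case (LAnd \<phi> \<psi>)
  then show ?case using LAnd.IH[of n D P j \<rho>] by (auto simp: stage_def)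
next
  case (LOr \<phi> \<psi>)
  then show ?case using LOr.IH[of n D P j \<rho>] by (auto simp: stage_def)
next
  case (LImp \<phi> \<psi>)
  note s = stageD[OF LImp.prems(2)]
  let ?X = "pw E \<Omega>"
  let ?D = "Prod E D ?X" and ?F = "Fst E D ?X" and ?K = "Snd E D ?X"
  have st: "stage X ?D (P \<bullet> ?F) ?K (shift ?F \<rho>)" using s by (simp add: stage_def)
  have wf: "lwf X n \<phi>" "lwf X n \<psi>" "length (shift ?F \<rho>) = n" using LImp.prems by auto
  note I1 = LImp.IH(1)[OF wf(1) st wf(3)] and I2 = LImp.IH(2)[OF wf(2) st wf(3)]
  have hom: "fval X D P j \<rho> (LImp \<phi> \<psi>) \<in> Hom E D \<Omega>" using s I1 I2 by (simp add: Let_def)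
  moreover have "fval X D P j \<rho> (LImp \<phi> \<psi>) \<bullet> f = fval X D' (P \<bullet> f) (j \<bullet> f) (shift f \<rho>) (LImp \<phi> \<psi>)"
    if f: "f \<in> Hom E D' D" for D' f
  proof -
    have D': "D' \<in> Obj E" using f by auto
    \<comment> \<open>The change of stage under a binder is \<open>f \<times> id\<close>.\<close>
    let ?h = "pair E (f \<bullet> Fst E D' ?X) (Snd E D' ?X)"
    have h: "?h \<in> Hom E (Prod E D' ?X) ?D" using f s D' by simp
    show ?thesis
      using f s D' h I1[THEN conjunct2, rule_format, OF h] I2[THEN conjunct2, rule_format, OF h] I1 I2
      by (simp add: Let_def)
  qed
  ultimately show ?case by blast
next
  case (LEx \<phi>)
  note s = stageD[OF LEx.prems(2)]
  let ?D = "Prod E D X" and ?F = "Fst E D X" and ?K = "Snd E D X"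
  have st: "stage X ?D (P \<bullet> ?F) (j \<bullet> ?F) (?K # shift ?F \<rho>)" using s by (simp add: stage_def)
  have wf: "lwf X (Suc n) \<phi>" "length (?K # shift ?F \<rho>) = Suc n" using LEx.prems by auto
  note I1 = LEx.IH[OF wf(1) st wf(2)]
  have hom: "fval X D P j \<rho> (LEx \<phi>) \<in> Hom E D \<Omega>" using s I1 by (simp add: Let_def)
  moreover have "fval X D P j \<rho> (LEx \<phi>) \<bullet> f = fval X D' (P \<bullet> f) (j \<bullet> f) (shift f \<rho>) (LEx \<phi>)"
    if f: "f \<in> Hom E D' D" for D' f
  proof -
    have D': "D' \<in> Obj E" using f by auto
    let ?h = "pair E (f \<bullet> Fst E D' X) (Snd E D' X)"
    have h: "?h \<in> Hom E (Prod E D' X) ?D" using f s D' by simp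
    show ?thesis
      using f s D' h I1[THEN conjunct2, rule_format, OF h] I1 by (simp add: Let_def)
  qed
  ultimately show ?case by blast
next
  case (LAll \<phi>)
  note s = stageD[OF LAll.prems(2)]
  let ?X = "pw E \<Omega>"
  let ?D = "Prod E D ?X" and ?F = "Fst E D ?X" and ?K = "Snd E D ?X"
  let ?D2 = "Prod E ?D X" and ?F2 = "Fst E ?D X" and ?K2 = "Snd E ?D X"
  have st: "stage X ?D2 (P \<bullet> ?F \<bullet> ?F2) (?K \<bullet> ?F2) (?K2 # shift (?F \<bullet> ?F2) \<rho>)"
    using s by (simp add: stage_def)
  have wf: "lwf X (Suc n) \<phi>" "length (?K2 # shift (?F \<bullet> ?F2) \<rho>) = Suc n" using LAll.prems by auto
  note I1 = LAll.IH[OF wf(1) st wf(2)]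
  have hom: "fval X D P j \<rho> (LAll \<phi>) \<in> Hom E D \<Omega>" using s I1 by (simp add: Let_def)
  moreover have "fval X D P j \<rho> (LAll \<phi>) \<bullet> f = fval X D' (P \<bullet> f) (j \<bullet> f) (shift f \<rho>) (LAll \<phi>)"
    if f: "f \<in> Hom E D' D" for D' f
  proof -
    have D': "D' \<in> Obj E" using f by auto
    let ?h = "pair E (f \<bullet> Fst E D' ?X) (Snd E D' ?X)"
    let ?D' = "Prod E D' ?X"
    \<comment> \<open>Two binders, first the operator and then the variable, so
      \<open>f \<times> id \<times> id\<close>.\<close>
    let ?h2 = "pair E (?h \<bullet> Fst E ?D' X) (Snd E ?D' X)"
    have h: "?h \<in> Hom E ?D' ?D" using f s D' by simp
    have h2: "?h2 \<in> Hom E (Prod E ?D' X) ?D2" using f s D' by simp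
    show ?thesis
      using f s D' h h2 I1[THEN conjunct2, rule_format, OF h2] I1 by (simp add: Let_def)
  qed
  ultimately show ?case by blast
qed

section \<open>Forcing clauses at generalized elements\<close>

lemma tr_le_val_refl: "j \<in> Hom E D (pw E \<Omega>) \<Longrightarrow> tr (le_val D j j)"
  by (auto simp: tr_le_val)

lemma tr_le_val_trans:
  assumes "j \<in> Hom E D (pw E \<Omega>)" "k \<in> Hom E D (pw E \<Omega>)" "l \<in> Hom E D (pw E \<Omega>)"
    "tr (le_val D j k)" "tr (le_val D k l)"
  shows "tr (le_val D j l)"
  using assms(4,5) unfolding tr_le_val[OF assms(1,2)] tr_le_val[OF assms(2,3)] tr_le_val[OF assms(1,3)]
  by blast

lemma tr_le_val_cmp:
  assumes "tr (le_val D j k)" "j \<in> Hom E D (pw E \<Omega>)" "k \<in> Hom E D (pw E \<Omega>)" "f \<in> Hom E D' D"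
  shows "tr (le_val D' (j \<bullet> f) (k \<bullet> f))"
proof -
  have D: "D \<in> Obj E" using assms(2) by auto
  have "tr (le_val D j k \<bullet> f)" using assms D by (intro tr_cmp) auto
  then show ?thesis using assms D by simp
qed

lemma tr_memb_cmp:
  assumes "tr (memb k P)" "k \<in> Hom E D X" "P \<in> Hom E D (pw E X)" "f \<in> Hom E D' D"
  shows "tr (memb (k \<bullet> f) (P \<bullet> f))"
proof -
  have "tr (memb k P \<bullet> f)" using assms by (intro tr_cmp) auto
  then show ?thesis using assms by simp
qed

lemma tr_le_valD:
  assumes "tr (le_val D j k)" "j \<in> Hom E D (pw E \<Omega>)" "k \<in> Hom E D (pw E \<Omega>)" "p \<in> Hom E D \<Omega>" "tr (memb p j)"
  shows "tr (memb p k)"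
proof -
  have D: "D \<in> Obj E" using assms by auto
  show ?thesis
    using assms(1)[unfolded tr_le_val[OF assms(2,3)], rule_format, of "Idt E D" D p] assms(2-5) D by simp
qed

lemma fval_hom:
  assumes "lwf X (length \<rho>) \<phi>" "stage X D P j \<rho>"
  shows "fval X D P j \<rho> \<phi> \<in> Arr E" "Dom E (fval X D P j \<rho> \<phi>) = D" "Cod E (fval X D P j \<rho> \<phi>) = \<Omega>"
  using fval_props[OF assms refl] by simp_all

lemma fval_cmp:
  assumes "lwf X (length \<rho>) \<phi>" "stage X D P j \<rho>" "f \<in> Hom E D' D"
  shows "fval X D P j \<rho> \<phi> \<bullet> f = fval X D' (P \<bullet> f) (j \<bullet> f) (shift f \<rho>) \<phi>"
  using fval_props[OF assms(1,2) refl] assms(3) by blast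

lemma stage_cmp:
  assumes "stage X D P j \<rho>" "f \<in> Hom E D' D" "k \<in> Hom E D' (pw E \<Omega>)"
  shows "stage X D' (P \<bullet> f) k (shift f \<rho>)"
  using stageD[OF assms(1)] assms(2,3) by (auto simp: stage_def)

text \<open>One quantifier over stages suffices: when the antecedent holds only after a further
  change of stage \<open>l\<close>, the pair \<open>(f, k)\<close> is itself restricted along
  \<open>l\<close>, and membership in \<open>P\<close> as well as \<open>j \<le> k\<close> are
  preserved by this.\<close>

lemma tr_fval_LImp:
  assumes wf: "lwf X (length \<rho>) \<phi>" "lwf X (length \<rho>) \<psi>" and st: "stage X D P j \<rho>"
  shows "tr (fval X D P j \<rho> (LImp \<phi> \<psi>)) \<longleftrightarrow> (\<forall>D' f k. f \<in> Hom E D' D \<longrightarrow> k \<in> Hom E D' (pw E \<Omega>) \<longrightarrow>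
    tr (memb k (P \<bullet> f)) \<longrightarrow> tr (le_val D' (j \<bullet> f) k) \<longrightarrow>
    tr (fval X D' (P \<bullet> f) k (shift f \<rho>) \<phi>) \<longrightarrow> tr (fval X D' (P \<bullet> f) k (shift f \<rho>) \<psi>))" (is "?l \<longleftrightarrow> ?r")
proof -
  note s = stageD[OF st]
  let ?X = "pw E \<Omega>"
  let ?D = "Prod E D ?X" and ?F = "Fst E D ?X" and ?K = "Snd E D ?X"
  have st': "stage X ?D (P \<bullet> ?F) ?K (shift ?F \<rho>)" using s by (simp add: stage_def)
  have wf': "lwf X (length (shift ?F \<rho>)) \<phi>" "lwf X (length (shift ?F \<rho>)) \<psi>" using wf by simp_all
  let ?a = "fval X ?D (P \<bullet> ?F) ?K (shift ?F \<rho>) \<phi>" and ?b = "fval X ?D (P \<bullet> ?F) ?K (shift ?F \<rho>) \<psi>"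
  have ab: "?a \<in> Hom E ?D \<Omega>" "?b \<in> Hom E ?D \<Omega>" using fval_hom[OF wf'(1) st'] fval_hom[OF wf'(2) st'] by simp_all
  have red: "fval X ?D (P \<bullet> ?F) ?K (shift ?F \<rho>) \<chi> \<bullet> pair E f k = fval X D' (P \<bullet> f) k (shift f \<rho>) \<chi>"
    if "lwf X (length \<rho>) \<chi>" "f \<in> Hom E D' D" "k \<in> Hom E D' ?X" for \<chi> D' f k
    using fval_cmp[OF _ st', of \<chi> "pair E f k" D'] that s by simp
  have "?l \<longleftrightarrow> tr (all_ge_val D P j (sub_imp E ?D ?a ?b))" by (simp add: Let_def)
  also have "\<dots> \<longleftrightarrow> (\<forall>D' f k. f \<in> Hom E D' D \<longrightarrow> k \<in> Hom E D' ?X \<longrightarrow>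
    tr (memb k (P \<bullet> f)) \<longrightarrow> tr (le_val D' (j \<bullet> f) k) \<longrightarrow> tr (sub_imp E ?D ?a ?b \<bullet> pair E f k))"
    using s ab by (intro tr_all_ge_val) auto
  also have "\<dots> \<longleftrightarrow> ?r"
  proof
    assume *: "\<forall>D' f k. f \<in> Hom E D' D \<longrightarrow> k \<in> Hom E D' ?X \<longrightarrow>
      tr (memb k (P \<bullet> f)) \<longrightarrow> tr (le_val D' (j \<bullet> f) k) \<longrightarrow> tr (sub_imp E ?D ?a ?b \<bullet> pair E f k)"
    show ?r
    proof (intro allI impI)
      fix D' f k assume f: "f \<in> Hom E D' D" "k \<in> Hom E D' ?X" "tr (memb k (P \<bullet> f))" "tr (le_val D' (j \<bullet> f) k)"
        and \<phi>: "tr (fval X D' (P \<bullet> f) k (shift f \<rho>) \<phi>)"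
      have D': "D' \<in> Obj E" using f(1) by auto
      have h: "pair E f k \<in> Hom E D' ?D" using f(1,2) by simp
      have "tr (?a \<bullet> pair E f k)" unfolding red[OF wf(1) f(1,2)] by (rule \<phi>)
      then have "tr (?b \<bullet> pair E f k)"
        using *[rule_format, OF f] sub_imp_eq(3)[OF ab h, THEN iffD1, rule_format, of "Idt E D'" D']
          sub_imp_eq(2)[OF ab] f(1,2) D' by simp
      then show "tr (fval X D' (P \<bullet> f) k (shift f \<rho>) \<psi>)" unfolding red[OF wf(2) f(1,2)] .
    qed
  next
    assume r: ?r
    show "\<forall>D' f k. f \<in> Hom E D' D \<longrightarrow> k \<in> Hom E D' ?X \<longrightarrow>
      tr (memb k (P \<bullet> f)) \<longrightarrow> tr (le_val D' (j \<bullet> f) k) \<longrightarrow> tr (sub_imp E ?D ?a ?b \<bullet> pair E f k)"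
    proof (intro allI impI)
      fix D' f k assume f: "f \<in> Hom E D' D" "k \<in> Hom E D' ?X" "tr (memb k (P \<bullet> f))" "tr (le_val D' (j \<bullet> f) k)"
      have h: "pair E f k \<in> Hom E D' ?D" using f(1,2) by simp
      show "tr (sub_imp E ?D ?a ?b \<bullet> pair E f k)"
        unfolding sub_imp_eq(2)[OF ab] sub_imp_eq(3)[OF ab h]
      proof (intro allI impI)
        fix D'' l assume l: "l \<in> Hom E D'' D'" and a: "tr (?a \<bullet> pair E f k \<bullet> l)"
        have fl: "f \<bullet> l \<in> Hom E D'' D" "k \<bullet> l \<in> Hom E D'' ?X" "pair E f k \<bullet> l = pair E (f \<bullet> l) (k \<bullet> l)"
          using f(1,2) l by simp_all
        have "tr (memb (k \<bullet> l) (P \<bullet> f \<bullet> l))"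
          using tr_memb_cmp[OF f(3,2) _ l] f(1) s l by simp
        moreover have "tr (le_val D'' (j \<bullet> f \<bullet> l) (k \<bullet> l))"
          using tr_le_val_cmp[OF f(4) _ f(2) l] f(1) s l by simp
        moreover have "tr (fval X D'' (P \<bullet> f \<bullet> l) (k \<bullet> l) (shift (f \<bullet> l) \<rho>) \<phi>)"
          using a unfolding fl(3) red[OF wf(1) fl(1,2)] .
        ultimately show "tr (?b \<bullet> pair E f k \<bullet> l)"
          unfolding fl(3) red[OF wf(2) fl(1,2)] using r[rule_format, OF fl(1,2)] by blast
      qed
    qed
  qed
  finally show ?thesis .
qed

text \<open>The element \<open>x\<close> may live at a later stage than the operator; as for
  implication, restricting the operator to the stage of \<open>x\<close> merges the two
  quantifiers.\<close>

lemma tr_fval_LAll: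
  assumes wf: "lwf X (Suc (length \<rho>)) \<phi>" and st: "stage X D P j \<rho>"
  shows "tr (fval X D P j \<rho> (LAll \<phi>)) \<longleftrightarrow> (\<forall>D' f k x. f \<in> Hom E D' D \<longrightarrow> k \<in> Hom E D' (pw E \<Omega>) \<longrightarrow>
    x \<in> Hom E D' X \<longrightarrow> tr (memb k (P \<bullet> f)) \<longrightarrow> tr (le_val D' (j \<bullet> f) k) \<longrightarrow>
    tr (fval X D' (P \<bullet> f) k (x # shift f \<rho>) \<phi>))" (is "?l \<longleftrightarrow> ?r")
proof -
  note s = stageD[OF st]
  let ?X = "pw E \<Omega>"
  let ?D = "Prod E D ?X" and ?F = "Fst E D ?X" and ?K = "Snd E D ?X"
  let ?D2 = "Prod E ?D X" and ?F2 = "Fst E ?D X" and ?K2 = "Snd E ?D X"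
  let ?e = "?K2 # shift (?F \<bullet> ?F2) \<rho>"
  have D: "?D \<in> Obj E" using s by simp
  have st': "stage X ?D2 (P \<bullet> ?F \<bullet> ?F2) (?K \<bullet> ?F2) ?e" using s by (simp add: stage_def)
  have wf': "lwf X (length ?e) \<phi>" using wf by simp
  let ?a = "fval X ?D2 (P \<bullet> ?F \<bullet> ?F2) (?K \<bullet> ?F2) ?e \<phi>"
  have a: "?a \<in> Hom E ?D2 \<Omega>" using fval_hom[OF wf' st'] by simp
  have red: "?a \<bullet> pair E (pair E f k) x = fval X D' (P \<bullet> f) k (x # shift f \<rho>) \<phi>"
    if "f \<in> Hom E D' D" "k \<in> Hom E D' ?X" "x \<in> Hom E D' X" for D' f k x
    using fval_cmp[OF wf' st', of "pair E (pair E f k) x" D'] that s by simp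
  have "?l \<longleftrightarrow> tr (all_ge_val D P j (sub_all E ?D X ?a))" by (simp add: Let_def)
  also have "\<dots> \<longleftrightarrow> (\<forall>D' f k. f \<in> Hom E D' D \<longrightarrow> k \<in> Hom E D' ?X \<longrightarrow>
    tr (memb k (P \<bullet> f)) \<longrightarrow> tr (le_val D' (j \<bullet> f) k) \<longrightarrow> tr (sub_all E ?D X ?a \<bullet> pair E f k))"
    using s a by (intro tr_all_ge_val) auto
  also have "\<dots> \<longleftrightarrow> ?r"
  proof
    assume *: "\<forall>D' f k. f \<in> Hom E D' D \<longrightarrow> k \<in> Hom E D' ?X \<longrightarrow>
      tr (memb k (P \<bullet> f)) \<longrightarrow> tr (le_val D' (j \<bullet> f) k) \<longrightarrow> tr (sub_all E ?D X ?a \<bullet> pair E f k)"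
    show ?r
    proof (intro allI impI)
      fix D' f k x assume f: "f \<in> Hom E D' D" "k \<in> Hom E D' ?X" "x \<in> Hom E D' X"
        "tr (memb k (P \<bullet> f))" "tr (le_val D' (j \<bullet> f) k)"
      have D': "D' \<in> Obj E" using f(1) by auto
      have h: "pair E f k \<in> Hom E D' ?D" using f(1,2) by simp
      have i: "Idt E D' \<in> Hom E D' D'" using D' by simp
      have "tr (?a \<bullet> pair E (pair E f k \<bullet> Idt E D') x)"
        using *[rule_format, OF f(1,2,4,5)] sub_all_eq(3)[OF s(1) D a h, THEN iffD1, rule_format, OF _ i f(3)]
          sub_all_eq(2)[OF s(1) D a] by simp
      then show "tr (fval X D' (P \<bullet> f) k (x # shift f \<rho>) \<phi>)"
        unfolding red[OF f(1-3), symmetric] using f(1,2) D' by simp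
    qed
  next
    assume r: ?r
    show "\<forall>D' f k. f \<in> Hom E D' D \<longrightarrow> k \<in> Hom E D' ?X \<longrightarrow>
      tr (memb k (P \<bullet> f)) \<longrightarrow> tr (le_val D' (j \<bullet> f) k) \<longrightarrow> tr (sub_all E ?D X ?a \<bullet> pair E f k)"
    proof (intro allI impI)
      fix D' f k assume f: "f \<in> Hom E D' D" "k \<in> Hom E D' ?X" "tr (memb k (P \<bullet> f))" "tr (le_val D' (j \<bullet> f) k)"
      have h: "pair E f k \<in> Hom E D' ?D" using f(1,2) by simp
      show "tr (sub_all E ?D X ?a \<bullet> pair E f k)"
        unfolding sub_all_eq(2)[OF s(1) D a] sub_all_eq(3)[OF s(1) D a h]
      proof (intro allI impI)
        fix D'' l x assume l: "l \<in> Hom E D'' D'" and x: "x \<in> Hom E D'' X"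
        have fl: "f \<bullet> l \<in> Hom E D'' D" "k \<bullet> l \<in> Hom E D'' ?X" "pair E f k \<bullet> l = pair E (f \<bullet> l) (k \<bullet> l)"
          using f(1,2) l by simp_all
        have "tr (memb (k \<bullet> l) (P \<bullet> f \<bullet> l))"
          using tr_memb_cmp[OF f(3,2) _ l] f(1) s l by simp
        moreover have "tr (le_val D'' (j \<bullet> f \<bullet> l) (k \<bullet> l))"
          using tr_le_val_cmp[OF f(4) _ f(2) l] f(1) s l by simp
        ultimately show "tr (?a \<bullet> pair E (pair E f k \<bullet> l) x)"
          unfolding fl(3) red[OF fl(1,2) x] using r[rule_format, OF fl(1,2) x] by blast
      qed
    qed
  qed
  finally show ?thesis .
qed

section \<open>Local operators seen from outside, and persistence of forcing\<close>

text \<open>Unit and monotonicity, required at all later stages. The internal implication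
  \<open>p \<rightarrow> q\<close> appears as inclusion of subobjects of the stage.\<close>

definition lop :: "'o \<Rightarrow> 'a \<Rightarrow> bool" where
  "lop D j \<longleftrightarrow> (\<forall>D' f p. f \<in> Hom E D' D \<longrightarrow> p \<in> Hom E D' \<Omega> \<longrightarrow> tr p \<longrightarrow> tr (memb p (j \<bullet> f))) \<and>
    (\<forall>D' f p q. f \<in> Hom E D' D \<longrightarrow> p \<in> Hom E D' \<Omega> \<longrightarrow> q \<in> Hom E D' \<Omega> \<longrightarrow> sub_le E D' p q \<longrightarrow>
      tr (memb p (j \<bullet> f)) \<longrightarrow> tr (memb q (j \<bullet> f)))"

text \<open>The elements of an internal set exist at later stages, so its global elements would not
  be enough.\<close>

definition lops :: "'o \<Rightarrow> 'a \<Rightarrow> bool" where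
  "lops D P \<longleftrightarrow> (\<forall>D' f k. f \<in> Hom E D' D \<longrightarrow> k \<in> Hom E D' (pw E \<Omega>) \<longrightarrow> tr (memb k (P \<bullet> f)) \<longrightarrow> lop D' k)"

lemma lop_unit: "lop D j \<Longrightarrow> j \<in> Hom E D (pw E \<Omega>) \<Longrightarrow> p \<in> Hom E D \<Omega> \<Longrightarrow> tr p \<Longrightarrow> tr (memb p j)"
  unfolding lop_def by (metis Hom_iff Idt_simps cmp_Idt dom_obj)

lemma lop_mono: "lop D j \<Longrightarrow> j \<in> Hom E D (pw E \<Omega>) \<Longrightarrow> p \<in> Hom E D \<Omega> \<Longrightarrow> q \<in> Hom E D \<Omega> \<Longrightarrow>
    sub_le E D p q \<Longrightarrow> tr (memb p j) \<Longrightarrow> tr (memb q j)"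
  unfolding lop_def by (metis Hom_iff Idt_simps cmp_Idt dom_obj)

lemma lops_cmp:
  assumes "lops D P" "P \<in> Hom E D A" "f \<in> Hom E D' D"
  shows "lops D' (P \<bullet> f)"
  unfolding lops_def
proof (intro allI impI)
  fix D'' g k assume g: "g \<in> Hom E D'' D'" "k \<in> Hom E D'' (pw E \<Omega>)" "tr (memb k ((P \<bullet> f) \<bullet> g))"
  then show "lop D'' k"
    using assms(1)[unfolded lops_def, rule_format, of "f \<bullet> g" D'' k] assms(2,3) by simp
qed

lemma lopsD:
  assumes "lops D P" "P \<in> Hom E D (pw E (pw E \<Omega>))" "f \<in> Hom E D' D" "k \<in> Hom E D' (pw E \<Omega>)" "tr (memb k (P \<bullet> f))"
  shows "lop D' k"
  using assms unfolding lops_def by blast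

lemma sub_le_refl: "sub_le E G p p"
  by (simp add: sub_le_def)

lemma sub_le_trans: "sub_le E G p q \<Longrightarrow> sub_le E G q r \<Longrightarrow> sub_le E G p r"
  by (simp add: sub_le_def)

lemma sub_join_mono:
  assumes "p \<in> Hom E G \<Omega>" "q \<in> Hom E G \<Omega>" "p' \<in> Hom E G \<Omega>" "q' \<in> Hom E G \<Omega>"
    "sub_le E G p p'" "sub_le E G q q'"
  shows "sub_le E G (sub_join E G p q) (sub_join E G p' q')"
proof -
  note m = sub_join_props[OF assms(3,4)]
  have "sub_le E G p' (sub_join E G p' q')" "sub_le E G q' (sub_join E G p' q')"
    using m(2)[OF m(1)] sub_le_refl by auto
  then show ?thesis
    using sub_join_props(2)[OF assms(1,2) m(1)] sub_le_trans assms(5,6) by blast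
qed

lemma sub_ex_mono:
  assumes "X \<in> Obj E" "G \<in> Obj E" "p \<in> Hom E (Prod E G X) \<Omega>" "q \<in> Hom E (Prod E G X) \<Omega>"
    "sub_le E (Prod E G X) p q"
  shows "sub_le E G (sub_ex E G X p) (sub_ex E G X q)"
proof -
  note m = sub_ex_props[OF assms(1,2,4)]
  show ?thesis
    using sub_ex_props(2)[OF assms(1-3) m(1)] m(2)[OF m(1)] sub_le_refl sub_le_trans assms(5) by blast
qed

text \<open>The induction hypothesis enters for \<open>LAnd\<close>, \<open>LOr\<close> and
  \<open>LEx\<close> only. The last two need it at every later stage, as an inclusion of subobjects,
  hence the generalization over the stage and all data on it.\<close>

lemma fval_mono:
  assumes "lwf X n \<phi>" "n = length \<rho>" "stage X D P j \<rho>" "k \<in> Hom E D (pw E \<Omega>)" "lops D P" "tr (memb k P)"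
    "tr (le_val D j k)" "tr (fval X D P j \<rho> \<phi>)"
  shows "tr (fval X D P k \<rho> \<phi>)"
  using assms
proof (induction \<phi> arbitrary: n D P j k \<rho>)
  case (LAtom R "is")
  note s = stageD[OF LAtom.prems(3)]
  have e: "env X D (map (nth \<rho>) is)" using LAtom.prems s by (simp add: env_map_nth)
  have "R \<bullet> mor_tuple E D (map (nth \<rho>) is) \<in> Hom E D \<Omega>"
    using LAtom.prems(1) s e mor_tuple_simps[OF s(2) e] by simp
  then show ?case using tr_le_valD[OF LAtom.prems(7)] LAtom.prems(4,8) s by simp
next
  case (LAnd \<phi> \<psi>)
  note s = stageD[OF LAnd.prems(3)]
  have k: "stage X D P k \<rho>" using s LAnd.prems(4) by (simp add: stage_def)
  have wf: "lwf X (length \<rho>) \<phi>" "lwf X (length \<rho>) \<psi>" using LAnd.prems by simp_all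
  have "tr (fval X D P j \<rho> \<phi>)" "tr (fval X D P j \<rho> \<psi>)"
    using LAnd.prems(8) fval_hom[OF wf(1) LAnd.prems(3)] fval_hom[OF wf(2) LAnd.prems(3)] by simp_all
  then have "tr (fval X D P k \<rho> \<phi>)" "tr (fval X D P k \<rho> \<psi>)"
    using LAnd.IH[OF _ refl LAnd.prems(3-7)] wf by blast+
  then show ?case using fval_hom[OF wf(1) k] fval_hom[OF wf(2) k] by simp
next
  case (LOr \<phi> \<psi>)
  note st = LOr.prems(3) note s = stageD[OF st]
  have k: "stage X D P k \<rho>" using s LOr.prems(4) by (simp add: stage_def)
  have wf: "lwf X (length \<rho>) \<phi>" "lwf X (length \<rho>) \<psi>" using LOr.prems by simp_all
  have "lop D k" using lopsD[OF LOr.prems(5) _ _ LOr.prems(4), of "Idt E D"] LOr.prems(6) s by simp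
  \<comment> \<open>The induction hypothesis as an inclusion: it is applied at each \<open>f\<close>
    to the restrictions of \<open>P\<close>, \<open>j\<close>, \<open>k\<close> and the
    environment.\<close>
  have le: "sub_le E D (fval X D P j \<rho> \<chi>) (fval X D P k \<rho> \<chi>)"
    if wf: "lwf X (length \<rho>) \<chi>" and IH: "\<And>n D P j k \<rho>. lwf X n \<chi> \<Longrightarrow> n = length \<rho> \<Longrightarrow> stage X D P j \<rho> \<Longrightarrow>
      k \<in> Hom E D (pw E \<Omega>) \<Longrightarrow> lops D P \<Longrightarrow> tr (memb k P) \<Longrightarrow> tr (le_val D j k) \<Longrightarrow>
      tr (fval X D P j \<rho> \<chi>) \<Longrightarrow> tr (fval X D P k \<rho> \<chi>)" for \<chi>
  proof -
    have "tr (fval X D P k \<rho> \<chi> \<bullet> f)" if f: "f \<in> Hom E D' D" "tr (fval X D P j \<rho> \<chi> \<bullet> f)" for D' f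
      unfolding fval_cmp[OF wf k f(1)]
    proof (rule IH)
      show "lwf X (length (shift f \<rho>)) \<chi>" using wf by simp
      show "stage X D' (P \<bullet> f) (j \<bullet> f) (shift f \<rho>)" using stage_cmp[OF st f(1)] s f(1) by simp
      show "k \<bullet> f \<in> Hom E D' (pw E \<Omega>)" using f(1) LOr.prems(4) by simp
      show "lops D' (P \<bullet> f)" using lops_cmp[OF LOr.prems(5) _ f(1)] s by simp
      show "tr (memb (k \<bullet> f) (P \<bullet> f))" using tr_memb_cmp[OF LOr.prems(6,4) _ f(1)] s by simp
      show "tr (le_val D' (j \<bullet> f) (k \<bullet> f))" using tr_le_val_cmp[OF LOr.prems(7) _ LOr.prems(4) f(1)] s by simp
      show "tr (fval X D' (P \<bullet> f) (j \<bullet> f) (shift f \<rho>) \<chi>)" using f(2) unfolding fval_cmp[OF wf st f(1)] .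
    qed simp
    then show ?thesis using fval_hom[OF wf st] fval_hom[OF wf k] by (simp add: sub_le_iff)
  qed
  have jle: "sub_le E D (sub_join E D (fval X D P j \<rho> \<phi>) (fval X D P j \<rho> \<psi>))
     (sub_join E D (fval X D P k \<rho> \<phi>) (fval X D P k \<rho> \<psi>))"
    using fval_hom[OF wf(1) k] fval_hom[OF wf(2) k] fval_hom[OF wf(1) st] fval_hom[OF wf(2) st]
      le[OF wf(1) LOr.IH(1)] le[OF wf(2) LOr.IH(2)] by (intro sub_join_mono) simp_all
  \<comment> \<open>First the outer operator is changed from \<open>j\<close> to \<open>k\<close>;
    \<open>jle\<close> and monotonicity of \<open>k\<close> then change the inner one.\<close>
  have jt: "tr (memb (sub_join E D (fval X D P j \<rho> \<phi>) (fval X D P j \<rho> \<psi>)) k)"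
    using LOr.prems(4,8) s fval_hom[OF wf(1) st] fval_hom[OF wf(2) st]
    by (intro tr_le_valD[OF LOr.prems(7)]) simp_all
  show ?case
    using lop_mono[OF \<open>lop D k\<close> LOr.prems(4) _ _ jle jt]
      fval_hom[OF wf(1) k] fval_hom[OF wf(2) k] fval_hom[OF wf(1) st] fval_hom[OF wf(2) st] by simp
next
  case (LImp \<phi> \<psi>)
  note st = LImp.prems(3) note s = stageD[OF st]
  have k: "stage X D P k \<rho>" using s LImp.prems(4) by (simp add: stage_def)
  have wf: "lwf X (length \<rho>) \<phi>" "lwf X (length \<rho>) \<psi>" using LImp.prems by simp_all
  show ?case unfolding tr_fval_LImp[OF wf k]
  proof (intro allI impI)
    fix D' f l assume f: "f \<in> Hom E D' D" "l \<in> Hom E D' (pw E \<Omega>)" "tr (memb l (P \<bullet> f))"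
      "tr (le_val D' (k \<bullet> f) l)" "tr (fval X D' (P \<bullet> f) l (shift f \<rho>) \<phi>)"
    have "tr (le_val D' (j \<bullet> f) (k \<bullet> f))" using tr_le_val_cmp[OF LImp.prems(7) _ LImp.prems(4) f(1)] s by simp
    then have "tr (le_val D' (j \<bullet> f) l)"
      using tr_le_val_trans[OF _ _ f(2) _ f(4)] f(1) s LImp.prems(4) by simp
    then show "tr (fval X D' (P \<bullet> f) l (shift f \<rho>) \<psi>)"
      using LImp.prems(8)[unfolded tr_fval_LImp[OF wf st], rule_format, OF f(1-3) _ f(5)] by blast
  qed
next
  case (LEx \<phi>)
  note st = LEx.prems(3) note s = stageD[OF st]
  have k: "stage X D P k \<rho>" using s LEx.prems(4) by (simp add: stage_def)
  have kh: "k \<in> Arr E" "Dom E k = D" "Cod E k = pw E \<Omega>" using LEx.prems(4) by auto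
  let ?D = "Prod E D X" and ?F = "Fst E D X" and ?K = "Snd E D X"
  let ?e = "?K # shift ?F \<rho>"
  let ?a = "\<lambda>j. fval X ?D (P \<bullet> ?F) (j \<bullet> ?F) ?e \<phi>"
  have D: "?D \<in> Obj E" using s by simp
  have wf: "lwf X (length ?e) \<phi>" using LEx.prems by simp
  have st': "stage X ?D (P \<bullet> ?F) (j \<bullet> ?F) ?e" "stage X ?D (P \<bullet> ?F) (k \<bullet> ?F) ?e"
    using s kh by (simp_all add: stage_def)
  have "lop D k" using lopsD[OF LEx.prems(5) _ _ LEx.prems(4), of "Idt E D"] LEx.prems(6) s by simp
  have a: "?a j \<in> Hom E ?D \<Omega>" "?a k \<in> Hom E ?D \<Omega>" using fval_hom[OF wf st'(1)] fval_hom[OF wf st'(2)] by simp_all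
  \<comment> \<open>As for disjunction, but the inclusion is over \<open>D \<times> X\<close>, so
    the operators are first weakened along the projection.\<close>
  have "tr (?a k \<bullet> f)" if f: "f \<in> Hom E D' ?D" "tr (?a j \<bullet> f)" for D' f
    unfolding fval_cmp[OF wf st'(2) f(1)]
  proof (rule LEx.IH)
    have g: "?F \<bullet> f \<in> Hom E D' D" using f(1) s by simp
    show "lwf X (length (shift f ?e)) \<phi>" using wf by simp
    show "stage X D' ((P \<bullet> ?F) \<bullet> f) ((j \<bullet> ?F) \<bullet> f) (shift f ?e)" using stage_cmp[OF st'(1) f(1)] s f(1) by simp
    show "(k \<bullet> ?F) \<bullet> f \<in> Hom E D' (pw E \<Omega>)" using f(1) s kh by simp
    show "lops D' ((P \<bullet> ?F) \<bullet> f)" using lops_cmp[OF LEx.prems(5) _ g] s f(1) by simp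
    show "tr (memb ((k \<bullet> ?F) \<bullet> f) ((P \<bullet> ?F) \<bullet> f))" using tr_memb_cmp[OF LEx.prems(6,4) _ g] s kh f(1) by simp
    show "tr (le_val D' ((j \<bullet> ?F) \<bullet> f) ((k \<bullet> ?F) \<bullet> f))"
      using tr_le_val_cmp[OF LEx.prems(7) _ LEx.prems(4) g] s kh f(1) by simp
    show "tr (fval X D' ((P \<bullet> ?F) \<bullet> f) ((j \<bullet> ?F) \<bullet> f) (shift f ?e) \<phi>)"
      using f(2) unfolding fval_cmp[OF wf st'(1) f(1)] .
  qed simp
  then have "sub_le E ?D (?a j) (?a k)" using a by (simp add: sub_le_iff)
  then have xle: "sub_le E D (sub_ex E D X (?a j)) (sub_ex E D X (?a k))"
    using sub_ex_mono[OF s(1,2) a] by blast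
  have xt: "tr (memb (sub_ex E D X (?a j)) k)"
    using LEx.prems(4,8) s a by (intro tr_le_valD[OF LEx.prems(7)]) (simp_all add: Let_def)
  show ?case
    using lop_mono[OF \<open>lop D k\<close> LEx.prems(4) _ _ xle xt] a s by (simp add: Let_def)
next
  case (LAll \<phi>)
  note st = LAll.prems(3) note s = stageD[OF st]
  have k: "stage X D P k \<rho>" using s LAll.prems(4) by (simp add: stage_def)
  have wf: "lwf X (Suc (length \<rho>)) \<phi>" using LAll.prems by simp_all
  show ?case unfolding tr_fval_LAll[OF wf k]
  proof (intro allI impI)
    fix D' f l x assume f: "f \<in> Hom E D' D" "l \<in> Hom E D' (pw E \<Omega>)" "x \<in> Hom E D' X" "tr (memb l (P \<bullet> f))"
      "tr (le_val D' (k \<bullet> f) l)"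
    have "tr (le_val D' (j \<bullet> f) (k \<bullet> f))" using tr_le_val_cmp[OF LAll.prems(7) _ LAll.prems(4) f(1)] s by simp
    then have "tr (le_val D' (j \<bullet> f) l)"
      using tr_le_val_trans[OF _ _ f(2) _ f(5)] f(1) s LAll.prems(4) by simp
    then show "tr (fval X D' (P \<bullet> f) l (x # shift f \<rho>) \<phi>)"
      using LAll.prems(8)[unfolded tr_fval_LAll[OF wf st], rule_format, OF f(1-4)] by blast
  qed
qed


section \<open>Agreement of the translated terms with their values, and typing\<close>

lemma sem_op_le: "sem E \<Gamma> (op_le E j k) = le_val (ctx E \<Gamma>) (proj E \<Gamma> j) (proj E \<Gamma> k)"
  by (simp add: op_le_def le_val_def memb_def)

lemma sem_all_ge:
  "sem E \<Gamma> (all_ge E P j \<chi>) = all_ge_val (ctx E \<Gamma>) (proj E \<Gamma> P) (proj E \<Gamma> j) (sem E (pw E \<Omega> # \<Gamma>) \<chi>)"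
  by (simp add: all_ge_def all_ge_val_def Let_def sem_op_le) (simp add: memb_def)

lemma sem_tuple: "sem E \<Gamma> (tuple ts) = mor_tuple E (ctx E \<Gamma>) (map (sem E \<Gamma>) ts)"
  by (induction ts) (simp_all add: mor_tuple_def)

text \<open>The generic environment: the variables of the formula as projections of the ambient
  context.\<close>

definition vals :: "'o list \<Rightarrow> (nat \<Rightarrow> nat) \<Rightarrow> nat \<Rightarrow> 'a list" where
  "vals \<Gamma> v n = map (\<lambda>i. proj E \<Gamma> (v i)) [0..<n]"

lemma vals_shift: "vals (Y # \<Gamma>) (\<lambda>i. v i + 1) n = shift (Fst E (ctx E \<Gamma>) Y) (vals \<Gamma> v n)"
  by (simp add: vals_def shift_def)

lemma vals_up: "vals (Y # \<Gamma>) (up v) (Suc n) = Snd E (ctx E \<Gamma>) Y # shift (Fst E (ctx E \<Gamma>) Y) (vals \<Gamma> v n)"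
  unfolding vals_def map_upt_Suc shift_def by (simp add: up_def)

lemma env_vals:
  assumes "set \<Gamma> \<subseteq> Obj E" "\<forall>i<n. v i < length \<Gamma> \<and> \<Gamma> ! v i = X"
  shows "env X (ctx E \<Gamma>) (vals \<Gamma> v n)"
  using assms by (auto simp: env_def vals_def)

text \<open>The interpretation of a term is its value at the generic stage, which is the context
  itself with its projections as elements. Each binder adds a factor, and raising the indices past
  it is restriction along the first projection.\<close>

lemma sem_force:
  assumes "lwf X n \<phi>" "X \<in> Obj E" "set \<Gamma> \<subseteq> Obj E" "P < length \<Gamma>" "\<Gamma> ! P = pw E (pw E \<Omega>)"
    "j < length \<Gamma>" "\<Gamma> ! j = pw E \<Omega>" "\<forall>i<n. v i < length \<Gamma> \<and> \<Gamma> ! v i = X"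
  shows "sem E \<Gamma> (force E X P j v \<phi>) = fval X (ctx E \<Gamma>) (proj E \<Gamma> P) (proj E \<Gamma> j) (vals \<Gamma> v n) \<phi>"
  using assms
proof (induction \<phi> arbitrary: n \<Gamma> P j v)
  case (LAtom R "is")
  have "map (\<lambda>i. proj E \<Gamma> (v i)) is = map (nth (vals \<Gamma> v n)) is"
    using LAtom.prems(1) by (auto simp: vals_def)
  then show ?case by (simp add: sem_tuple o_def memb_def del: map_eq_conv)
next
  case (LImp \<phi> \<psi>)
  show ?case
    using LImp.prems LImp.IH[of n "pw E \<Omega> # \<Gamma>" "P + 1" 0 "\<lambda>i. v i + 1"]
    by (simp add: sem_all_ge vals_shift Let_def flip: One_nat_def) (simp add: vals_shift[simplified])
next
  case (LEx \<phi>)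
  have "\<forall>i<Suc n. up v i < length (X # \<Gamma>) \<and> (X # \<Gamma>) ! up v i = X"
    using LEx.prems(8) by (auto simp: up_def split: nat.split)
  then show ?case
    using LEx.prems LEx.IH[of "Suc n" "X # \<Gamma>" "P + 1" "j + 1" "up v"]
    by (simp add: vals_up memb_def Let_def)
next
  case (LAll \<phi>)
  have "\<forall>i<Suc n. up (\<lambda>i. v i + 1) i < length (X # pw E \<Omega> # \<Gamma>) \<and> (X # pw E \<Omega> # \<Gamma>) ! up (\<lambda>i. v i + 1) i = X"
    using LAll.prems(8) by (auto simp: up_def split: nat.split)
  then show ?case
    using LAll.prems LAll.IH[of "Suc n" "X # pw E \<Omega> # \<Gamma>" "P + 2" 1 "up (\<lambda>i. v i + 1)"] env_vals[OF LAll.prems(3,8)]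
    by (simp add: sem_all_ge vals_up vals_shift[simplified] Let_def)
next
  case (LAnd \<phi> \<psi>)
  show ?case using LAnd.prems LAnd.IH[of n \<Gamma> P j v] by simp
next
  case (LOr \<phi> \<psi>)
  show ?case using LOr.prems LOr.IH[of n \<Gamma> P j v] by (simp add: memb_def)
qed

text \<open>The type is a separate equation, so that applying the rule does not require unification
  with a list lookup.\<close>

lemma typed_TVar: "i < length \<Gamma> \<Longrightarrow> \<Gamma> ! i = A \<Longrightarrow> typed E \<Gamma> (TVar i) A"
  using typed.intros(1) by blast

lemma typed_tuple:
  "\<forall>t\<in>set ts. typed E \<Gamma> t X \<Longrightarrow> typed E \<Gamma> (tuple ts) (ctx E (replicate (length ts) X))"
  by (induction ts) (auto intro: typed.intros)

lemma typed_op_le: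
  "j < length \<Gamma> \<Longrightarrow> k < length \<Gamma> \<Longrightarrow> \<Gamma> ! j = pw E \<Omega> \<Longrightarrow> \<Gamma> ! k = pw E \<Omega> \<Longrightarrow> typed E \<Gamma> (op_le E j k) \<Omega>"
  unfolding op_le_def by (intro typed.intros(12,13) typed.intros(6)[of _ _ _ \<Omega>] typed_TVar) auto

lemma typed_all_ge:
  assumes "P < length \<Gamma>" "\<Gamma> ! P = pw E (pw E \<Omega>)" "j < length \<Gamma>" "\<Gamma> ! j = pw E \<Omega>"
    "typed E (pw E \<Omega> # \<Gamma>) \<chi> \<Omega>"
  shows "typed E \<Gamma> (all_ge E P j \<chi>) \<Omega>"
  unfolding all_ge_def using assms
  by (intro typed.intros(12,13) typed.intros(6)[of _ _ _ "pw E \<Omega>"] typed_TVar typed_op_le) auto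

lemma typed_force:
  assumes "lwf X n \<phi>" "X \<in> Obj E" "P < length \<Gamma>" "\<Gamma> ! P = pw E (pw E \<Omega>)"
    "j < length \<Gamma>" "\<Gamma> ! j = pw E \<Omega>" "\<forall>i<n. v i < length \<Gamma> \<and> \<Gamma> ! v i = X"
  shows "typed E \<Gamma> (force E X P j v \<phi>) \<Omega>"
  using assms
proof (induction \<phi> arbitrary: n \<Gamma> P j v)
  case (LAtom R "is")
  have "typed E \<Gamma> (tuple (map (\<lambda>i. TVar (v i)) is)) (ctx E (replicate (length is) X))"
    using typed_tuple[of "map (\<lambda>i. TVar (v i)) is" \<Gamma> X] LAtom.prems by (auto intro: typed_TVar)
  then have "typed E \<Gamma> (TApp R (tuple (map (\<lambda>i. TVar (v i)) is))) \<Omega>"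
    using LAtom.prems(1) by (intro typed.intros(4)[of R _ "ctx E (replicate (length is) X)"]) auto
  then show ?case using LAtom.prems by (auto intro!: typed.intros(6)[of _ _ _ \<Omega>] typed_TVar)
next
  case (LAnd \<phi> \<psi>)
  then show ?case by (auto intro!: typed.intros(10))
next
  case (LOr \<phi> \<psi>)
  then show ?case by (auto intro!: typed.intros(11) typed.intros(6)[of _ _ _ \<Omega>] typed_TVar)
next
  case (LImp \<phi> \<psi>)
  then show ?case
    using LImp.IH[where n = n and \<Gamma> = "pw E \<Omega> # \<Gamma>" and P = "P + 1" and j = 0 and v = "\<lambda>i. v i + 1"]
    by (auto intro!: typed_all_ge typed.intros(12))
next
  case (LEx \<phi>)
  have "\<forall>i<Suc n. up v i < length (X # \<Gamma>) \<and> (X # \<Gamma>) ! up v i = X"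
    using LEx.prems(7) by (auto simp: up_def split: nat.split)
  then show ?case
    using LEx.prems LEx.IH[where n = "Suc n" and \<Gamma> = "X # \<Gamma>" and P = "P + 1" and j = "j + 1" and v = "up v"]
    by (auto intro!: typed.intros(14) typed.intros(6)[of _ _ _ \<Omega>] typed_TVar)
next
  case (LAll \<phi>)
  have "\<forall>i<Suc n. up (\<lambda>i. v i + 1) i < length (X # pw E \<Omega> # \<Gamma>) \<and> (X # pw E \<Omega> # \<Gamma>) ! up (\<lambda>i. v i + 1) i = X"
    using LAll.prems(7) by (auto simp: up_def split: nat.split)
  then show ?case
    using LAll.prems LAll.IH[where n = "Suc n" and \<Gamma> = "X # pw E \<Omega> # \<Gamma>" and P = "P + 2" and j = 1 and v = "up (\<lambda>i. v i + 1)"]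
    by (auto intro!: typed_all_ge typed.intros(13))
qed

subsection \<open>The internal object of local operators\<close>

definition unit_val :: "'o \<Rightarrow> 'a \<Rightarrow> 'a" where
  "unit_val D j = sub_all E D \<Omega> (sub_imp E (Prod E D \<Omega>) (Snd E D \<Omega>) (memb (Snd E D \<Omega>) (j \<bullet> Fst E D \<Omega>)))"

definition idem_val :: "'o \<Rightarrow> 'a \<Rightarrow> 'a" where
  "idem_val D j = sub_all E D \<Omega> (sub_imp E (Prod E D \<Omega>)
     (memb (memb (Snd E D \<Omega>) (j \<bullet> Fst E D \<Omega>)) (j \<bullet> Fst E D \<Omega>)) (memb (Snd E D \<Omega>) (j \<bullet> Fst E D \<Omega>)))"

text \<open>The inner quantifier of the monotonicity law, split off with \<open>p\<close> as a
  parameter so that each of the two nested quantifiers can be unfolded and restricted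
  separately.\<close>

definition mono_at_val :: "'o \<Rightarrow> 'a \<Rightarrow> 'a \<Rightarrow> 'a" where
  "mono_at_val D j p = (let D' = Prod E D \<Omega>; f = Fst E D \<Omega>; q = Snd E D \<Omega> in
     sub_all E D \<Omega> (sub_imp E D' (sub_imp E D' (p \<bullet> f) q)
       (sub_imp E D' (memb (p \<bullet> f) (j \<bullet> f)) (memb q (j \<bullet> f)))))"

definition mono_val :: "'o \<Rightarrow> 'a \<Rightarrow> 'a" where
  "mono_val D j = sub_all E D \<Omega> (mono_at_val (Prod E D \<Omega>) (j \<bullet> Fst E D \<Omega>) (Snd E D \<Omega>))"

definition lop_val :: "'o \<Rightarrow> 'a \<Rightarrow> 'a" where
  "lop_val D j = sub_meet E D (unit_val D j) (sub_meet E D (idem_val D j) (mono_val D j))"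

lemma sem_is_lop: "sem E \<Gamma> (is_lop E j) = lop_val (ctx E \<Gamma>) (proj E \<Gamma> j)"
  by (simp add: is_lop_def lop_val_def unit_val_def idem_val_def mono_val_def mono_at_val_def memb_def Let_def)

lemma unit_val_simps [simp]:
  assumes "j \<in> Arr E" "Dom E j = D" "Cod E j = pw E \<Omega>" "D \<in> Obj E"
  shows "unit_val D j \<in> Arr E" "Dom E (unit_val D j) = D" "Cod E (unit_val D j) = \<Omega>"
    "f \<in> Arr E \<Longrightarrow> Cod E f = D \<Longrightarrow> unit_val D j \<bullet> f = unit_val (Dom E f) (j \<bullet> f)"
  using assms by (simp_all add: unit_val_def)

lemma idem_val_simps [simp]:
  assumes "j \<in> Arr E" "Dom E j = D" "Cod E j = pw E \<Omega>" "D \<in> Obj E"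
  shows "idem_val D j \<in> Arr E" "Dom E (idem_val D j) = D" "Cod E (idem_val D j) = \<Omega>"
    "f \<in> Arr E \<Longrightarrow> Cod E f = D \<Longrightarrow> idem_val D j \<bullet> f = idem_val (Dom E f) (j \<bullet> f)"
  using assms by (simp_all add: idem_val_def)

lemma mono_at_val_simps [simp]:
  assumes "j \<in> Arr E" "Dom E j = D" "Cod E j = pw E \<Omega>" "p \<in> Arr E" "Dom E p = D" "Cod E p = \<Omega>" "D \<in> Obj E"
  shows "mono_at_val D j p \<in> Arr E" "Dom E (mono_at_val D j p) = D" "Cod E (mono_at_val D j p) = \<Omega>"
    "f \<in> Arr E \<Longrightarrow> Cod E f = D \<Longrightarrow> mono_at_val D j p \<bullet> f = mono_at_val (Dom E f) (j \<bullet> f) (p \<bullet> f)"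
  using assms by (simp_all add: mono_at_val_def Let_def)

lemma mono_val_simps [simp]:
  assumes "j \<in> Arr E" "Dom E j = D" "Cod E j = pw E \<Omega>" "D \<in> Obj E"
  shows "mono_val D j \<in> Arr E" "Dom E (mono_val D j) = D" "Cod E (mono_val D j) = \<Omega>"
    "f \<in> Arr E \<Longrightarrow> Cod E f = D \<Longrightarrow> mono_val D j \<bullet> f = mono_val (Dom E f) (j \<bullet> f)"
  using assms by (simp_all add: mono_val_def)

lemma lop_val_simps [simp]:
  assumes "j \<in> Arr E" "Dom E j = D" "Cod E j = pw E \<Omega>" "D \<in> Obj E"
  shows "lop_val D j \<in> Arr E" "Dom E (lop_val D j) = D" "Cod E (lop_val D j) = \<Omega>"
    "f \<in> Arr E \<Longrightarrow> Cod E f = D \<Longrightarrow> lop_val D j \<bullet> f = lop_val (Dom E f) (j \<bullet> f)"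
  using assms by (simp_all add: lop_val_def)

lemma tr_sub_imp_mp:
  assumes "tr (sub_imp E G p q)" "tr p" "p \<in> Hom E G \<Omega>" "q \<in> Hom E G \<Omega>"
  shows "tr q"
proof -
  have G: "G \<in> Obj E" using assms(3) by auto
  then show ?thesis
    using assms(1)[unfolded tr_sub_imp[OF assms(3,4)], rule_format, of "Idt E G" G] assms(2-4) by simp
qed

text \<open>An inclusion of subobjects of \<open>D\<close> is a true implication at
  \<open>D\<close>, so the inner quantifier can be instantiated at the identity stage and followed
  by modus ponens.\<close>

lemma tr_mono_at_val:
  assumes "tr (mono_at_val D j p)" "j \<in> Hom E D (pw E \<Omega>)" "p \<in> Hom E D \<Omega>" "q \<in> Hom E D \<Omega>"
    and le: "sub_le E D p q" and jp: "tr (memb p j)"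
  shows "tr (memb q j)"
proof -
  let ?D = "Prod E D \<Omega>" and ?f = "Fst E D \<Omega>" and ?q = "Snd E D \<Omega>"
  let ?a = "sub_imp E ?D (p \<bullet> ?f) ?q" and ?b = "sub_imp E ?D (memb (p \<bullet> ?f) (j \<bullet> ?f)) (memb ?q (j \<bullet> ?f))"
  have D: "D \<in> Obj E" using assms(2) by auto
  have ab: "?a \<in> Hom E ?D \<Omega>" "?b \<in> Hom E ?D \<Omega>" using assms(2,3) D by simp_all
  have i: "Idt E D \<in> Hom E D D" using D by simp
  have e: "?a \<bullet> pair E (Idt E D) q = sub_imp E D p q"
    "?b \<bullet> pair E (Idt E D) q = sub_imp E D (memb p j) (memb q j)"
    using assms(2-4) D by simp_all
  have m: "memb p j \<in> Hom E D \<Omega>" "memb q j \<in> Hom E D \<Omega>" using assms(2-4) by simp_all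
  have "tr (sub_imp E D p q)" using le unfolding tr_sub_imp[OF assms(3,4)] sub_le_iff[OF assms(3,4)] .
  then have "tr (sub_imp E D (memb p j) (memb q j))"
    using assms(1)[unfolded mono_at_val_def Let_def tr_sub_all_imp[OF omega_obj D ab], rule_format, OF i assms(4)]
    unfolding e by blast
  then show ?thesis by (rule tr_sub_imp_mp[OF _ jp m])
qed

text \<open>Passage from the internal predicate to \<open>lop\<close>: the conjuncts for unit and
  monotonicity are unfolded at each later stage.\<close>

lemma tr_lop_val:
  assumes "tr (lop_val D j)" "j \<in> Hom E D (pw E \<Omega>)"
  shows "lop D j"
proof -
  have D: "D \<in> Obj E" using assms(2) by auto
  let ?D = "Prod E D \<Omega>" and ?f = "Fst E D \<Omega>" and ?p = "Snd E D \<Omega>"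
  have u: "tr (unit_val D j)" and m: "tr (mono_val D j)"
    using assms D by (simp_all add: lop_val_def)
  have h: "?p \<in> Hom E ?D \<Omega>" "memb ?p (j \<bullet> ?f) \<in> Hom E ?D \<Omega>" "mono_at_val ?D (j \<bullet> ?f) ?p \<in> Hom E ?D \<Omega>"
    using assms(2) D by simp_all
  show ?thesis
    unfolding lop_def
  proof (intro conjI allI impI)
    fix D' f p assume f: "f \<in> Hom E D' D" "p \<in> Hom E D' \<Omega>" "tr p"
    have e: "?p \<bullet> pair E f p = p" "memb ?p (j \<bullet> ?f) \<bullet> pair E f p = memb p (j \<bullet> f)"
      using f(1,2) assms(2) D by simp_all
    show "tr (memb p (j \<bullet> f))"
      using u[unfolded unit_val_def tr_sub_all_imp[OF omega_obj D h(1,2)], rule_format, OF f(1,2)] f(3)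
      unfolding e by blast
  next
    fix D' f p q
    assume f: "f \<in> Hom E D' D" and p: "p \<in> Hom E D' \<Omega>" and q: "q \<in> Hom E D' \<Omega>"
      and le: "sub_le E D' p q" and jp: "tr (memb p (j \<bullet> f))"
    have "tr (mono_at_val ?D (j \<bullet> ?f) ?p \<bullet> pair E f p)"
      using m[unfolded mono_val_def tr_sub_all[OF omega_obj D h(3)], rule_format, OF f p] .
    moreover have "mono_at_val ?D (j \<bullet> ?f) ?p \<bullet> pair E f p = mono_at_val D' (j \<bullet> f) p"
      using f p D assms(2) by simp
    ultimately have "tr (mono_at_val D' (j \<bullet> f) p)" by simp
    then show "tr (memb q (j \<bullet> f))"
      by (rule tr_mono_at_val[OF _ _ p q le jp]) (use f assms(2) in simp)
  qed
qed

lemma sem_mem_Lop: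
  assumes "set \<Gamma> \<subseteq> Obj E" "i < length \<Gamma>" "\<Gamma> ! i = pw E \<Omega>"
  shows "sem E \<Gamma> (TMem (TVar i) (Lop E)) = lop_val (ctx E \<Gamma>) (proj E \<Gamma> i)"
proof -
  let ?G = "ctx E \<Gamma>" and ?X = "pw E \<Omega>"
  let ?l = "lop_val (Prod E ?G ?X) (Snd E ?G ?X)"
  have G: "?G \<in> Obj E" using assms(1) by simp
  have i: "proj E \<Gamma> i \<in> Arr E" "Dom E (proj E \<Gamma> i) = ?G" "Cod E (proj E \<Gamma> i) = ?X" using assms by simp_all
  have "sem E \<Gamma> (TMem (TVar i) (Lop E)) = memb (proj E \<Gamma> i) (curried E ?G ?X \<Omega> ?l)"
    using i by (simp add: Lop_def sem_is_lop memb_def)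
  \<comment> \<open>The identity is inserted so that the transpose has the form expected by
    \<open>memb_curried\<close>.\<close>
  also have "\<dots> = memb (proj E \<Gamma> i) (curried E ?G ?X \<Omega> ?l \<bullet> Idt E ?G)"
    using G by simp
  also have "\<dots> = ?l \<bullet> pair E (Idt E ?G) (proj E \<Gamma> i)"
    using G i by (intro memb_curried) simp_all
  also have "\<dots> = lop_val ?G (proj E \<Gamma> i)" using G i by simp
  finally show ?thesis .
qed

definition lops_val :: "'o \<Rightarrow> 'a \<Rightarrow> 'a" where
  "lops_val D P = sub_all E D (pw E \<Omega>) (sub_imp E (Prod E D (pw E \<Omega>))
     (memb (Snd E D (pw E \<Omega>)) (P \<bullet> Fst E D (pw E \<Omega>))) (lop_val (Prod E D (pw E \<Omega>)) (Snd E D (pw E \<Omega>))))"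

lemma lops_val_simps [simp]:
  assumes "P \<in> Arr E" "Dom E P = D" "Cod E P = pw E (pw E \<Omega>)" "D \<in> Obj E"
  shows "lops_val D P \<in> Arr E" "Dom E (lops_val D P) = D" "Cod E (lops_val D P) = \<Omega>"
    "f \<in> Arr E \<Longrightarrow> Cod E f = D \<Longrightarrow> lops_val D P \<bullet> f = lops_val (Dom E f) (P \<bullet> f)"
  using assms by (simp_all add: lops_val_def)

lemma tr_lops_val:
  assumes "tr (lops_val D P)" "P \<in> Hom E D (pw E (pw E \<Omega>))"
  shows "lops D P"
  unfolding lops_def
proof (intro allI impI)
  let ?X = "pw E \<Omega>"
  let ?D = "Prod E D ?X" and ?F = "Fst E D ?X" and ?K = "Snd E D ?X"
  fix D' f k assume f: "f \<in> Hom E D' D" "k \<in> Hom E D' ?X" "tr (memb k (P \<bullet> f))"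
  have D: "D \<in> Obj E" "?X \<in> Obj E" using assms(2) by auto
  have h: "memb ?K (P \<bullet> ?F) \<in> Hom E ?D \<Omega>" "lop_val ?D ?K \<in> Hom E ?D \<Omega>" using assms(2) D by simp_all
  have e: "memb ?K (P \<bullet> ?F) \<bullet> pair E f k = memb k (P \<bullet> f)" "lop_val ?D ?K \<bullet> pair E f k = lop_val D' k"
    using f(1,2) assms(2) D by simp_all
  have "tr (lop_val D' k)"
    using assms(1)[unfolded lops_val_def tr_sub_all_imp[OF D(2,1) h], rule_format, OF f(1,2)] f(3)
    unfolding e by blast
  then show "lop D' k" using f(2) by (rule tr_lop_val)
qed

lemma sem_sub_Lop:
  assumes "set \<Gamma> \<subseteq> Obj E"
  shows "sem E \<Gamma> (sub_Lop E P) = lops_val (ctx E \<Gamma>) (proj E \<Gamma> P)"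
proof -
  have "sem E (pw E \<Omega> # \<Gamma>) (TMem (TVar 0) (Lop E)) = lop_val (ctx E (pw E \<Omega> # \<Gamma>)) (proj E (pw E \<Omega> # \<Gamma>) 0)"
    using assms by (intro sem_mem_Lop) simp_all
  then show ?thesis by (simp add: sub_Lop_def lops_val_def memb_def)
qed

lemma typed_is_lop:
  "j < length \<Gamma> \<Longrightarrow> \<Gamma> ! j = pw E \<Omega> \<Longrightarrow> typed E \<Gamma> (is_lop E j) \<Omega>"
  unfolding is_lop_def
  by (intro typed.intros(10,12,13) typed.intros(6)[of _ _ _ \<Omega>] typed_TVar) auto

lemma typed_mem_Lop:
  "i < length \<Gamma> \<Longrightarrow> \<Gamma> ! i = pw E \<Omega> \<Longrightarrow> typed E \<Gamma> (TMem (TVar i) (Lop E)) \<Omega>"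
  unfolding Lop_def
  by (intro typed.intros(7) typed.intros(6)[of _ _ _ "pw E \<Omega>"] typed_TVar typed_is_lop) auto

lemma typed_sub_Lop:
  "P < length \<Gamma> \<Longrightarrow> \<Gamma> ! P = pw E (pw E \<Omega>) \<Longrightarrow> typed E \<Gamma> (sub_Lop E P) \<Omega>"
  unfolding sub_Lop_def
  by (intro typed.intros(12,13) typed_mem_Lop typed.intros(6)[of _ _ _ "pw E \<Omega>"] typed_TVar) auto

end

subsection \<open>Arithmetic on the natural numbers object\<close>

locale topos_nno = elementary_topos E for E :: "('o, 'a) topos" +
  fixes N :: 'o and z s :: 'a
  assumes nno: "nno E N z s"
begin

lemma nno_simps [simp]:
  "N \<in> Obj E" "z \<in> Arr E" "Dom E z = One E" "Cod E z = N" "s \<in> Arr E" "Dom E s = N" "Cod E s = N"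
  using nno by (auto simp: nno_def)

lemma nno_rec:
  assumes "a \<in> Hom E (One E) A" "f \<in> Hom E A A"
  shows "\<exists>!h. h \<in> Hom E N A \<and> h \<bullet> z = a \<and> h \<bullet> s = f \<bullet> h"
proof -
  have "A \<in> Obj E" using assms by auto
  then show ?thesis using nno assms unfolding nno_def by blast
qed

text \<open>The identity solves the recursion problem with data \<open>z\<close> and
  \<open>s\<close>, whose solution is unique.\<close>

lemma nno_endo:
  assumes "h \<in> Hom E N N" "h \<bullet> z = z" "h \<bullet> s = s \<bullet> h"
  shows "h = Idt E N"
proof -
  have "z \<in> Hom E (One E) N" "s \<in> Hom E N N" by simp_all
  note rec = nno_rec[OF this]
  have "Idt E N \<in> Hom E N N \<and> Idt E N \<bullet> z = z \<and> Idt E N \<bullet> s = s \<bullet> Idt E N" by simp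
  then show ?thesis using rec assms by blast
qed

text \<open>The subobject \<open>e\<close> of \<open>N\<close> classified by \<open>c\<close>
  contains zero and is closed under successor. Recursion into its domain yields a section of
  \<open>e\<close>, and since \<open>c\<close> is true on \<open>e\<close>, it is true on
  \<open>N\<close>.\<close>

lemma nno_induct_global:
  assumes c: "c \<in> Hom E N \<Omega>" and base: "tr (c \<bullet> z)"
    and step: "\<And>D y. y \<in> Hom E D N \<Longrightarrow> tr (c \<bullet> y) \<Longrightarrow> tr (c \<bullet> s \<bullet> y)"
  shows "tr c"
proof -
  obtain e where e: "e \<in> Arr E" "Cod E e = N" "c \<bullet> e = true_at E N \<bullet> e"
    and u: "\<forall>D\<in>Obj E. \<forall>h\<in>Hom E D N. c \<bullet> h = true_at E N \<bullet> h \<longrightarrow>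
      (\<exists>!k. k \<in> Hom E D (Dom E e) \<and> e \<bullet> k = h)"
    using equalizer[of c N \<Omega> "true_at E N"] c by force
  have fac: "\<exists>k. k \<in> Hom E D (Dom E e) \<and> e \<bullet> k = h" if "h \<in> Hom E D N" "tr (c \<bullet> h)" for D h
  proof -
    have "D \<in> Obj E" using that by auto
    moreover have "c \<bullet> h = true_at E N \<bullet> h" using that c by (simp add: tr_def)
    ultimately show ?thesis using u that(1) by blast
  qed
  have te: "tr (c \<bullet> e)" using e c by (simp add: tr_def)
  obtain z' where z': "z' \<in> Hom E (One E) (Dom E e)" "e \<bullet> z' = z"
    using fac[of z "One E"] base by auto
  have "tr (c \<bullet> s \<bullet> e)" using step[of e "Dom E e"] te e(1,2) by simp
  then obtain s' where s': "s' \<in> Hom E (Dom E e) (Dom E e)" "e \<bullet> s' = s \<bullet> e"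
    using fac[of "s \<bullet> e" "Dom E e"] e(1,2) by auto
  obtain h where h: "h \<in> Hom E N (Dom E e)" "h \<bullet> z = z'" "h \<bullet> s = s' \<bullet> h"
    using nno_rec[OF z'(1) s'(1)] by blast
  \<comment> \<open>The composite \<open>e \<bullet> h\<close> respects zero and successor, which
    leaves the identity only.\<close>
  have "e \<bullet> h = Idt E N"
  proof (rule nno_endo)
    show "e \<bullet> h \<in> Hom E N N" using e(1,2) h(1) by simp
    show "(e \<bullet> h) \<bullet> z = z" using e(1,2) h(1,2) z'(2) by simp
    have "(e \<bullet> h) \<bullet> s = e \<bullet> s' \<bullet> h" using e(1,2) h(1,3) by simp
    also have "\<dots> = (e \<bullet> s') \<bullet> h" using e(1,2) h(1) s'(1) by simp
    also have "\<dots> = s \<bullet> e \<bullet> h" using e(1,2) h(1) s'(2) by simp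
    finally show "(e \<bullet> h) \<bullet> s = s \<bullet> e \<bullet> h" .
  qed
  then have "c = (c \<bullet> e) \<bullet> h" using e(1,2) h(1) c by simp
  then show ?thesis using tr_cmp[OF te, of h] e(1,2) h(1) c by simp
qed

text \<open>Induction with parameters in \<open>D\<close> reduces to the version without them for
  the predicate "for all \<open>d\<close>, \<open>c(d, y)\<close>" of \<open>y\<close>.\<close>

lemma nno_induct:
  assumes D: "D \<in> Obj E" and c: "c \<in> Hom E (Prod E D N) \<Omega>"
    and base: "tr (c \<bullet> pair E (Idt E D) (z \<bullet> bang E D))"
    and step: "\<And>D' k y. k \<in> Hom E D' D \<Longrightarrow> y \<in> Hom E D' N \<Longrightarrow> tr (c \<bullet> pair E k y) \<Longrightarrow> tr (c \<bullet> pair E k (s \<bullet> y))"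
  shows "tr c"
proof -
  \<comment> \<open>The factors are swapped because \<open>sub_all\<close> quantifies over the last
    one.\<close>
  let ?q = "c \<bullet> pair E (Snd E N D) (Fst E N D)"
  have q: "?q \<in> Hom E (Prod E N D) \<Omega>" using D c by simp
  note a = sub_all_eq[OF D nno_simps(1) q]
  let ?a = "sub_all E N D ?q"
  have a_iff: "tr (?a \<bullet> y) \<longleftrightarrow> (\<forall>D'' k d. k \<in> Hom E D'' D' \<longrightarrow> d \<in> Hom E D'' D \<longrightarrow> tr (c \<bullet> pair E d (y \<bullet> k)))"
    if y: "y \<in> Hom E D' N" for D' y
  proof -
    have red: "?q \<bullet> pair E (y \<bullet> k) d = c \<bullet> pair E d (y \<bullet> k)" if "k \<in> Hom E D'' D'" "d \<in> Hom E D'' D" for D'' k d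
      using that y c D by simp
    show ?thesis
      unfolding a(2) a(3)[OF y]
      by (intro all_cong1 imp_cong refl arg_cong[of _ _ tr] red)
  qed
  have "tr ?a"
  proof (rule nno_induct_global)
    show "?a \<in> Hom E N \<Omega>" using a(1,2) by simp
    have zh: "z \<in> Hom E (One E) N" by simp
    show "tr (?a \<bullet> z)"
      unfolding a_iff[OF zh]
    proof (intro allI impI)
      fix D'' k d assume kd: "k \<in> Hom E D'' (One E)" "d \<in> Hom E D'' D"
      have "k = bang E D''" using bang_unique[of k] kd by simp
      moreover have "tr ((c \<bullet> pair E (Idt E D) (z \<bullet> bang E D)) \<bullet> d)"
        using tr_cmp[OF base, of d] kd(2) c D by simp
      ultimately show "tr (c \<bullet> pair E d (z \<bullet> k))" using kd(2) c D by simp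
    qed
  next
    fix D' y assume y: "y \<in> Hom E D' N" "tr (?a \<bullet> y)"
    have sy: "s \<bullet> y \<in> Hom E D' N" using y(1) by simp
    show "tr (?a \<bullet> s \<bullet> y)"
      unfolding a_iff[OF sy]
    proof (intro allI impI)
      fix D'' k d assume kd: "k \<in> Hom E D'' D'" "d \<in> Hom E D'' D"
      have "tr (c \<bullet> pair E d (y \<bullet> k))" using y(2)[unfolded a_iff[OF y(1)], rule_format, OF kd] .
      then have "tr (c \<bullet> pair E d (s \<bullet> y \<bullet> k))" using step[OF kd(2), of "y \<bullet> k"] kd(1) y(1) by simp
      then show "tr (c \<bullet> pair E d ((s \<bullet> y) \<bullet> k))" using kd y(1) by simp
    qed
  qed
  moreover have "?a \<bullet> Idt E N = ?a" using a(1,2) by simp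
  moreover have i: "Idt E N \<in> Hom E N N" by simp
  ultimately have "tr (c \<bullet> pair E (Fst E D N) (Idt E N \<bullet> Snd E D N))"
    using a_iff[OF i, THEN iffD1, rule_format, of "Snd E D N" "Prod E D N" "Fst E D N"] D by simp
  then show ?thesis using c D by simp
qed

text \<open>Existence is plain recursion on pairs of a counter and a function of the parameters.
  Uniqueness is induction on the equation between two solutions. The order of the factors is that of
  the clause for \<open>PRec\<close>.\<close>

lemma prim_rec_ex1:
  assumes f: "f \<in> Hom E D A" and g: "g \<in> Hom E (Prod E (Prod E D A) N) A"
  defines "p \<equiv> Fst E D N" and "q \<equiv> Snd E D N"
  shows "\<exists>!h. h \<in> Hom E (Prod E D N) A \<and> h \<bullet> pair E (Idt E D) (z \<bullet> bang E D) = f \<and>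
    h \<bullet> pair E p (s \<bullet> q) = g \<bullet> pair E (pair E p h) q"
proof -
  have D: "D \<in> Obj E" and A: "A \<in> Obj E" using f by auto
  have p: "p \<in> Arr E" "Dom E p = Prod E D N" "Cod E p = D" using D by (simp_all add: p_def)
  have q: "q \<in> Arr E" "Dom E q = Prod E D N" "Cod E q = N" using D by (simp_all add: q_def)
  show ?thesis
  proof (rule ex_ex1I)
    \<comment> \<open>States are pairs \<open>(n, u)\<close> with \<open>u\<close> a function of the
      parameter. The start is \<open>(0, f)\<close> and the step sends \<open>(n, u)\<close> to
      \<open>(S n, d \<mapsto> g(d, u(d), n))\<close>; the counter is carried because
      \<open>g\<close> depends on it.\<close>
    let ?W = "Exp E D A"
    let ?B = "Prod E N ?W"
    let ?a = "pair E z (curried E (One E) D A (f \<bullet> Snd E (One E) D))"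
    let ?G = "g \<bullet> pair E (pair E (Snd E ?B D) (Ev E D A \<bullet> pair E (Snd E N ?W \<bullet> Fst E ?B D) (Snd E ?B D)))
      (Fst E N ?W \<bullet> Fst E ?B D)"
    let ?F = "pair E (s \<bullet> Fst E N ?W) (curried E ?B D A ?G)"
    have W: "?W \<in> Obj E" "?B \<in> Obj E" using D A by simp_all
    have a: "?a \<in> Hom E (One E) ?B" using f D A by simp
    have G: "?G \<in> Arr E" "Dom E ?G = Prod E ?B D" "Cod E ?G = A" using g D A W by simp_all
    have F: "?F \<in> Hom E ?B ?B" using G D A W by simp
    obtain r where r: "r \<in> Hom E N ?B" "r \<bullet> z = ?a" "r \<bullet> s = ?F \<bullet> r"
      using nno_rec[OF a F] by blast
    let ?n = "Fst E N ?W \<bullet> r" and ?u = "Snd E N ?W \<bullet> r"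
    \<comment> \<open>The counter after \<open>n\<close> steps is \<open>n\<close>, so
      \<open>g\<close> receives the intended number.\<close>
    have n: "?n = Idt E N"
    proof (rule nno_endo)
      show "?n \<in> Hom E N N" using r(1) W by simp
      show "?n \<bullet> z = z" using r(1,2) W f D A by simp
      show "?n \<bullet> s = s \<bullet> ?n" using r(1,3) W G D A by simp
    qed
    have uz: "?u \<bullet> z = curried E (One E) D A (f \<bullet> Snd E (One E) D)" using r(1,2) W f D A by simp
    have us: "?u \<bullet> s = curried E ?B D A ?G \<bullet> r" using r(1,3) W G D A by simp
    have u: "?u \<in> Arr E" "Dom E ?u = N" "Cod E ?u = ?W" using r(1) W by simp_all
    let ?h = "Ev E D A \<bullet> pair E (?u \<bullet> q) p"
    have "?h \<in> Hom E (Prod E D N) A" using u p q D A by simp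
    moreover have "?h \<bullet> pair E (Idt E D) (z \<bullet> bang E D) = f"
    proof -
      have "?h \<bullet> pair E (Idt E D) (z \<bullet> bang E D) =
          Ev E D A \<bullet> pair E ((?u \<bullet> z) \<bullet> bang E D) (Idt E D)"
        using u D A r(1) W by (simp add: p_def q_def)
      also have "\<dots> = f" unfolding uz using f D A by simp
      finally show ?thesis .
    qed
    moreover have "?h \<bullet> pair E p (s \<bullet> q) = g \<bullet> pair E (pair E p ?h) q"
    proof -
      have "?h \<bullet> pair E p (s \<bullet> q) = Ev E D A \<bullet> pair E ((?u \<bullet> s) \<bullet> q) p"
        using u p q D A r(1) W by (simp add: p_def q_def)
      also have "\<dots> = ?G \<bullet> pair E (r \<bullet> q) p"
        unfolding us using G p q D A r(1) W by simp
      also have "\<dots> = g \<bullet> pair E (pair E p ?h) (?n \<bullet> q)"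
        using g p q D A r(1) W by simp
      also have "\<dots> = g \<bullet> pair E (pair E p ?h) q"
        unfolding n using q by simp
      finally show ?thesis .
    qed
    ultimately show "\<exists>h. h \<in> Hom E (Prod E D N) A \<and> h \<bullet> pair E (Idt E D) (z \<bullet> bang E D) = f \<and>
      h \<bullet> pair E p (s \<bullet> q) = g \<bullet> pair E (pair E p h) q" by blast
  next
    fix h h' assume
      "h \<in> Hom E (Prod E D N) A \<and> h \<bullet> pair E (Idt E D) (z \<bullet> bang E D) = f \<and>
        h \<bullet> pair E p (s \<bullet> q) = g \<bullet> pair E (pair E p h) q"
      "h' \<in> Hom E (Prod E D N) A \<and> h' \<bullet> pair E (Idt E D) (z \<bullet> bang E D) = f \<and>
        h' \<bullet> pair E p (s \<bullet> q) = g \<bullet> pair E (pair E p h') q"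
    then have h: "h \<in> Arr E" "Dom E h = Prod E D N" "Cod E h = A"
        "h \<bullet> pair E (Idt E D) (z \<bullet> bang E D) = f" "h \<bullet> pair E p (s \<bullet> q) = g \<bullet> pair E (pair E p h) q"
      and h': "h' \<in> Arr E" "Dom E h' = Prod E D N" "Cod E h' = A"
        "h' \<bullet> pair E (Idt E D) (z \<bullet> bang E D) = f" "h' \<bullet> pair E p (s \<bullet> q) = g \<bullet> pair E (pair E p h') q"
      by auto
    \<comment> \<open>The successor equation at arbitrary elements, from the generic one by
      composition with \<open>pair E k y\<close>.\<close>
    have suc: "k' \<bullet> pair E k (s \<bullet> y) = g \<bullet> pair E (pair E k (k' \<bullet> pair E k y)) y"
      if k': "k' \<in> Arr E" "Dom E k' = Prod E D N" "Cod E k' = A"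
        and eq: "k' \<bullet> pair E p (s \<bullet> q) = g \<bullet> pair E (pair E p k') q"
        and ky: "k \<in> Hom E D' D" "y \<in> Hom E D' N" for k' k y D'
    proof -
      have "k' \<bullet> pair E k (s \<bullet> y) = (k' \<bullet> pair E p (s \<bullet> q)) \<bullet> pair E k y"
        using k' ky D by (simp add: p_def q_def)
      also have "\<dots> = g \<bullet> pair E (pair E k (k' \<bullet> pair E k y)) y"
        unfolding eq using k' ky D g by (simp add: p_def q_def)
      finally show ?thesis .
    qed
    have "tr (eq_at E A \<bullet> pair E h h')"
    proof (rule nno_induct[OF D])
      show "eq_at E A \<bullet> pair E h h' \<in> Hom E (Prod E D N) \<Omega>" using h(1-3) h'(1-3) A by simp
      show "tr ((eq_at E A \<bullet> pair E h h') \<bullet> pair E (Idt E D) (z \<bullet> bang E D))"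
        using h(1-4) h'(1-4) A D f by simp
      fix D' k y assume ky: "k \<in> Hom E D' D" "y \<in> Hom E D' N" "tr ((eq_at E A \<bullet> pair E h h') \<bullet> pair E k y)"
      have red: "(eq_at E A \<bullet> pair E h h') \<bullet> pair E k x = eq_at E A \<bullet> pair E (h \<bullet> pair E k x) (h' \<bullet> pair E k x)"
        "h \<bullet> pair E k x \<in> Hom E D' A" "h' \<bullet> pair E k x \<in> Hom E D' A" if "x \<in> Hom E D' N" for x
        using that ky(1) h(1-3) h'(1-3) A D by simp_all
      have "h \<bullet> pair E k y = h' \<bullet> pair E k y"
        using ky(3) red[OF ky(2)] tr_eq_at[of "h \<bullet> pair E k y" "h' \<bullet> pair E k y" A] by auto
      then have "h \<bullet> pair E k (s \<bullet> y) = h' \<bullet> pair E k (s \<bullet> y)"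
        using suc[OF h(1-3,5) ky(1,2)] suc[OF h'(1-3,5) ky(1,2)] by simp
      then show "tr ((eq_at E A \<bullet> pair E h h') \<bullet> pair E k (s \<bullet> y))"
        using red[of "s \<bullet> y"] tr_eq_at[of "h \<bullet> pair E k (s \<bullet> y)" "h' \<bullet> pair E k (s \<bullet> y)" A] ky(2) by auto
    qed
    then show "h = h'" using h(1-3) h'(1-3) by simp
  qed
qed

text \<open>Recursion gives a predicate \<open>h\<close> that is bottom at zero and true at every
  successor. Where \<open>S y = 0\<close>, bottom is therefore true, and every proposition
  follows.\<close>

lemma succ_ne_zero:
  assumes "y \<in> Hom E D N" "s \<bullet> y = z \<bullet> bang E D" "p \<in> Hom E D \<Omega>"
  shows "tr p"
proof -
  have D: "D \<in> Obj E" using assms(1) by auto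
  obtain h where h: "h \<in> Hom E N \<Omega>" "h \<bullet> z = sub_bot E (One E)" "h \<bullet> s = true_at E \<Omega> \<bullet> h"
  proof -
    have "sub_bot E (One E) \<in> Hom E (One E) \<Omega>" "true_at E \<Omega> \<in> Hom E \<Omega> \<Omega>" by simp_all
    from nno_rec[OF this] show thesis using that by blast
  qed
  have b: "bang E D \<in> Hom E D (One E)" using D by simp
  have "sub_bot E (One E) \<bullet> bang E D = h \<bullet> z \<bullet> bang E D" using h(1) D by (simp flip: h(2))
  also have "\<dots> = (h \<bullet> s) \<bullet> y" using assms(1) h(1) by (simp flip: assms(2))
  also have "\<dots> = true_at E D" unfolding h(3) using h(1) assms(1) by simp
  finally have "tr (sub_bot E (One E) \<bullet> bang E D)" using D by (simp add: tr_def)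
  then show ?thesis using tr_sub_bot[OF one_obj b _ assms(3)] by blast
qed

section \<open>Values of arithmetical terms, and substitution\<close>

abbreviation pmor :: "prim \<Rightarrow> 'a" where "pmor \<equiv> prim_mor E N z s"
abbreviation pow :: "nat \<Rightarrow> 'o" where "pow m \<equiv> ctx E (replicate m N)"

lemma pow_obj [simp]: "pow m \<in> Obj E"
  by (rule ctx_obj) auto

lemma prim_mor_hom:
  "prim_wf f \<Longrightarrow> pmor f \<in> Hom E (pow (arity f)) N"
proof (induction f)
  case (PProj m i)
  have "set (replicate m N) \<subseteq> Obj E" by auto
  then show ?case using PProj by simp
next
  case (PComp m f gs)
  have e: "env N (pow m) (map pmor gs)"
    unfolding env_def using PComp by auto
  show ?case using PComp mor_tuple_simps[OF _ e] by simp
next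
  case (PRec f g)
  have "pmor f \<in> Hom E (pow (arity f)) N" "pmor g \<in> Hom E (Prod E (Prod E (pow (arity f)) N) N) N"
    using PRec by simp_all
  from theI'[OF prim_rec_ex1[OF this]] show ?case by (simp add: Let_def)
qed simp_all

lemma prim_mor_PRec:
  assumes "prim_wf (PRec f g)"
  defines "D \<equiv> pow (arity f)"
  shows "pmor (PRec f g) \<bullet> pair E (Idt E D) (z \<bullet> bang E D) = pmor f"
    "pmor (PRec f g) \<bullet> pair E (Fst E D N) (s \<bullet> Snd E D N) =
      pmor g \<bullet> pair E (pair E (Fst E D N) (pmor (PRec f g))) (Snd E D N)"
proof -
  have "pmor f \<in> Hom E D N" "pmor g \<in> Hom E (Prod E (Prod E D N) N) N"
    using assms(1) prim_mor_hom[of f] prim_mor_hom[of g] by (simp_all add: D_def)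
  from theI'[OF prim_rec_ex1[OF this]]
  show "pmor (PRec f g) \<bullet> pair E (Idt E D) (z \<bullet> bang E D) = pmor f"
    "pmor (PRec f g) \<bullet> pair E (Fst E D N) (s \<bullet> Snd E D N) =
      pmor g \<bullet> pair E (pair E (Fst E D N) (pmor (PRec f g))) (Snd E D N)"
    by (simp_all add: Let_def D_def)
qed

text \<open>The counterpart of \<open>fval\<close> for terms: evaluation at generalized elements of
  a stage, without a context.\<close>

fun tval :: "'o \<Rightarrow> 'a list \<Rightarrow> atm \<Rightarrow> 'a" where
  "tval D \<rho> (AVar i) = \<rho> ! i"
| "tval D \<rho> (AFun f ts) = pmor f \<bullet> mor_tuple E D (map (tval D \<rho>) ts)"

lemma tval_props:
  assumes "atm_wf (length \<rho>) t" "D \<in> Obj E" "env N D \<rho>"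
  shows "tval D \<rho> t \<in> Hom E D N \<and> (\<forall>D' f. f \<in> Hom E D' D \<longrightarrow> tval D \<rho> t \<bullet> f = tval D' (shift f \<rho>) t)"
  using assms
proof (induction t)
  case (AVar i)
  then show ?case using env_nth[of N D \<rho> i] by (simp add: shift_def)
next
  case (AFun f ts)
  have e: "env N D (map (tval D \<rho>) ts)" unfolding env_def using AFun by auto
  have sh: "shift h (map (tval D \<rho>) ts) = map (tval D' (shift h \<rho>)) ts" if "h \<in> Hom E D' D" for D' h
    unfolding shift_def using AFun that by (auto simp: shift_def)
  have f: "pmor f \<in> Hom E (pow (length ts)) N" using AFun.prems prim_mor_hom[of f] by simp
  show ?case using f mor_tuple_simps[OF AFun.prems(2) e] sh by auto
qed

lemma tval_hom:
  assumes "atm_wf (length \<rho>) t" "D \<in> Obj E" "env N D \<rho>"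
  shows "tval D \<rho> t \<in> Arr E" "Dom E (tval D \<rho> t) = D" "Cod E (tval D \<rho> t) = N"
  using tval_props[OF assms, THEN conjunct1] by simp_all

lemma tval_cmp:
  assumes "atm_wf (length \<rho>) t" "D \<in> Obj E" "env N D \<rho>" "f \<in> Hom E D' D"
  shows "tval D \<rho> t \<bullet> f = tval D' (shift f \<rho>) t"
  using tval_props[OF assms(1-3)] assms(4) by blast

lemma tval_subst:
  "atm_wf n t \<Longrightarrow> tval D \<rho> (atm_subst \<sigma> t) = tval D (map (\<lambda>i. tval D \<rho> (\<sigma> i)) [0..<n]) t"
proof (induction t)
  case (AFun f ts)
  have "(tval D \<rho> \<circ> atm_subst \<sigma>) u = tval D (map (\<lambda>i. tval D \<rho> (\<sigma> i)) [0..<n]) u" if "u \<in> set ts" for u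
    using AFun.IH[OF that] AFun.prems that by simp
  then have "map (tval D \<rho> \<circ> atm_subst \<sigma>) ts = map (tval D (map (\<lambda>i. tval D \<rho> (\<sigma> i)) [0..<n])) ts"
    by (rule map_cong[OF refl])
  then show ?case by (simp del: map_eq_conv)
qed simp

lemma sem_std_tm:
  "atm_wf n t \<Longrightarrow> sem E (replicate n N) (std_tm E N z s t) = tval (pow n) (map (proj E (replicate n N)) [0..<n]) t"
proof (induction t)
  case (AFun f ts)
  have "(sem E (replicate n N) \<circ> std_tm E N z s) u = tval (pow n) (map (proj E (replicate n N)) [0..<n]) u"
    if "u \<in> set ts" for u
    using AFun.IH[OF that] AFun.prems that by simp
  then have "map (sem E (replicate n N) \<circ> std_tm E N z s) ts = map (tval (pow n) (map (proj E (replicate n N)) [0..<n])) ts"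
    by (rule map_cong[OF refl])
  then show ?case by (simp add: sem_tuple del: map_eq_conv)
qed simp

lemma env_proj: "env N (pow n) (map (proj E (replicate n N)) [0..<n])"
proof -
  have "set (replicate n N) \<subseteq> Obj E" by auto
  then show ?thesis by (auto simp: env_def)
qed

text \<open>The term is interpreted on the power of \<open>N\<close> in the generic environment, and
  restricting that environment along the tuple of \<open>\<rho>\<close> returns
  \<open>\<rho>\<close>.\<close>

lemma sem_std_tm_cmp:
  assumes "atm_wf (length \<rho>) t" "D \<in> Obj E" "env N D \<rho>"
  shows "sem E (replicate (length \<rho>) N) (std_tm E N z s t) \<bullet> mor_tuple E D \<rho> = tval D \<rho> t"
proof -
  let ?n = "length \<rho>"
  have "shift (mor_tuple E D \<rho>) (map (proj E (replicate ?n N)) [0..<?n]) = \<rho>"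
    unfolding shift_def using proj_mor_tuple[OF assms(2) _ assms(3)] by (intro nth_equalityI) simp_all
  then show ?thesis
    unfolding sem_std_tm[OF assms(1)]
    using tval_cmp[OF _ pow_obj env_proj, of ?n t "mor_tuple E D \<rho>" D] assms(1) mor_tuple_simps[OF assms(2,3)]
    by simp
qed

lemma sem_std_tm_hom:
  assumes "atm_wf n t"
  shows "sem E (replicate n N) (std_tm E N z s t) \<in> Hom E (pow n) N"
  unfolding sem_std_tm[OF assms] using tval_hom[OF _ pow_obj env_proj, of n t] assms by simp

abbreviation ST :: "nat \<Rightarrow> afm \<Rightarrow> 'a lfm" where "ST \<equiv> std E N z s"

lemma lwf_std: "afm_wf n \<phi> \<Longrightarrow> lwf N n (ST n \<phi>)"
proof (induction \<phi> arbitrary: n)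
  case (AEq t u)
  then show ?case using sem_std_tm_hom[of n t] sem_std_tm_hom[of n u] by simp
qed simp_all

lemma fval_AEq:
  assumes "atm_wf n t" "atm_wf n u" "stage N D P j \<rho>" "length \<rho> = n"
  shows "fval N D P j \<rho> (ST n (AEq t u)) = memb (eq_at E N \<bullet> pair E (tval D \<rho> t) (tval D \<rho> u)) j"
proof -
  note st = stageD[OF assms(3)]
  have "map (nth \<rho>) [0..<n] = \<rho>" using assms(4) map_nth by blast
  moreover have "(eq_at E N \<bullet> pair E (sem E (replicate n N) (std_tm E N z s t)) (sem E (replicate n N) (std_tm E N z s u)))
      \<bullet> mor_tuple E D \<rho> = eq_at E N \<bullet> pair E (tval D \<rho> t) (tval D \<rho> u)"
    using sem_std_tm_hom[OF assms(1)] sem_std_tm_hom[OF assms(2)] mor_tuple_simps[OF st(2,9)]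
      sem_std_tm_cmp[OF _ st(2,9)] assms(1,2,4) by simp
  ultimately show ?thesis using sem_std_tm_hom[OF assms(1)] by simp
qed

lemma wf_rename: "atm_wf n t \<Longrightarrow> \<forall>i<n. atm_wf m (\<sigma> i) \<Longrightarrow> atm_wf m (atm_subst \<sigma> t)"
  by (induction t) auto

lemma under_wf: "\<forall>i<n. atm_wf m (\<sigma> i) \<Longrightarrow> \<forall>i<Suc n. atm_wf (Suc m) (under \<sigma> i)"
  by (auto simp: under_def intro!: wf_rename[of m] split: nat.split)

lemma afm_wf_subst: "afm_wf n \<phi> \<Longrightarrow> \<forall>i<n. atm_wf m (\<sigma> i) \<Longrightarrow> afm_wf m (afm_subst \<sigma> \<phi>)"
proof (induction \<phi> arbitrary: n m \<sigma>)
  case (AEx \<phi>)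
  then show ?case using under_wf[of n m \<sigma>] by simp
next
  case (AAll \<phi>)
  then show ?case using under_wf[of n m \<sigma>] by simp
qed (auto intro: wf_rename)

lemma tvals_shift:
  assumes "\<forall>i<n. atm_wf (length \<rho>) (\<sigma> i)" "D \<in> Obj E" "env N D \<rho>" "f \<in> Hom E D' D"
  shows "shift f (map (\<lambda>i. tval D \<rho> (\<sigma> i)) [0..<n]) = map (\<lambda>i. tval D' (shift f \<rho>) (\<sigma> i)) [0..<n]"
  using tval_cmp[OF _ assms(2-4)] assms(1) by (auto simp: shift_def)

text \<open>Renaming the terms past the new variable is undone by evaluating them with
  \<open>x\<close> put in front of the environment.\<close>

lemma tvals_under:
  assumes "\<forall>i<n. atm_wf (length \<rho>) (\<sigma> i)"
  shows "map (\<lambda>i. tval D (x # \<rho>) (under \<sigma> i)) [0..<Suc n] = x # map (\<lambda>i. tval D \<rho> (\<sigma> i)) [0..<n]"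
proof -
  have "tval D (x # \<rho>) (atm_subst (\<lambda>k. AVar (Suc k)) (\<sigma> i)) = tval D \<rho> (\<sigma> i)" if "i < n" for i
    using tval_subst[of "length \<rho>" "\<sigma> i" D "x # \<rho>" "\<lambda>k. AVar (Suc k)"] assms that by (simp add: map_nth)
  then show ?thesis unfolding map_upt_Suc by (simp add: under_def)
qed

lemma env_tvals:
  assumes "\<forall>i<n. atm_wf (length \<rho>) (\<sigma> i)" "D \<in> Obj E" "env N D \<rho>"
  shows "env N D (map (\<lambda>i. tval D \<rho> (\<sigma> i)) [0..<n])"
  using tval_hom[OF _ assms(2,3)] assms(1) by (auto simp: env_def)

text \<open>Substituting terms amounts to evaluating in the environment of their values. The numbers
  of variables \<open>m\<close> and \<open>n\<close> differ on the two sides, and so do the atoms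
  built by \<open>std\<close>. Under a binder the list of values is restricted to the larger stage
  and, for a variable, extended by the generic element.\<close>

lemma fval_subst:
  assumes "afm_wf n \<phi>" "\<forall>i<n. atm_wf m (\<sigma> i)" "stage N D P j \<rho>" "length \<rho> = m"
  shows "fval N D P j \<rho> (ST m (afm_subst \<sigma> \<phi>)) = fval N D P j (map (\<lambda>i. tval D \<rho> (\<sigma> i)) [0..<n]) (ST n \<phi>)"
  using assms
proof (induction \<phi> arbitrary: n m \<sigma> D P j \<rho>)
  case (AEq t u)
  note st = stageD[OF AEq.prems(3)]
  have wf: "atm_wf m (atm_subst \<sigma> t)" "atm_wf m (atm_subst \<sigma> u)" "atm_wf n t" "atm_wf n u"
    using AEq.prems wf_rename by auto
  have st': "stage N D P j (map (\<lambda>i. tval D \<rho> (\<sigma> i)) [0..<n])"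
    using st env_tvals[OF _ st(2,9)] AEq.prems by (simp add: stage_def)
  show ?case
    unfolding afm_subst.simps fval_AEq[OF wf(1,2) AEq.prems(3,4)]
    using fval_AEq[OF wf(3,4) st'] tval_subst[OF wf(3)] tval_subst[OF wf(4)] by simp
next
  case ABot
  then show ?case by simp
next
  case (AAnd \<phi> \<psi>)
  show ?case using AAnd.prems AAnd.IH[OF _ AAnd.prems(2-4)] by simp
next
  case (AOr \<phi> \<psi>)
  show ?case using AOr.prems AOr.IH[OF _ AOr.prems(2-4)] by simp
next
  case (AImp \<phi> \<psi>)
  note st = stageD[OF AImp.prems(3)]
  let ?X = "pw E \<Omega>"
  let ?D = "Prod E D ?X" and ?F = "Fst E D ?X" and ?K = "Snd E D ?X"
  have F: "?F \<in> Hom E ?D D" using st by simp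
  have st': "stage N ?D (P \<bullet> ?F) ?K (shift ?F \<rho>)" using st by (simp add: stage_def)
  show ?case
    using AImp.prems AImp.IH[OF _ AImp.prems(2) st'] tvals_shift[OF _ st(2,9) F, of n \<sigma>] by (simp add: Let_def)
next
  case (AEx \<phi>)
  note st = stageD[OF AEx.prems(3)]
  let ?D = "Prod E D N" and ?F = "Fst E D N" and ?K = "Snd E D N"
  have F: "?F \<in> Hom E ?D D" using st by simp
  have st': "stage N ?D (P \<bullet> ?F) (j \<bullet> ?F) (?K # shift ?F \<rho>)" using st by (simp add: stage_def)
  have w: "\<forall>i<n. atm_wf (length (shift ?F \<rho>)) (\<sigma> i)" using AEx.prems by simp
  show ?case
    using AEx.prems AEx.IH[OF _ under_wf[OF AEx.prems(2)] st'] tvals_shift[OF _ st(2,9) F, of n \<sigma>]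
      tvals_under[OF w, of ?D ?K] by (simp add: Let_def del: upt_Suc)
next
  case (AAll \<phi>)
  note st = stageD[OF AAll.prems(3)]
  let ?X = "pw E \<Omega>"
  let ?D = "Prod E D ?X" and ?F = "Fst E D ?X" and ?K = "Snd E D ?X"
  let ?D2 = "Prod E ?D N" and ?F2 = "Fst E ?D N" and ?K2 = "Snd E ?D N"
  have F: "?F \<bullet> ?F2 \<in> Hom E ?D2 D" using st by simp
  have st': "stage N ?D2 (P \<bullet> ?F \<bullet> ?F2) (?K \<bullet> ?F2) (?K2 # shift (?F \<bullet> ?F2) \<rho>)"
    using st by (simp add: stage_def)
  have w: "\<forall>i<n. atm_wf (length (shift (?F \<bullet> ?F2) \<rho>)) (\<sigma> i)" using AAll.prems by simp
  show ?case
    using AAll.prems AAll.IH[OF _ under_wf[OF AAll.prems(2)] st'] tvals_shift[OF _ st(2,9) F, of n \<sigma>]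
      tvals_under[OF w, of ?D2 ?K2] by (simp add: Let_def del: upt_Suc)
qed

subsection \<open>Validity of the axioms\<close>

text \<open>The internal quantifiers over \<open>P\<close> and \<open>j\<close> become quantifiers
  over generalized elements at arbitrary stages. Quantifying over all stages makes the notion closed
  under universal generalization.\<close>

definition valid :: "nat \<Rightarrow> afm \<Rightarrow> bool" where
  "valid n \<phi> \<longleftrightarrow> (\<forall>D P j \<rho>. stage N D P j \<rho> \<longrightarrow> length \<rho> = n \<longrightarrow> lops D P \<longrightarrow> lop D j \<longrightarrow>
     tr (fval N D P j \<rho> (ST n \<phi>)))"

lemma mor_tuple_Nil: "mor_tuple E D [] = bang E D"
  by (simp add: mor_tuple_def)

lemma tval_AZero: "D \<in> Obj E \<Longrightarrow> tval D \<rho> AZero = z \<bullet> bang E D"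
  by (simp add: mor_tuple_Nil)

lemma tval_ASuc:
  assumes "tval D \<rho> t \<in> Hom E D N"
  shows "tval D \<rho> (ASuc t) = s \<bullet> tval D \<rho> t"
proof -
  have "D \<in> Obj E" using assms dom_obj[of "tval D \<rho> t"] by auto
  then show ?thesis using assms by (simp add: mor_tuple_Nil mor_tuple_Cons)
qed

lemma tval_vars: "k + m \<le> length \<rho> \<Longrightarrow> map (tval D \<rho>) (vars k m) = take m (drop k \<rho>)"
  by (rule nth_equalityI) (auto simp: vars_def)

lemma env_take_drop: "env X D \<rho> \<Longrightarrow> env X D (take m (drop k \<rho>))"
  unfolding env_def by (meson in_set_dropD in_set_takeD)

lemma vars_wf: "k + m \<le> n \<Longrightarrow> t \<in> set (vars k m) \<Longrightarrow> atm_wf n t"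
  by (auto simp: vars_def)

lemma length_vars [simp]: "length (vars k m) = m"
  by (simp add: vars_def)

lemma HA_axiom_wf: "HA_axiom n \<phi> \<Longrightarrow> afm_wf n \<phi>"
proof (induction rule: HA_axiom.induct)
  case (induction n \<phi>)
  have "afm_wf n (subst_zero \<phi>)"
    unfolding subst_zero_def using induction by (rule afm_wf_subst) (auto split: nat.split)
  moreover have "afm_wf (Suc n) (subst_suc \<phi>)"
    unfolding subst_suc_def using induction by (rule afm_wf_subst) (auto split: nat.split)
  ultimately show ?case using induction by simp
qed (auto simp: vars_def)

lemma valid_AEq:
  assumes "atm_wf n t" "atm_wf n u"
    and eq: "\<And>D \<rho>. D \<in> Obj E \<Longrightarrow> env N D \<rho> \<Longrightarrow> length \<rho> = n \<Longrightarrow> tval D \<rho> t = tval D \<rho> u"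
  shows "valid n (AEq t u)"
  unfolding valid_def
proof (intro allI impI)
  fix D P j \<rho> assume st: "stage N D P j \<rho>" and len: "length \<rho> = n" and "lops D P" and lop: "lop D j"
  note st' = stageD[OF st]
  have h: "tval D \<rho> t \<in> Arr E" "Dom E (tval D \<rho> t) = D" "Cod E (tval D \<rho> t) = N"
    using tval_hom[OF _ st'(2,9)] assms(1) len by simp_all
  have e: "eq_at E N \<bullet> pair E (tval D \<rho> t) (tval D \<rho> t) \<in> Hom E D \<Omega>" using h by simp
  have "tr (memb (eq_at E N \<bullet> pair E (tval D \<rho> t) (tval D \<rho> t)) j)"
    by (rule lop_unit[OF lop _ e]) (use st' h in simp_all)
  then show "tr (fval N D P j \<rho> (ST n (AEq t u)))"
    unfolding fval_AEq[OF assms(1,2) st len] eq[OF st'(2,9) len, symmetric] .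
qed

text \<open>The clause for \<open>LAll\<close> moves to a later stage and to an operator in
  \<open>P\<close>, which is again a local operator there, so validity of the body applies.\<close>

lemma valid_gen:
  assumes "afm_wf (Suc n) \<phi>" "valid (Suc n) \<phi>"
  shows "valid n (AAll \<phi>)"
  unfolding valid_def
proof (intro allI impI)
  fix D P j \<rho> assume st: "stage N D P j \<rho>" and len: "length \<rho> = n" and lops: "lops D P" and lop: "lop D j"
  note st' = stageD[OF st]
  have wf: "lwf N (Suc (length \<rho>)) (ST (Suc n) \<phi>)" using lwf_std[OF assms(1)] len by simp
  have P: "P \<in> Hom E D (pw E (pw E \<Omega>))" using st' by simp
  show "tr (fval N D P j \<rho> (ST n (AAll \<phi>)))"
    unfolding std.simps tr_fval_LAll[OF wf st]
  proof (intro allI impI)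
    fix D' f k x assume f: "f \<in> Hom E D' D" "k \<in> Hom E D' (pw E \<Omega>)" "x \<in> Hom E D' N" "tr (memb k (P \<bullet> f))"
    have "stage N D' (P \<bullet> f) k (x # shift f \<rho>)" using stage_cmp[OF st f(1,2)] f(3) by (simp add: stage_def)
    then show "tr (fval N D' (P \<bullet> f) k (x # shift f \<rho>) (ST (Suc n) \<phi>))"
      using assms(2)[unfolded valid_def, rule_format] len lops_cmp[OF lops P f(1)] lopsD[OF lops P f(1,2,4)] by simp
  qed
qed

lemma valid_succ_nonzero: "valid n (AAll (ANeg (AEq (ASuc (AVar 0)) AZero)))"
proof -
  let ?e = "AEq (ASuc (AVar 0)) AZero"
  have "valid (Suc n) (ANeg ?e)"
    unfolding valid_def
  proof (intro allI impI)
    fix D P j \<rho> assume st: "stage N D P j \<rho>" and len: "length \<rho> = Suc n" and lops: "lops D P" and lop: "lop D j"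
    note st' = stageD[OF st]
    have P: "P \<in> Hom E D (pw E (pw E \<Omega>))" using st' by simp
    have awf: "atm_wf (Suc n) (ASuc (AVar 0))" "atm_wf (Suc n) AZero" by simp_all
    have wf: "lwf N (length \<rho>) (ST (Suc n) ?e)" "lwf N (length \<rho>) (ST (Suc n) ABot)"
      using lwf_std[of "Suc n" ?e] lwf_std[of "Suc n" ABot] len by (simp_all del: std.simps)
    show "tr (fval N D P j \<rho> (ST (Suc n) (ANeg ?e)))"
      unfolding std.simps(5) tr_fval_LImp[OF wf st]
    proof (intro allI impI)
      fix D' f k assume f: "f \<in> Hom E D' D" "k \<in> Hom E D' (pw E \<Omega>)" "tr (memb k (P \<bullet> f))"
        and pr: "tr (fval N D' (P \<bullet> f) k (shift f \<rho>) (ST (Suc n) ?e))"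
      have D': "D' \<in> Obj E" using f(1) by auto
      have s2: "stage N D' (P \<bullet> f) k (shift f \<rho>)" using stage_cmp[OF st f(1,2)] .
      have lk: "lop D' k" using lopsD[OF lops P f(1-3)] .
      have len': "length (shift f \<rho>) = Suc n" using len by simp
      define y where "y = shift f \<rho> ! 0"
      have y: "y \<in> Hom E D' N" using env_nth[OF stageD(9)[OF s2], of 0] len' unfolding y_def by (simp del: length_shift)
      have tv: "tval D' (shift f \<rho>) (ASuc (AVar 0)) = s \<bullet> y" "tval D' (shift f \<rho>) AZero = z \<bullet> bang E D'"
        using tval_ASuc[of D' "shift f \<rho>" "AVar 0"] tval_AZero[OF D'] y by (simp_all add: y_def)
      let ?p = "eq_at E N \<bullet> pair E (s \<bullet> y) (z \<bullet> bang E D')"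
      let ?b = "sub_bot E (One E) \<bullet> bang E D'"
      have p: "?p \<in> Hom E D' \<Omega>" "?b \<in> Hom E D' \<Omega>" using y D' by simp_all
      have "tr (?b \<bullet> g)" if g: "g \<in> Hom E D'' D'" "tr (?p \<bullet> g)" for D'' g
      proof (rule succ_ne_zero)
        have D'': "D'' \<in> Obj E" using g(1) by auto
        have "?p \<bullet> g = eq_at E N \<bullet> pair E (s \<bullet> y \<bullet> g) (z \<bullet> bang E D'')" using g(1) y D' by simp
        then show "s \<bullet> y \<bullet> g = z \<bullet> bang E D''"
          using g y D'' tr_eq_at[of "s \<bullet> y \<bullet> g" "z \<bullet> bang E D''" N] by simp
        show "y \<bullet> g \<in> Hom E D'' N" "?b \<bullet> g \<in> Hom E D'' \<Omega>" using g(1) y D' D'' by simp_all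
      qed
      then have le: "sub_le E D' ?p ?b" using p by (simp add: sub_le_iff)
      have "tr (memb ?p k)"
        using pr unfolding fval_AEq[OF awf s2 len'] tv .
      then have "tr (memb ?b k)" using lop_mono[OF lk f(2) p le] by blast
      then show "tr (fval N D' (P \<bullet> f) k (shift f \<rho>) (ST (Suc n) ABot))"
        by (simp add: mor_tuple_Nil)
    qed
  qed
  then show ?thesis by (intro valid_gen) simp_all
qed

lemma valid_induction:
  assumes wf: "afm_wf (Suc n) \<phi>"
  shows "valid n (AImp (AAnd (subst_zero \<phi>) (AAll (AImp \<phi> (subst_suc \<phi>)))) (AAll \<phi>))"
  unfolding valid_def
proof (intro allI impI)
  let ?\<sigma>0 = "\<lambda>i. case i of 0 \<Rightarrow> AZero | Suc i' \<Rightarrow> AVar i'"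
  let ?\<sigma>s = "\<lambda>i. case i of 0 \<Rightarrow> ASuc (AVar 0) | Suc i' \<Rightarrow> AVar (Suc i')"
  have \<sigma>0: "\<forall>i<Suc n. atm_wf n (?\<sigma>0 i)" and \<sigma>s: "\<forall>i<Suc n. atm_wf (Suc n) (?\<sigma>s i)"
    by (auto split: nat.split)
  have wf0: "afm_wf n (subst_zero \<phi>)" and wfs: "afm_wf (Suc n) (subst_suc \<phi>)"
    unfolding subst_zero_def subst_suc_def using afm_wf_subst[OF wf \<sigma>0] afm_wf_subst[OF wf \<sigma>s] .
  let ?Z = "ST n (subst_zero \<phi>)" and ?F = "ST (Suc n) \<phi>" and ?S = "ST (Suc n) (subst_suc \<phi>)"
  note l = lwf_std[OF wf] lwf_std[OF wf0] lwf_std[OF wfs]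
  \<comment> \<open>The substituted formulas of the axiom are replaced by the formula itself at the
    elements \<open>0\<close> and \<open>S y\<close>.\<close>
  have zero: "fval N D P j \<rho> ?Z = fval N D P j ((z \<bullet> bang E D) # \<rho>) ?F"
    if st: "stage N D P j \<rho>" "length \<rho> = n" for D P j \<rho>
  proof -
    have "map (\<lambda>i. tval D \<rho> (?\<sigma>0 i)) [0..<Suc n] = (z \<bullet> bang E D) # \<rho>"
      unfolding map_upt_Suc using stageD(2)[OF st(1)] st(2) map_nth[of \<rho>] by (simp add: mor_tuple_Nil)
    then show ?thesis unfolding subst_zero_def fval_subst[OF wf \<sigma>0 st] by simp
  qed
  have suc: "fval N D P j (y # \<rho>) ?S = fval N D P j ((s \<bullet> y) # \<rho>) ?F"
    if st: "stage N D P j (y # \<rho>)" "length \<rho> = n" for D P j y \<rho>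
  proof -
    have "tval D (y # \<rho>) (ASuc (AVar 0)) = s \<bullet> y"
      using tval_ASuc[of D "y # \<rho>" "AVar 0"] stageD(9)[OF st(1)] by simp
    then have "map (\<lambda>i. tval D (y # \<rho>) (?\<sigma>s i)) [0..<Suc n] = (s \<bullet> y) # \<rho>"
      unfolding map_upt_Suc using st(2) map_nth[of \<rho>] by simp
    moreover have "length (y # \<rho>) = Suc n" using st(2) by simp
    ultimately show ?thesis unfolding subst_suc_def using fval_subst[OF wf \<sigma>s st(1)] by simp
  qed
  fix D P j \<rho> assume st: "stage N D P j \<rho>" and len: "length \<rho> = n" and lops: "lops D P" and "lop D j"
  have P: "P \<in> Hom E D (pw E (pw E \<Omega>))" using stageD[OF st] by simp
  have lw: "lwf N (length \<rho>) (LAnd ?Z (LAll (LImp ?F ?S)))" "lwf N (length \<rho>) (LAll ?F)"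
    using l len by simp_all
  show "tr (fval N D P j \<rho> (ST n (AImp (AAnd (subst_zero \<phi>) (AAll (AImp \<phi> (subst_suc \<phi>)))) (AAll \<phi>))))"
    unfolding std.simps(3,5,7) tr_fval_LImp[OF lw st]
  proof (intro allI impI)
    fix D1 f1 k assume f1: "f1 \<in> Hom E D1 D" "k \<in> Hom E D1 (pw E \<Omega>)" "tr (memb k (P \<bullet> f1))"
      and pr: "tr (fval N D1 (P \<bullet> f1) k (shift f1 \<rho>) (LAnd ?Z (LAll (LImp ?F ?S))))"
    let ?P1 = "P \<bullet> f1" and ?r1 = "shift f1 \<rho>"
    have st1: "stage N D1 ?P1 k ?r1" using stage_cmp[OF st f1(1,2)] .
    have len1: "length ?r1 = n" using len by simp
    have lops1: "lops D1 ?P1" using lops_cmp[OF lops P f1(1)] .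
    have P1: "?P1 \<in> Hom E D1 (pw E (pw E \<Omega>))" using P f1(1) by simp
    have w1: "lwf N (length ?r1) ?Z" "lwf N (length ?r1) (LAll (LImp ?F ?S))" "lwf N (Suc (length ?r1)) (LImp ?F ?S)"
      "lwf N (Suc (length ?r1)) ?F" using l len by simp_all
    have pr0: "tr (fval N D1 ?P1 k ?r1 ?Z)" and prs: "tr (fval N D1 ?P1 k ?r1 (LAll (LImp ?F ?S)))"
      using pr fval_hom[OF w1(1) st1] fval_hom[OF w1(2) st1] by (simp_all del: fval.simps(6) add: fval.simps(2))
    show "tr (fval N D1 ?P1 k ?r1 (LAll ?F))"
      unfolding tr_fval_LAll[OF w1(4) st1]
    proof (intro allI impI)
      fix D2 f2 l x assume f2: "f2 \<in> Hom E D2 D1" "l \<in> Hom E D2 (pw E \<Omega>)" "x \<in> Hom E D2 N"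
        "tr (memb l (?P1 \<bullet> f2))" "tr (le_val D2 (k \<bullet> f2) l)"
      let ?P2 = "?P1 \<bullet> f2" and ?r2 = "shift f2 ?r1"
      have D2: "D2 \<in> Obj E" using f2(1) by auto
      have kf: "k \<bullet> f2 \<in> Hom E D2 (pw E \<Omega>)" using f1(2) f2(1) by simp
      have st2: "stage N D2 ?P2 l ?r2" "stage N D2 ?P2 (k \<bullet> f2) ?r2"
        using stage_cmp[OF st1 f2(1) f2(2)] stage_cmp[OF st1 f2(1) kf] .
      note s2 = stageD[OF st2(1)]
      have len2: "length ?r2 = n" using len by simp
      have lops2: "lops D2 ?P2" using lops_cmp[OF lops1 P1 f2(1)] .
      let ?G = "Prod E D2 N" and ?p = "Fst E D2 N" and ?q = "Snd E D2 N"
      let ?e = "?q # shift ?p ?r2"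
      \<comment> \<open>The induction predicate: \<open>l\<close> forces the formula at the generic
        number over \<open>D2\<close>. The stage \<open>D2\<close> and the operator \<open>l\<close>
        are fixed from here on.\<close>
      let ?c = "fval N ?G (?P2 \<bullet> ?p) (l \<bullet> ?p) ?e ?F"
      have stc: "stage N ?G (?P2 \<bullet> ?p) (l \<bullet> ?p) ?e" using s2 by (simp add: stage_def)
      have wc: "lwf N (length ?e) ?F" using w1(4) by simp
      have c: "?c \<in> Hom E ?G \<Omega>" using fval_hom[OF wc stc] by simp
      have red: "?c \<bullet> pair E g y = fval N D' (?P2 \<bullet> g) (l \<bullet> g) (y # shift g ?r2) ?F"
        if g: "g \<in> Hom E D' D2" "y \<in> Hom E D' N" for D' g y
      proof -
        have h: "pair E g y \<in> Hom E D' ?G" using g by simp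
        have a: "(?P2 \<bullet> ?p) \<bullet> pair E g y = ?P2 \<bullet> g" "(l \<bullet> ?p) \<bullet> pair E g y = l \<bullet> g"
          "?q \<bullet> pair E g y = y" "shift (pair E g y) (shift ?p ?r2) = shift g ?r2"
          using g s2 by (simp_all del: cmp_assoc add: cmp_assoc[of _ ?p] shift_shift[of N ?p ?r2])
        show ?thesis unfolding fval_cmp[OF wc stc h] shift_Cons a ..
      qed
      have "tr ?c"
      proof (rule nno_induct[OF D2 c])
        have i: "Idt E D2 \<in> Hom E D2 D2" "z \<bullet> bang E D2 \<in> Hom E D2 N" using D2 by simp_all
        \<comment> \<open>The premise for zero is forced by \<open>k\<close>; it is restricted to
          \<open>D2\<close> and moved up to \<open>l\<close> by \<open>fval_mono\<close>.\<close>
        have "tr (fval N D1 ?P1 k ?r1 ?Z \<bullet> f2)"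
          using fval_hom[OF w1(1) st1] f2(1) by (intro tr_cmp[OF pr0]) simp_all
        then have "tr (fval N D2 ?P2 (k \<bullet> f2) ?r2 ?Z)" unfolding fval_cmp[OF w1(1) st1 f2(1)] .
        then have "tr (fval N D2 ?P2 l ?r2 ?Z)"
          by (rule fval_mono[OF lwf_std[OF wf0] len2[symmetric] st2(2) f2(2) lops2 f2(4,5)])
        then have "tr (fval N D2 ?P2 l ((z \<bullet> bang E D2) # ?r2) ?F)" unfolding zero[OF st2(1) len2] .
        then show "tr (?c \<bullet> pair E (Idt E D2) (z \<bullet> bang E D2))"
          unfolding red[OF i] cmp_Idt[OF s2(3,4)] cmp_Idt[OF s2(6,7)] shift_Idt[OF s2(9)] .
      next
        fix D' g y assume g: "g \<in> Hom E D' D2" "y \<in> Hom E D' N" and t: "tr (?c \<bullet> pair E g y)"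
        let ?P' = "?P2 \<bullet> g" and ?l' = "l \<bullet> g" and ?r' = "shift g ?r2"
        have D': "D' \<in> Obj E" using g(1) by auto
        have lg: "?l' \<in> Hom E D' (pw E \<Omega>)" using f2(2) g(1) by simp
        have st': "stage N D' ?P' ?l' (y # ?r')" using stage_cmp[OF st2(1) g(1) lg] g(2) by (simp add: stage_def)
        note s' = stageD[OF st']
        have len': "length ?r' = n" using len by simp
        have w': "lwf N (length (y # ?r')) ?F" "lwf N (length (y # ?r')) ?S" using l len by simp_all
        have fg: "f2 \<bullet> g \<in> Hom E D' D1" using f2(1) g(1) by simp
        have e: "?P1 \<bullet> f2 \<bullet> g = ?P'" "k \<bullet> f2 \<bullet> g = (k \<bullet> f2) \<bullet> g" "shift (f2 \<bullet> g) ?r1 = ?r'"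
          using f1(2) f2(1) g(1) P1 stageD(9)[OF st1]
          by (simp_all del: cmp_assoc add: cmp_assoc[symmetric] shift_shift[of N f2 ?r1])
        have m: "tr (memb ?l' ?P')" using tr_memb_cmp[OF f2(4,2) _ g(1)] s2 by simp
        have le: "tr (le_val D' ((k \<bullet> f2) \<bullet> g) ?l')" using tr_le_val_cmp[OF f2(5) kf f2(2) g(1)] .
        \<comment> \<open>The step premise ranges over the operators above \<open>k\<close>, so it
          can be taken at the restriction of \<open>l\<close>. The resulting implication is then
          used at this same operator, by reflexivity of the order.\<close>
        have imp: "tr (fval N D' ?P' ?l' (y # ?r') (LImp ?F ?S))"
          using prs[unfolded tr_fval_LAll[OF w1(3) st1], rule_format, OF fg lg g(2), unfolded e, OF m le] .
        have i: "Idt E D' \<in> Hom E D' D'" using D' by simp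
        have "tr (fval N D' ?P' ?l' (y # ?r') ?S)"
          using imp[unfolded tr_fval_LImp[OF w' st'], rule_format, OF i lg]
            m t[unfolded red[OF g]] tr_le_val_refl[OF lg]
          unfolding cmp_Idt[OF s'(3,4)] cmp_Idt[OF s'(6,7)] shift_Idt[OF s'(9)] by blast
        then have "tr (fval N D' ?P' ?l' ((s \<bullet> y) # ?r') ?F)" unfolding suc[OF st' len'] .
        moreover have "s \<bullet> y \<in> Hom E D' N" using g(2) by simp
        ultimately show "tr (?c \<bullet> pair E g (s \<bullet> y))" using red[OF g(1)] by simp
      qed
      \<comment> \<open>From the generic number back to the given \<open>x\<close>.\<close>
      then have "tr (?c \<bullet> pair E (Idt E D2) x)" using c f2(3) D2 by (intro tr_cmp) simp_all
      moreover have i: "Idt E D2 \<in> Hom E D2 D2" using D2 by simp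
      ultimately show "tr (fval N D2 ?P2 l (x # ?r2) ?F)"
        unfolding red[OF i f2(3)] cmp_Idt[OF s2(3,4)] cmp_Idt[OF s2(6,7)] shift_Idt[OF s2(9)] by blast
    qed
  qed
qed

lemma tval_vars_tuple:
  assumes "D \<in> Obj E" "env N D \<rho>" "k + m \<le> length \<rho>"
  defines "x \<equiv> mor_tuple E D (take m (drop k \<rho>))"
  shows "x \<in> Arr E" "Dom E x = D" "Cod E x = pow m" "mor_tuple E D (map (tval D \<rho>) (vars k m)) = x"
proof -
  have "env N D (take m (drop k \<rho>))" using assms(2) by (rule env_take_drop)
  note mor_tuple_simps[OF assms(1) this]
  then show "x \<in> Arr E" "Dom E x = D" "Cod E x = pow m" using assms(3) by (simp_all add: x_def)
  show "mor_tuple E D (map (tval D \<rho>) (vars k m)) = x"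
    unfolding x_def tval_vars[OF assms(3)] ..
qed

text \<open>Each defining equation of a primitive recursive function is an identity of morphisms on
  a power of \<open>N\<close>, composed with the tuple of the arguments.\<close>

lemma HA_axiom_valid: "HA_axiom n \<phi> \<Longrightarrow> valid n \<phi>"
proof (induction rule: HA_axiom.induct)
  case (succ_nonzero n)
  then show ?case by (rule valid_succ_nonzero)
next
  case (proj_eq m i n)
  show ?case
  proof (rule valid_AEq)
    fix D \<rho> assume \<rho>: "D \<in> Obj E" "env N D \<rho>" "length \<rho> = n"
    have "env N D (take m (drop 0 \<rho>))" using \<rho>(2) by (rule env_take_drop)
    moreover have "length (take m (drop 0 \<rho>)) = m" using proj_eq \<rho>(3) by simp
    moreover have "map (tval D \<rho>) (vars 0 m) = take m (drop 0 \<rho>)" using proj_eq \<rho>(3) by (intro tval_vars) simp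
    ultimately show "tval D \<rho> (AFun (PProj m i) (vars 0 m)) = tval D \<rho> (AVar i)"
      using proj_mor_tuple[of D N "take m (drop 0 \<rho>)" i] \<rho>(1) proj_eq by simp
  qed (use proj_eq vars_wf[of 0 m n] in auto)
next
  case (comp_eq m f gs n)
  have wf: "afm_wf n (AEq (AFun (PComp m f gs) (vars 0 m)) (AFun f (map (\<lambda>g. AFun g (vars 0 m)) gs)))"
    by (rule HA_axiom_wf, rule HA_axiom.comp_eq[OF comp_eq])
  show ?case
  proof (rule valid_AEq)
    fix D \<rho> assume \<rho>: "D \<in> Obj E" "env N D \<rho>" "length \<rho> = n"
    let ?x = "mor_tuple E D (take m (drop 0 \<rho>))"
    have "0 + m \<le> length \<rho>" using comp_eq \<rho>(3) by simp
    note x = tval_vars_tuple[OF \<rho>(1,2) this]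
    have e: "env N (pow m) (map pmor gs)" unfolding env_def using comp_eq prim_mor_hom by auto
    have f: "pmor f \<in> Hom E (pow (length gs)) N" using comp_eq prim_mor_hom[of f] by simp
    have sh: "shift ?x (map pmor gs) = map (tval D \<rho>) (map (\<lambda>g. AFun g (vars 0 m)) gs)"
      using x(4) by (simp add: shift_def)
    have "tval D \<rho> (AFun (PComp m f gs) (vars 0 m)) = (pmor f \<bullet> mor_tuple E (pow m) (map pmor gs)) \<bullet> ?x"
      using x(4) by simp
    also have "\<dots> = pmor f \<bullet> mor_tuple E (pow m) (map pmor gs) \<bullet> ?x"
      using f mor_tuple_simps(1-3)[OF pow_obj e] x(1-3) by simp
    also have "\<dots> = pmor f \<bullet> mor_tuple E D (shift ?x (map pmor gs))"
      unfolding mor_tuple_simps(4)[OF pow_obj e x(1,3)] x(2) ..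
    finally show "tval D \<rho> (AFun (PComp m f gs) (vars 0 m)) = tval D \<rho> (AFun f (map (\<lambda>g. AFun g (vars 0 m)) gs))"
      unfolding sh by simp
  qed (use wf in \<open>simp_all only: afm_wf.simps\<close>)
next
  case (rec_zero f g n)
  let ?m = "arity f"
  have wf: "afm_wf n (AEq (AFun (PRec f g) (AZero # vars 0 ?m)) (AFun f (vars 0 ?m)))"
    by (rule HA_axiom_wf, rule HA_axiom.rec_zero[OF rec_zero])
  show ?case
  proof (rule valid_AEq)
    fix D \<rho> assume \<rho>: "D \<in> Obj E" "env N D \<rho>" "length \<rho> = n"
    let ?x = "mor_tuple E D (take ?m (drop 0 \<rho>))"
    have "0 + ?m \<le> length \<rho>" using rec_zero \<rho>(3) by simp
    note x = tval_vars_tuple[OF \<rho>(1,2) this]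
    have r: "pmor (PRec f g) \<in> Hom E (Prod E (pow ?m) N) N"
      using prim_mor_hom[OF rec_zero(1)] by (simp del: prim_mor.simps)
    have "tval D \<rho> (AFun (PRec f g) (AZero # vars 0 ?m)) = pmor (PRec f g) \<bullet> pair E ?x (z \<bullet> bang E D)"
      using x(4) \<rho>(1) by (simp add: mor_tuple_Cons mor_tuple_Nil del: prim_mor.simps(5))
    \<comment> \<open>The tuple of parameters is pulled out to expose the zero equation. The
      recursion argument stands in the last component because tuples are built from the end of the
      list.\<close>
    also have "\<dots> = (pmor (PRec f g) \<bullet> pair E (Idt E (pow ?m)) (z \<bullet> bang E (pow ?m))) \<bullet> ?x"
      using r x(1-3) by (simp del: prim_mor.simps)
    also have "\<dots> = tval D \<rho> (AFun f (vars 0 ?m))"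
      unfolding prim_mor_PRec(1)[OF rec_zero(1)] using x(4) by simp
    finally show "tval D \<rho> (AFun (PRec f g) (AZero # vars 0 ?m)) = tval D \<rho> (AFun f (vars 0 ?m))" .
  qed (use wf in \<open>simp_all only: afm_wf.simps\<close>)
next
  case (rec_suc f g n)
  let ?m = "arity f"
  have wf: "afm_wf n (AEq (AFun (PRec f g) (ASuc (AVar 0) # vars 1 ?m))
      (AFun g (AVar 0 # AFun (PRec f g) (AVar 0 # vars 1 ?m) # vars 1 ?m)))"
    by (rule HA_axiom_wf, rule HA_axiom.rec_suc[OF rec_suc])
  show ?case
  proof (rule valid_AEq)
    fix D \<rho> assume \<rho>: "D \<in> Obj E" "env N D \<rho>" "length \<rho> = n"
    let ?x = "mor_tuple E D (take ?m (drop 1 \<rho>))" and ?y = "\<rho> ! 0" and ?r = "pmor (PRec f g)"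
    let ?p = "Fst E (pow ?m) N" and ?q = "Snd E (pow ?m) N"
    have "1 + ?m \<le> length \<rho>" using rec_suc \<rho>(3) by simp
    note x = tval_vars_tuple[OF \<rho>(1,2) this]
    have y: "?y \<in> Arr E" "Dom E ?y = D" "Cod E ?y = N" using env_nth[OF \<rho>(2), of 0] rec_suc \<rho>(3) by simp_all
    have r: "?r \<in> Arr E" "Dom E ?r = Prod E (pow ?m) N" "Cod E ?r = N"
      using prim_mor_hom[OF rec_suc(1)] by (simp_all del: prim_mor.simps)
    have g: "pmor g \<in> Arr E" "Dom E (pmor g) = Prod E (Prod E (pow ?m) N) N" "Cod E (pmor g) = N"
      using prim_mor_hom[of g] rec_suc(1) by simp_all
    have sy: "tval D \<rho> (ASuc (AVar 0)) = s \<bullet> ?y" using tval_ASuc[of D \<rho> "AVar 0"] y by simp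
    have "tval D \<rho> (AFun (PRec f g) (ASuc (AVar 0) # vars 1 ?m)) = ?r \<bullet> pair E ?x (s \<bullet> ?y)"
      unfolding tval.simps(2)[of D \<rho> "PRec f g"] list.map sy mor_tuple_Cons x(4) ..
    \<comment> \<open>Likewise the pair of parameters and recursion argument is pulled out to expose
      the successor equation.\<close>
    also have "\<dots> = (?r \<bullet> pair E ?p (s \<bullet> ?q)) \<bullet> pair E ?x ?y"
      using r x(1-3) y by (simp del: prim_mor.simps)
    also have "\<dots> = (pmor g \<bullet> pair E (pair E ?p ?r) ?q) \<bullet> pair E ?x ?y"
      unfolding prim_mor_PRec(2)[OF rec_suc(1)] ..
    also have "\<dots> = pmor g \<bullet> pair E (pair E ?x (?r \<bullet> pair E ?x ?y)) ?y"
      using g r x(1-3) y by (simp del: prim_mor.simps)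
    also have "\<dots> = tval D \<rho> (AFun g (AVar 0 # AFun (PRec f g) (AVar 0 # vars 1 ?m) # vars 1 ?m))"
      unfolding tval.simps list.map mor_tuple_Cons x(4) ..
    finally show "tval D \<rho> (AFun (PRec f g) (ASuc (AVar 0) # vars 1 ?m)) =
      tval D \<rho> (AFun g (AVar 0 # AFun (PRec f g) (AVar 0 # vars 1 ?m) # vars 1 ?m))" .
  qed (use wf in \<open>simp_all only: afm_wf.simps\<close>)
next
  case (induction n \<phi>)
  then show ?case by (rule valid_induction)
next
  case (gen n \<phi>)
  then show ?case using valid_gen HA_axiom_wf by blast
qed

end

section \<open>From validity at all stages to truth in the internal language\<close>

theorem theorem4p17:
  fixes E :: "('o, 'a) topos" and N :: 'o and z s :: 'a and n :: nat and \<phi> :: afm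
  assumes "elementary_topos E"
    and "nno E N z s"
    and "HA_axiom n \<phi>"
  shows "holds E (replicate n N)
    (TAll (pw E (pw E (Omega E))) (TImp (sub_Lop E 0)
      (TAll (pw E (Omega E)) (TImp (TMem (TVar 0) (Lop E))
        (force E N 1 0 (\<lambda>i. i + 2) (std E N z s n \<phi>))))))"
proof -
  interpret topos_nno E N z s
    using assms(1,2) by (intro topos_nno.intro topos_nno_axioms.intro)
  let ?X1 = "pw E (pw E \<Omega>)" and ?X2 = "pw E \<Omega>"
  let ?\<Gamma>0 = "replicate n N"
  let ?\<Gamma>1 = "?X1 # ?\<Gamma>0"
  let ?\<Gamma>2 = "?X2 # ?\<Gamma>1"
  \<comment> \<open>The binders of \<open>P\<close> and \<open>j\<close> lie on top of the
    \<open>n\<close> free variables: \<open>j\<close> is variable 0, \<open>P\<close> is variable 1,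
    and the others are raised by two.\<close>
  let ?v = "\<lambda>i. i + 2" and ?\<phi> = "ST n \<phi>"
  let ?G = "pow n"
  let ?G1 = "Prod E ?G ?X1"
  let ?G2 = "Prod E ?G1 ?X2"
  have wf: "lwf N n ?\<phi>" by (rule lwf_std[OF HA_axiom_wf[OF assms(3)]])
  have \<Gamma>: "set ?\<Gamma>0 \<subseteq> Obj E" "set ?\<Gamma>1 \<subseteq> Obj E" "set ?\<Gamma>2 \<subseteq> Obj E" by auto
  have v: "\<forall>i<n. ?v i < length ?\<Gamma>2 \<and> ?\<Gamma>2 ! ?v i = N" by simp
  have typed: "typed E ?\<Gamma>0 (TAll ?X1 (TImp (sub_Lop E 0) (TAll ?X2 (TImp (TMem (TVar 0) (Lop E))
      (force E N 1 0 ?v ?\<phi>))))) \<Omega>"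
    by (intro typed.intros(12,13) typed_sub_Lop typed_mem_Lop typed_force[OF wf]) auto
  let ?P = "proj E ?\<Gamma>2 1" and ?j = "proj E ?\<Gamma>2 0" and ?r = "vals ?\<Gamma>2 ?v n"
  let ?A = "lops_val ?G1 (Snd E ?G ?X1)" and ?B = "lop_val ?G2 (Snd E ?G1 ?X2)"
    and ?C = "fval N ?G2 ?P ?j ?r ?\<phi>"
  have obj: "?X1 \<in> Obj E" "?X2 \<in> Obj E" "?G \<in> Obj E" "?G1 \<in> Obj E" "?G2 \<in> Obj E" by simp_all
  have r: "env N ?G2 ?r" "length ?r = n" using env_vals[OF \<Gamma>(3) v] by (simp_all add: vals_def)
  have st: "stage N ?G2 ?P ?j ?r" using r by (simp add: stage_def)
  have wf': "lwf N (length ?r) ?\<phi>" using wf r(2) by simp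
  have B: "?B \<in> Hom E ?G2 \<Omega>" by simp
  have C: "?C \<in> Hom E ?G2 \<Omega>" using fval_hom[OF wf' st] by simp
  have A: "?A \<in> Hom E ?G1 \<Omega>" by simp
  let ?I = "sub_all E ?G1 ?X2 (sub_imp E ?G2 ?B ?C)"
  have BC: "sub_imp E ?G2 ?B ?C \<in> Hom E ?G2 \<Omega>" using B C by simp
  have I: "?I \<in> Hom E ?G1 \<Omega>" using BC obj by simp
  have sem: "sem E ?\<Gamma>0 (TAll ?X1 (TImp (sub_Lop E 0) (TAll ?X2 (TImp (TMem (TVar 0) (Lop E))
      (force E N 1 0 ?v ?\<phi>))))) = sub_all E ?G ?X1 (sub_imp E ?G1 ?A ?I)"
  proof -
    have "sem E ?\<Gamma>2 (force E N 1 0 ?v ?\<phi>) = ?C"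
      using sem_force[OF wf _ \<Gamma>(3), of 1 0 ?v] v by simp
    moreover have "sem E ?\<Gamma>2 (TMem (TVar 0) (Lop E)) = ?B"
      using sem_mem_Lop[OF \<Gamma>(3), of 0] by simp
    moreover have "sem E ?\<Gamma>1 (sub_Lop E 0) = ?A"
      using sem_sub_Lop[OF \<Gamma>(2), of 0] by simp
    ultimately show ?thesis by (simp del: sem.simps(6))
  qed
  \<comment> \<open>Unfolding the quantifiers and implications changes the stage repeatedly: to
    \<open>D\<close> for \<open>P\<close>, to \<open>D'\<close> for \<open>j\<close>, to
    \<open>D''\<close> for the assumption on \<open>j\<close>. At the last stage the restrictions of
    \<open>P\<close> and \<open>j\<close> satisfy \<open>lops\<close> and \<open>lop\<close>, so
    validity applies.\<close>
  have "tr (sub_all E ?G ?X1 (sub_imp E ?G1 ?A ?I))"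
    unfolding tr_sub_all_imp[OF obj(1,3) A I]
  proof (intro allI impI)
    fix D f P assume f: "f \<in> Hom E D ?G" "P \<in> Hom E D ?X1" and tA: "tr (?A \<bullet> pair E f P)"
    let ?h = "pair E f P"
    have h: "?h \<in> Hom E D ?G1" using f by simp
    have "?A \<bullet> ?h = lops_val D P" using f obj by simp
    then have lops: "lops D P" using tr_lops_val[OF _ f(2)] tA by simp
    show "tr (?I \<bullet> ?h)"
      unfolding sub_all_eq(2)[OF obj(2,4) BC] sub_all_eq(3)[OF obj(2,4) BC h]
    proof (intro allI impI)
      fix D' k j assume k: "k \<in> Hom E D' D" "j \<in> Hom E D' ?X2"
      let ?w = "pair E (?h \<bullet> k) j"
      have w: "?w \<in> Hom E D' ?G2" using h k by simp
      show "tr (sub_imp E ?G2 ?B ?C \<bullet> ?w)"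
        unfolding sub_imp_eq(2)[OF B C] sub_imp_eq(3)[OF B C w]
      proof (intro allI impI)
        fix D'' l assume l: "l \<in> Hom E D'' D'" and tB: "tr (?B \<bullet> ?w \<bullet> l)"
        have D'': "D'' \<in> Obj E" using l by auto
        have kl: "k \<bullet> l \<in> Hom E D'' D" using k l by simp
        have jl: "j \<bullet> l \<in> Hom E D'' ?X2" using k l by simp
        have wl: "?w \<bullet> l \<in> Hom E D'' ?G2" using w l by (simp del: pair_cmp)
        have "?B \<bullet> ?w \<bullet> l = lop_val D'' (j \<bullet> l)" using f k l obj by simp
        then have lop: "lop D'' (j \<bullet> l)" using tr_lop_val[OF _ jl] tB by simp
        have P: "?P \<bullet> ?w \<bullet> l = P \<bullet> k \<bullet> l" and j: "?j \<bullet> ?w \<bullet> l = j \<bullet> l" using f k l obj by simp_all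
        have "?C \<bullet> ?w \<bullet> l = fval N D'' (P \<bullet> k \<bullet> l) (j \<bullet> l) (shift (?w \<bullet> l) ?r) ?\<phi>"
          unfolding fval_cmp[OF wf' st wl] P j ..
        moreover have "stage N D'' (P \<bullet> k \<bullet> l) (j \<bullet> l) (shift (?w \<bullet> l) ?r)"
          using stage_cmp[OF st wl jl] unfolding P .
        moreover have "lops D'' (P \<bullet> k \<bullet> l)" using lops_cmp[OF lops f(2) kl] .
        ultimately show "tr (?C \<bullet> ?w \<bullet> l)"
          using HA_axiom_valid[OF assms(3), unfolded valid_def] lop r(2) length_shift[of "?w \<bullet> l" ?r] by metis
      qed
    qed
  qed
  then have "sub_all E ?G ?X1 (sub_imp E ?G1 ?A ?I) = true_at E ?G"
    using A I obj by (simp add: tr_def)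
  then show ?thesis unfolding holds_def using typed sem by simp
qed

end
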